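(* Let $\psi$ be a conformal map on the unit disk $\mathbb{D}$ with $\psi(0)=0$, and for $\alpha>0$ let $F_\alpha=\{z\in\mathbb{D}:|\psi(z)|=\alpha\}$. Suppose that the limit $$L:=\lim_{\alpha\to+\infty}\frac{\log\left(\omega_{\mathbb{D}}(0,F_\alpha)^{-1}\right)}{\log\alpha}$$ exists in $[0,+\infty]$. For each $\alpha>0$ let $F_\alpha^*$ be a component of $F_\alpha$ of maximal harmonic measure at $0$ among the components of $F_\alpha$. Then the limit $$\mu:=\lim_{\alpha\to+\infty}\frac{d_{\mathbb{D}}(0,F_\alpha)}{\log\alpha}$$ exists in $[0,+\infty]$ if and only if $$\limsup_{\alpha\to+\infty}\frac{\log\left(\omega_{\mathbb{D}}(0,F_\alpha^* )^{-1}\right)}{\log\alpha}=L.$$ Moreover, in case $\mu$ exists, $\mu=L$.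
   Context: A conformal map on $\mathbb{D}=\{z\in\mathbb{C}:|z|<1\}$ is an injective holomorphic function $\psi:\mathbb{D}\to\mathbb{C}$. Hyperbolic distance: for $z,w\in\mathbb{D}$, $d_{\mathbb{D}}(z,w)=\log\frac{1+\left|\frac{z-w}{1-z\bar w}\right|}{1-\left|\frac{z-w}{1-z\bar w}\right|}$; for a set $E\subset\mathbb{D}$, $d_{\mathbb{D}}(z,E)=\inf\{d_{\mathbb{D}}(z,w):w\in E\}$ (with $\inf\emptyset=+\infty$). Harmonic measure: for a domain $D$, $z\in D$ and a Borel set $E\subset\overline{D}$, $\omega_D(z,E)$ denotes the harmonic measure at $z$ of $E$ with respect to the component of $D\setminus E$ containing $z$; i.e. $\omega_D(\cdot,E)$ is the solution of the generalized Dirichlet problem in that component with boundary data $1_E$. Maximal components: $N(\alpha)\in\mathbb{N}\cup\{+\infty\}$ is the number of connected components of $F_\alpha$, and $F_\alpha^i$, $i=1,2,\ldots,N(\alpha)$, are these components. The maximum $\max\{\omega_{\mathbb{D}}(0,F_\alpha^i):i\in\{1,2,\ldots,N(\alpha)\}\}$ exists, and $F_\alpha^*$ denotes a component of $F_\alpha$ with $$\omega_{\mathbb{D}}(0,F_\alpha^* )=\max\{\omega_{\mathbb{D}}(0,F_\alpha^i):i\in\{1,2,\ldots,N(\alpha)\}\}.$$ If $F_\alpha=\emptyset$, set $F_\alpha^*=\emptyset$; the harmonic measure of the empty set is $0$, and $\log(0^{-1})=+\infty$. *)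

theory Defs
  imports "HOL-Complex_Analysis.Complex_Analysis"
begin

abbreviation unit_disk :: "complex set" where
  "unit_disk \<equiv> ball 0 1"

definition conformal_map :: "(complex \<Rightarrow> complex) \<Rightarrow> bool" where
  "conformal_map \<psi> \<longleftrightarrow> \<psi> holomorphic_on unit_disk \<and> inj_on \<psi> unit_disk"

definition hyp_dist :: "complex \<Rightarrow> complex \<Rightarrow> real" where
  "hyp_dist z w =
     ln ((1 + cmod ((z - w) / (1 - z * cnj w))) / (1 - cmod ((z - w) / (1 - z * cnj w))))"

text \<open>The infimum is taken in the extended reals, so the distance to the empty set is \<open>\<infinity>\<close>.\<close>

definition hyp_dist_set :: "complex \<Rightarrow> complex set \<Rightarrow> ereal" where
  "hyp_dist_set z E = (INF w\<in>E. ereal (hyp_dist z w))"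

text \<open>
  The integral mean of \<open>u\<close> over the circle of centre \<open>w\<close> and radius \<open>r\<close>, as the difference of
  the integrals of the positive and negative parts (\<open>e2ennreal\<close> sends negative numbers to \<open>0\<close>).
  An upper semicontinuous function is bounded above on the circle, so the first integral is
  finite and the mean is a well-defined element of \<open>[-\<infinity>, \<infinity>)\<close>.
\<close>

definition circle_mean :: "(complex \<Rightarrow> ereal) \<Rightarrow> complex \<Rightarrow> real \<Rightarrow> ereal" where
  "circle_mean u w r =
     (enn2ereal (\<integral>\<^sup>+t\<in>{0..2*pi}. e2ennreal (u (w + of_real r * cis t)) \<partial>lborel)
      - enn2ereal (\<integral>\<^sup>+t\<in>{0..2*pi}. e2ennreal (- u (w + of_real r * cis t)) \<partial>lborel))
     / ereal (2 * pi)"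

text \<open>
  Subharmonic functions with values in \<open>[-\<infinity>, \<infinity>)\<close> on an open set: upper semicontinuity
  and the local submean inequality. The function that is constantly \<open>-\<infinity>\<close> is included.
\<close>

definition subharmonic_on :: "(complex \<Rightarrow> ereal) \<Rightarrow> complex set \<Rightarrow> bool" where
  "subharmonic_on u \<Omega> \<longleftrightarrow>
     (\<forall>z\<in>\<Omega>. u z < \<infinity>) \<and>
     (\<forall>a::real. open {z\<in>\<Omega>. u z < ereal a}) \<and>
     (\<forall>w\<in>\<Omega>. \<exists>\<rho>>0. \<forall>r. 0 < r \<and> r < \<rho> \<longrightarrow> u w \<le> circle_mean u w r)"

text \<open>
  The Perron solution of the generalized Dirichlet problem on a bounded open set \<open>\<Omega>\<close> with
  boundary data \<open>\<phi>\<close>.  For unbounded \<open>\<Omega>\<close> the point at infinity would have to be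
  treated as a boundary point as well.
\<close>

definition perron_solution :: "complex set \<Rightarrow> (complex \<Rightarrow> real) \<Rightarrow> complex \<Rightarrow> ereal" where
  "perron_solution \<Omega> \<phi> z =
     (SUP u\<in>{u. subharmonic_on u \<Omega> \<and>
               (\<forall>\<zeta>\<in>frontier \<Omega>. Limsup (at \<zeta> within \<Omega>) u \<le> ereal (\<phi> \<zeta>))}. u z)"

text \<open>
  Harmonic measure, for a bounded domain \<open>D\<close>, a Borel set \<open>E \<subseteq> closure D\<close> that is
  relatively closed in \<open>D\<close>, and a point \<open>z \<in> D - E\<close>.
  Since the boundary data lie in \<open>[0, 1]\<close>, so does the Perron solution
  (maximum principle), and the conversion to a real number loses nothing.
\<close>

definition harmonic_measure :: "complex set \<Rightarrow> complex \<Rightarrow> complex set \<Rightarrow> real" where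
  "harmonic_measure D z E =
     real_of_ereal (perron_solution (connected_component_set (D - E) z) (indicat_real E) z)"

definition level_set :: "(complex \<Rightarrow> complex) \<Rightarrow> real \<Rightarrow> complex set" where
  "level_set \<psi> \<alpha> = {z\<in>unit_disk. cmod (\<psi> z) = \<alpha>}"

definition is_max_component :: "(complex \<Rightarrow> complex) \<Rightarrow> real \<Rightarrow> complex set \<Rightarrow> bool" where
  "is_max_component \<psi> \<alpha> C \<longleftrightarrow>
     (if level_set \<psi> \<alpha> = {} then C = {}
      else C \<in> components (level_set \<psi> \<alpha>) \<and>
           (\<forall>C'\<in>components (level_set \<psi> \<alpha>).
              harmonic_measure unit_disk 0 C' \<le> harmonic_measure unit_disk 0 C))"

text \<open>\<open>log (x\<inverse>)\<close> for \<open>x \<ge> 0\<close>, with the convention \<open>log (0\<inverse>) = \<infinity>\<close>.\<close>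

definition log_inverse :: "real \<Rightarrow> ereal" where
  "log_inverse x = (if x = 0 then \<infinity> else ereal (ln (inverse x)))"

end

theory Submission
  imports Defs
begin

text \<open>
  Write \<open>A(\<alpha>)\<close>, \<open>B(\<alpha>)\<close>, \<open>D(\<alpha>)\<close> for \<open>log (1/\<omega>(0, F\<^sub>\<alpha>))\<close>,
  \<open>log (1/\<omega>(0, F\<^sub>\<alpha>*))\<close> and the hyperbolic distance of \<open>0\<close> from \<open>F\<^sub>\<alpha>\<close>. For large
  \<open>\<alpha>\<close> we have \<open>A(\<alpha>) \<le> B(\<alpha>) \<le> D(\<alpha>) + C\<close> and \<open>D(\<alpha>) \<le> A(c \<alpha>) + C\<close> with constants \<open>c\<close>, \<open>C\<close>.
  Hence, once \<open>A(\<alpha>) / log \<alpha>\<close> converges to \<open>L\<close>, so do the other two quotients, and both sides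
  of the equivalence are true.

  The bound \<open>B(\<alpha>) \<le> D(\<alpha>) + C\<close>: the component of \<open>F\<^sub>\<alpha>\<close> through a point \<open>w\<close> runs from \<open>w\<close> to the unit circle,
  because the image of the disk contains no large circle around \<open>0\<close>. It therefore carries a measure
  whose radial projection is uniform on an interval of length \<open>(1 - |w|) / 2\<close>, and the Green
  potential of this measure bounds the harmonic measure from below by a multiple of \<open>1 - |w|\<close>.

  The bound \<open>D(\<alpha>) \<le> A(c \<alpha>) + C\<close>: let \<open>a\<close> be an omitted value of \<open>\<psi>\<close>. No two values of \<open>f = log (\<psi> - a)\<close>
  differ by a nonzero multiple of \<open>2 \<pi> \<i>\<close>, so the part of the image of \<open>f\<close> in a vertical strip of width \<open>1\<close> has
  area at most \<open>2 \<pi>\<close>. By the length-area method, the rays along which \<open>Re f\<close> exceeds its maximum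
  on \<open>|z| \<le> \<rho>\<close> by more than \<open>1\<close> form a set of measure at most \<open>2 \<pi> log (1/\<rho>)\<close>. By Bloch's theorem
  \<open>(1 - |z|) |f'(z)|\<close> is bounded, so the Poisson integral of the indicator function of this set is
  bounded below on \<open>F\<^bsub>c\<alpha>\<^esub>\<close>; a multiple of it is a majorant of the harmonic measure.
\<close>

subsection \<open>Circle averages and the mean value property\<close>

text \<open>A Bochner integral, in contrast to \<open>circle_mean\<close>, so that linearity and
  Fubini's theorem apply directly; \<open>circle_mean_ereal\<close> identifies the two for
  continuous functions.\<close>

definition circle_avg :: "(complex \<Rightarrow> real) \<Rightarrow> complex \<Rightarrow> real \<Rightarrow> real" where
  "circle_avg g w r = (LINT t:{0..2*pi}|lborel. g (w + of_real r * cis t)) / (2 * pi)"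

text \<open>Harmonicity is encoded by the mean value property: this form passes through integrals
  over a parameter, and it is what the comparison principle uses.\<close>

definition mean_value_on :: "(complex \<Rightarrow> real) \<Rightarrow> complex set \<Rightarrow> bool" where
  "mean_value_on g S \<longleftrightarrow>
     continuous_on S g \<and> (\<forall>w r. 0 < r \<and> cball w r \<subseteq> S \<longrightarrow> circle_avg g w r = g w)"

lemma mean_value_on_subset: "mean_value_on g S \<Longrightarrow> T \<subseteq> S \<Longrightarrow> mean_value_on g T"
  unfolding mean_value_on_def by (meson continuous_on_subset order_trans)

lemma circle_point_in_sphere: "0 \<le> r \<Longrightarrow> w + of_real r * cis t \<in> sphere w r"
  by (simp add: dist_norm norm_mult)

lemma continuous_on_circle:
  assumes "continuous_on (sphere w r) g" "0 \<le> r"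
  shows "continuous_on A (\<lambda>t. g (w + of_real r * cis t))"
  by (rule continuous_on_compose2[OF assms(1)])
     (use assms(2) circle_point_in_sphere in \<open>auto intro!: continuous_intros\<close>)

lemma set_integrable_circle:
  fixes g :: "complex \<Rightarrow> real"
  assumes "continuous_on (sphere w r) g" "0 \<le> r"
  shows "set_integrable lborel {0..2*pi} (\<lambda>t. g (w + of_real r * cis t))"
  by (rule borel_integrable_atLeastAtMost') (rule continuous_on_circle[OF assms])

lemma circle_mean_ereal:
  fixes g :: "complex \<Rightarrow> real"
  assumes "continuous_on (sphere w r) g" "0 \<le> r"
  shows "circle_mean (\<lambda>z. ereal (g z)) w r = ereal (circle_avg g w r)"
proof -
  define G where "G t = indicat_real {0..2*pi} t *\<^sub>R g (w + of_real r * cis t)" for t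
  have int: "integrable lborel G"
    using set_integrable_circle[OF assms] by (simp add: set_integrable_def G_def[abs_def])
  define P where "P = (\<integral>\<^sup>+t. ennreal (G t) \<partial>lborel)"
  define N where "N = (\<integral>\<^sup>+t. ennreal (- G t) \<partial>lborel)"
  have fin: "P \<noteq> \<infinity>" "N \<noteq> \<infinity>"
    using int by (auto simp: real_integrable_def P_def N_def)
  have e0: "e2ennreal 0 = 0" using e2ennreal_ereal[of 0] by (simp add: zero_ereal_def)
  have "(\<integral>\<^sup>+t\<in>{0..2*pi}. e2ennreal (ereal (g (w + of_real r * cis t))) \<partial>lborel) = P"
    unfolding P_def G_def by (intro nn_integral_cong) (auto simp: indicator_def e2ennreal_ereal e0)
  moreover have "(\<integral>\<^sup>+t\<in>{0..2*pi}. e2ennreal (- ereal (g (w + of_real r * cis t))) \<partial>lborel) = N"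
    unfolding N_def G_def by (intro nn_integral_cong) (auto simp: indicator_def e2ennreal_ereal e0)
  moreover have "integral\<^sup>L lborel G = enn2real P - enn2real N"
    using real_lebesgue_integral_def[OF int] by (simp add: P_def N_def)
  moreover have "enn2ereal X = ereal (enn2real X)" if "X \<noteq> \<infinity>" for X
    using that by (cases X) (simp_all add: enn2ereal_ennreal)
  note this[OF fin(1)] this[OF fin(2)]
  ultimately show ?thesis
    by (simp add: circle_mean_def circle_avg_def set_lebesgue_integral_def G_def[abs_def])
qed

lemma circle_mean_mono:
  assumes "\<And>t. u (w + of_real r * cis t) \<le> v (w + of_real r * cis t)"
  shows "circle_mean u w r \<le> circle_mean v w r"
proof -
  have *: "enn2ereal (\<integral>\<^sup>+t\<in>{0..2*pi}. e2ennreal (u (w + of_real r * cis t)) \<partial>lborel)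
      \<le> enn2ereal (\<integral>\<^sup>+t\<in>{0..2*pi}. e2ennreal (v (w + of_real r * cis t)) \<partial>lborel)"
    unfolding less_eq_ennreal.rep_eq[symmetric]
    by (intro nn_integral_mono mult_right_mono e2ennreal_mono assms) auto
  have "enn2ereal (\<integral>\<^sup>+t\<in>{0..2*pi}. e2ennreal (- v (w + of_real r * cis t)) \<partial>lborel)
      \<le> enn2ereal (\<integral>\<^sup>+t\<in>{0..2*pi}. e2ennreal (- u (w + of_real r * cis t)) \<partial>lborel)"
    unfolding less_eq_ennreal.rep_eq[symmetric]
    by (intro nn_integral_mono mult_right_mono e2ennreal_mono) (auto simp: assms)
  with * show ?thesis
    unfolding circle_mean_def by (intro ereal_divide_right_mono ereal_minus_mono) auto
qed

text \<open>Cauchy's integral formula at the centre of the circle. After parametrisation by the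
  angle, the factor \<open>of_real r * cis t\<close> of the line element cancels the denominator and
  leaves the average of \<open>f\<close>.\<close>

lemma mean_value_onI_Re:
  assumes "f holomorphic_on S" "open S"
  shows "mean_value_on (\<lambda>z. Re (f z)) S"
  unfolding mean_value_on_def
proof (intro conjI allI impI)
  show "continuous_on S (\<lambda>z. Re (f z))"
    by (intro continuous_intros holomorphic_on_imp_continuous_on assms)
  fix w r assume wr: "0 < (r::real) \<and> cball w r \<subseteq> S"
  have hol: "f holomorphic_on cball w r" using assms wr holomorphic_on_subset by blast
  have cont: "continuous_on (sphere w r) f"
    using hol by (meson holomorphic_on_imp_continuous_on continuous_on_subset sphere_cball)
  have "((\<lambda>u. f u / (u - w)) has_contour_integral (2 * of_real pi * \<i> * f w)) (circlepath w r)"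
    using Cauchy_integral_circlepath_simple[of f w r w] hol wr by simp
  then have "contour_integral (part_circlepath w r 0 (2*pi)) (\<lambda>u. f u / (u - w)) = 2 * of_real pi * \<i> * f w"
    by (simp add: contour_integral_unique circlepath_def)
  then have "integral {0..2*pi} (\<lambda>t. f (w + of_real r * cis t) / (of_real r * cis t) * of_real r * \<i> * cis t)
     = 2 * of_real pi * \<i> * f w"
    by (subst (asm) contour_integral_part_circlepath_eq) (use wr in \<open>auto simp: mult_ac\<close>)
  also have "(\<lambda>t. f (w + of_real r * cis t) / (of_real r * cis t) * of_real r * \<i> * cis t)
     = (\<lambda>t. f (w + of_real r * cis t) * \<i>)"
    using wr by (auto simp: fun_eq_iff field_simps)
  finally have "\<i> * integral {0..2*pi} (\<lambda>t. f (w + of_real r * cis t)) = \<i> * (2 * of_real pi * f w)"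
    by (simp add: mult_ac)
  then have I: "integral {0..2*pi} (\<lambda>t. f (w + of_real r * cis t)) = 2 * of_real pi * f w"
    by simp
  have "set_integrable lborel {0..2*pi} (\<lambda>t. f (w + of_real r * cis t))"
    by (rule borel_integrable_atLeastAtMost') (rule continuous_on_circle, use cont wr in auto)
  then have i: "(\<lambda>t. f (w + of_real r * cis t)) integrable_on {0..2*pi}"
    by (rule set_borel_integral_eq_integral(1))
  have "set_integrable lborel {0..2*pi} (\<lambda>t. Re (f (w + of_real r * cis t)))"
    using set_integrable_circle[of w r "\<lambda>z. Re (f z)"] cont wr by (auto intro!: continuous_intros)
  then have "(LINT t:{0..2*pi}|lborel. Re (f (w + of_real r * cis t))) = integral {0..2*pi} (\<lambda>t. Re (f (w + of_real r * cis t)))"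
    by (rule set_borel_integral_eq_integral(2))
  also have "\<dots> = Re (integral {0..2*pi} (\<lambda>t. f (w + of_real r * cis t)))"
    using integral_linear[OF i bounded_linear_Re] by (simp add: o_def)
  also have "\<dots> = 2 * pi * Re (f w)" unfolding I by simp
  finally show "circle_avg (\<lambda>z. Re (f z)) w r = Re (f w)" by (simp add: circle_avg_def)
qed

lemma mean_value_on_const: "mean_value_on (\<lambda>z. c) S"
  using mean_value_onI_Re[of "\<lambda>z. of_real c" UNIV]
  by (auto simp: mean_value_on_def holomorphic_on_const)

text \<open>Locally the function is the real part of a holomorphic logarithm of \<open>F\<close>. A
  logarithm on all of \<open>S\<close> may fail to exist, so one is taken on a ball slightly larger
  than the given closed disk.\<close>

lemma mean_value_on_ln_norm:
  assumes "F holomorphic_on S" "open S" "\<And>z. z \<in> S \<Longrightarrow> F z \<noteq> 0"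
  shows "mean_value_on (\<lambda>z. ln (cmod (F z))) S"
  unfolding mean_value_on_def
proof (intro conjI allI impI)
  show "continuous_on S (\<lambda>z. ln (cmod (F z)))"
    using assms by (intro continuous_intros holomorphic_on_imp_continuous_on) auto
  fix w r assume wr: "0 < (r::real) \<and> cball w r \<subseteq> S"
  obtain e where e: "e > 0" "(\<Union>x\<in>cball w r. ball x e) \<subseteq> S"
    using compact_subset_open_imp_ball_epsilon_subset[of "cball w r" S] wr assms(2) by auto
  have sub: "ball w (r + e) \<subseteq> S"
  proof
    fix z assume z: "z \<in> ball w (r + e)"
    show "z \<in> S"
    proof (cases "z \<in> cball w r")
      case False
      \<comment> \<open>The radial projection of \<open>z\<close> to the circle; its distance from
        \<open>z\<close> is less than the margin \<open>e\<close> that compactness provides.\<close>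
      define x where "x = w + of_real (r / cmod (z - w)) * (z - w)"
      have nz: "cmod (z - w) > r" using False by (simp add: dist_norm norm_minus_commute)
      have "x \<in> cball w r" using nz wr by (auto simp: x_def dist_norm norm_mult norm_divide)
      have "z - x = of_real (1 - r / cmod (z - w)) * (z - w)" by (simp add: x_def algebra_simps)
      then have "cmod (z - x) = \<bar>1 - r / cmod (z - w)\<bar> * cmod (z - w)"
        by (metis norm_mult norm_of_real)
      also have "\<dots> = cmod (z - w) - r"
      proof -
        have "r / cmod (z - w) \<le> 1" "cmod (z - w) > 0" using nz wr by (auto simp: divide_le_eq)
        then show ?thesis by (simp add: field_simps)
      qed
      finally have "z \<in> ball x e"
        using z by (simp add: dist_norm norm_minus_commute)
      then show ?thesis using e \<open>x \<in> cball w r\<close> by blast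
    qed (use wr in auto)
  qed
  obtain g where g: "g holomorphic_on ball w (r+e)" "\<And>z. z \<in> ball w (r+e) \<Longrightarrow> exp (g z) = F z"
  proof (rule holomorphic_logarithm_exists[of "ball w (r+e)" F w])
    show "F holomorphic_on ball w (r+e)" using assms(1) sub holomorphic_on_subset by blast
  qed (use assms(3) sub wr e in auto)
  have eq: "ln (cmod (F z)) = Re (g z)" if "z \<in> ball w (r+e)" for z
    by (simp flip: g(2)[OF that])
  have "circle_avg (\<lambda>z. Re (g z)) w r = Re (g w)"
  proof -
    have "cball w r \<subseteq> ball w (r + e)" using e by auto
    then show ?thesis using mean_value_onI_Re[OF g(1)] wr by (simp add: mean_value_on_def)
  qed
  moreover have "circle_avg (\<lambda>z. Re (g z)) w r = circle_avg (\<lambda>z. ln (cmod (F z))) w r"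
    unfolding circle_avg_def
    using eq wr e by (intro arg_cong2[where f="(/)"] set_lebesgue_integral_cong) (auto simp: dist_norm norm_mult)
  ultimately show "circle_avg (\<lambda>z. ln (cmod (F z))) w r = ln (cmod (F w))"
    using eq wr e by simp
qed

text \<open>Continuity follows by dominated convergence and the mean value property by Fubini's
  theorem; the bound on compact sets supplies the dominating constant in both.\<close>

lemma mean_value_on_integral:
  fixes K :: "complex \<Rightarrow> complex \<Rightarrow> real" and \<zeta> :: "'a \<Rightarrow> complex"
  assumes S: "open S" and M: "finite_measure M" and \<zeta>: "\<zeta> \<in> measurable M borel"
    and Z: "Z \<in> sets borel" "\<And>s. s \<in> space M \<Longrightarrow> \<zeta> s \<in> Z"
    and cont: "continuous_on (S \<times> Z) (\<lambda>(z, \<xi>). K z \<xi>)"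
    and mv: "\<And>\<xi>. \<xi> \<in> Z \<Longrightarrow> mean_value_on (\<lambda>z. K z \<xi>) S"
    and bd: "\<And>C. compact C \<Longrightarrow> C \<subseteq> S \<Longrightarrow> \<exists>B. \<forall>z\<in>C. \<forall>\<xi>\<in>Z. \<bar>K z \<xi>\<bar> \<le> B"
  shows "mean_value_on (\<lambda>z. \<integral>s. K z (\<zeta> s) \<partial>M) S"
proof -
  interpret M: finite_measure M by fact
  have SB: "S \<in> sets borel" using S by simp
  have SZ: "S \<times> Z \<in> sets borel" using pair_measureI[OF SB Z(1)] unfolding borel_prod .
  \<comment> \<open>Extension by zero turns a kernel that is continuous on
    \<open>S \<times> Z\<close> into a globally Borel function, which can be composed with
    measurable maps.\<close>
  define KK where "KK p = indicator (S \<times> Z) p *\<^sub>R (case p of (z, \<xi>) \<Rightarrow> K z \<xi>)" for p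
  have KK: "KK \<in> borel_measurable borel"
    unfolding KK_def by (rule borel_measurable_continuous_on_indicator[OF SZ cont])
  have KKeq: "KK (z, \<zeta> s) = K z (\<zeta> s)" if "z \<in> S" "s \<in> space M" for z s
    using that Z by (simp add: KK_def)
  have meas: "(\<lambda>s. K z (\<zeta> s)) \<in> borel_measurable M" if "z \<in> S" for z
  proof -
    have "(\<lambda>s. KK (z, \<zeta> s)) \<in> borel_measurable M"
      by (rule measurable_compose[OF _ KK]) (use \<zeta> in \<open>simp flip: borel_prod\<close>)
    then show ?thesis

      by (subst measurable_cong[where g="\<lambda>s. KK (z, \<zeta> s)"]) (use that KKeq in auto)
  qed
  have "isCont (\<lambda>z. \<integral>s. K z (\<zeta> s) \<partial>M) w" if w: "w \<in> S" for w
    unfolding continuous_at_sequentially o_def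
  proof (intro allI impI)
    fix x assume x: "x \<longlonglongrightarrow> w"
    obtain e where e: "e > 0" "cball w e \<subseteq> S" using S w open_contains_cball by blast
    obtain B where B: "\<And>z \<xi>. z \<in> cball w e \<Longrightarrow> \<xi> \<in> Z \<Longrightarrow> \<bar>K z \<xi>\<bar> \<le> B" using bd[OF compact_cball e(2)] by (metis (no_types))
    have "eventually (\<lambda>n. x n \<in> ball w e) sequentially"
      using x e by (intro topological_tendstoD) auto
    \<comment> \<open>Dropping the first \<open>N\<close> terms keeps the sequence in the ball on
      which the kernel is bounded by \<open>B\<close>.\<close>
    then obtain N where N: "\<And>n. n \<ge> N \<Longrightarrow> x n \<in> ball w e" by (auto simp: eventually_sequentially)
    have xS: "x (n + N) \<in> S" "x (n + N) \<in> cball w e" for n using N[of "n+N"] e by auto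
    have "(\<lambda>n. \<integral>s. K (x (n + N)) (\<zeta> s) \<partial>M) \<longlonglongrightarrow> (\<integral>s. K w (\<zeta> s) \<partial>M)"
    proof (rule integral_dominated_convergence[where w="\<lambda>_. B"])
      show "AE s in M. (\<lambda>n. K (x (n + N)) (\<zeta> s)) \<longlonglongrightarrow> K w (\<zeta> s)"
      proof (rule AE_I2)
        fix s assume "s \<in> space M"
        then have "continuous_on S (\<lambda>z. K z (\<zeta> s))" using mv Z by (auto simp: mean_value_on_def)
        then have "isCont (\<lambda>z. K z (\<zeta> s)) w" using S w continuous_on_eq_continuous_at by blast
        then show "(\<lambda>n. K (x (n + N)) (\<zeta> s)) \<longlonglongrightarrow> K w (\<zeta> s)"
          by (rule isCont_tendsto_compose) (rule LIMSEQ_ignore_initial_segment[OF x])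
      qed
    qed (use xS meas w B Z in auto)
    then show "(\<lambda>n. \<integral>s. K (x n) (\<zeta> s) \<partial>M) \<longlonglongrightarrow> (\<integral>s. K w (\<zeta> s) \<partial>M)"
      by (rule LIMSEQ_offset)
  qed
  moreover have "circle_avg (\<lambda>z. \<integral>s. K z (\<zeta> s) \<partial>M) w r = (\<integral>s. K w (\<zeta> s) \<partial>M)"
    if wr: "0 < r" "cball w r \<subseteq> S" for w r
  proof -
    define N where "N = restrict_space lborel {0..2*pi}"
    have spN: "space N = {0..2*pi}" by (simp add: N_def space_restrict_space)
    interpret N: finite_measure N
      by standard (simp add: N_def emeasure_restrict_space space_restrict_space)
    interpret P: pair_sigma_finite N M ..
    define c where "c t = w + of_real r * cis t" for t
    have cN: "c \<in> measurable N borel"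
    proof -
      have "c \<in> borel_measurable borel"
        unfolding c_def by (intro borel_measurable_continuous_onI continuous_intros)
      then show ?thesis unfolding N_def by (intro measurable_restrict_space1) simp
    qed
    have cS: "c t \<in> S" "c t \<in> cball w r" for t
      using wr circle_point_in_sphere[of r w t] by (auto simp: c_def)
    obtain B where B: "\<And>z \<xi>. z \<in> cball w r \<Longrightarrow> \<xi> \<in> Z \<Longrightarrow> \<bar>K z \<xi>\<bar> \<le> B" using bd[OF compact_cball wr(2)] by (metis (no_types))
    have "(\<lambda>(t, s). KK (c t, \<zeta> s)) \<in> borel_measurable (N \<Otimes>\<^sub>M M)"
    proof -
      have "(\<lambda>p. (c (fst p), \<zeta> (snd p))) \<in> measurable (N \<Otimes>\<^sub>M M) (borel \<Otimes>\<^sub>M borel)"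
        using cN \<zeta> by measurable
      then have "(\<lambda>p. KK (c (fst p), \<zeta> (snd p))) \<in> borel_measurable (N \<Otimes>\<^sub>M M)"
        using KK by (intro measurable_compose[OF _ KK]) (simp add: borel_prod)
      then show ?thesis by (simp add: case_prod_unfold)
    qed
    then have m: "(\<lambda>(t, s). K (c t) (\<zeta> s)) \<in> borel_measurable (N \<Otimes>\<^sub>M M)"

    proof (subst measurable_cong)
      fix p assume "p \<in> space (N \<Otimes>\<^sub>M M)"
      then show "(case p of (t, s) \<Rightarrow> K (c t) (\<zeta> s)) = (case p of (t, s) \<Rightarrow> KK (c t, \<zeta> s))"
        using cS KKeq by (auto simp: space_pair_measure)
    qed
    interpret NM: finite_measure "N \<Otimes>\<^sub>M M"
      by (rule finite_measure_pair_measure) unfold_locales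
    have "integrable (N \<Otimes>\<^sub>M M) (\<lambda>(t, s). K (c t) (\<zeta> s))"
      by (rule NM.integrable_const_bound[where B=B])
         (use m B cS Z in \<open>auto simp: space_pair_measure\<close>)
    then have "(\<integral>t. \<integral>s. K (c t) (\<zeta> s) \<partial>M \<partial>N) = (\<integral>s. \<integral>t. K (c t) (\<zeta> s) \<partial>N \<partial>M)"
      using P.Fubini_integral[of "\<lambda>t s. K (c t) (\<zeta> s)"] by simp
    also have "\<dots> = (\<integral>s. 2 * pi * K w (\<zeta> s) \<partial>M)"
    proof (rule Bochner_Integration.integral_cong)
      fix s assume "s \<in> space M"
      then have "circle_avg (\<lambda>z. K z (\<zeta> s)) w r = K w (\<zeta> s)"
        using mv[of "\<zeta> s"] Z wr by (auto simp: mean_value_on_def)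
      then show "(\<integral>t. K (c t) (\<zeta> s) \<partial>N) = 2 * pi * K w (\<zeta> s)"
        by (simp add: circle_avg_def c_def N_def integral_restrict_space set_lebesgue_integral_def field_simps)
    qed simp
    finally show ?thesis
      by (simp add: circle_avg_def c_def N_def integral_restrict_space set_lebesgue_integral_def field_simps)
  qed
  ultimately show ?thesis
    unfolding mean_value_on_def using continuous_at_imp_continuous_on by blast
qed

subsection \<open>A comparison principle\<close>

text \<open>A continuous nonnegative function with zero integral over an interval vanishes there,
  and the point \<open>w + of_real r\<close> belongs to the parameter value 0.\<close>

lemma circle_avg_pos:
  fixes g :: "complex \<Rightarrow> real"
  assumes cont: "continuous_on (sphere w r) g" and r: "0 < r"
    and nonneg: "\<And>z. z \<in> sphere w r \<Longrightarrow> 0 \<le> g z" and pos: "0 < g (w + of_real r)"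
  shows "0 < circle_avg g w r"
proof -
  let ?f = "\<lambda>t. g (w + of_real r * cis t)"
  have c: "continuous_on {0..2*pi} ?f" using continuous_on_circle[OF cont] r by auto
  have "set_integrable lborel {0..2*pi} ?f" using set_integrable_circle[OF cont] r by auto
  then have eq: "(LINT t:{0..2*pi}|lborel. ?f t) = integral {0..2*pi} ?f"
    by (rule set_borel_integral_eq_integral(2))
  have nn: "0 \<le> ?f t" for t using nonneg circle_point_in_sphere[of r w t] r by auto
  have "integral {0..2*pi} ?f \<noteq> 0"
    using integral_eq_0_iff[OF c] nn pos by (auto dest!: bspec[where x=0])
  moreover have "integral {0..2*pi} ?f \<ge> 0" by (rule Henstock_Kurzweil_Integration.integral_nonneg) (auto simp: nn integrable_continuous_real c)
  ultimately show ?thesis by (simp add: circle_avg_def eq)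
qed

text \<open>A real number \<open>q\<close> inserted between \<open>u z\<close> and
  \<open>h z\<close> exhibits the set as a union of open sets, without any subtraction of extended
  reals.\<close>

lemma open_less_continuous:
  fixes u :: "complex \<Rightarrow> ereal"
  assumes u: "\<And>a::real. open {z\<in>\<Omega>. u z < ereal a}" and \<Omega>: "open \<Omega>" and h: "continuous_on \<Omega> h"
  shows "open {z\<in>\<Omega>. u z < ereal (h z)}"
proof -
  have "{z\<in>\<Omega>. u z < ereal (h z)} = (\<Union>q. {z\<in>\<Omega>. u z < ereal q} \<inter> {z\<in>\<Omega>. q < h z})"
    using ereal_dense2 by (force intro: less_trans)
  moreover have "open {z\<in>\<Omega>. q < h z}" for q
    using continuous_open_preimage[OF h \<Omega>, of "{q<..}"] by (simp add: vimage_def Int_def conj_commute)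
  ultimately show ?thesis using u by (simp only:) (intro open_UN ballI open_Int)
qed

text \<open>The maximum principle for the excess of \<open>u\<close> over \<open>h\<close>. If the
  excess is positive somewhere, the boundary condition confines its large values to a compact set,
  so a positive maximum \<open>S\<close> is attained. At the point \<open>w\<close> of greatest real
  part among the maximum points the submean inequality fails, because every small circle about
  \<open>w\<close> contains a point to the right of \<open>w\<close>, where the excess is smaller
  than \<open>S\<close>.\<close>

theorem subharmonic_comparison:
  assumes sub: "subharmonic_on u \<Omega>" and \<Omega>: "open \<Omega>" "bounded \<Omega>"
    and h: "mean_value_on h \<Omega>"
    and bd: "\<And>\<zeta> \<epsilon>. \<zeta> \<in> frontier \<Omega> \<Longrightarrow> 0 < \<epsilon> \<Longrightarrow> eventually (\<lambda>z. u z \<le> ereal (h z + \<epsilon>)) (at \<zeta> within \<Omega>)"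
    and z: "z \<in> \<Omega>"
  shows "u z \<le> ereal (h z)"
proof (rule ccontr)
  assume "\<not> u z \<le> ereal (h z)"
  have fin: "u z < \<infinity>" if "z \<in> \<Omega>" for z using sub that by (auto simp: subharmonic_on_def)
  have hc: "continuous_on \<Omega> h" using h by (simp add: mean_value_on_def)
  have usc: "open {z\<in>\<Omega>. u z < ereal (h z + a)}" for a
    by (rule open_less_continuous) (use sub \<Omega> hc in \<open>auto simp: subharmonic_on_def intro!: continuous_intros\<close>)
  obtain b where b: "ereal (h z) < ereal b" "ereal b < u z"
    using ereal_dense2[of "ereal (h z)" "u z"] \<open>\<not> u z \<le> ereal (h z)\<close> by (auto simp: not_le)
  define \<epsilon> where "\<epsilon> = b - h z"
  have \<epsilon>: "\<epsilon> > 0" "u z \<ge> ereal (h z + \<epsilon>)" using b by (auto simp: \<epsilon>_def)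
  \<comment> \<open>Near the frontier the excess is at most \<open>c/2\<close>, so
    \<open>K c\<close> cannot accumulate there; inside \<Omega> upper semicontinuity makes it
    closed.\<close>
  define K where "K c = {z\<in>\<Omega>. u z \<ge> ereal (h z + c)}" for c
  have K: "compact (K c)" if c: "c > 0" for c
  proof -
    have "bounded (K c)" using \<Omega>(2) by (rule bounded_subset) (auto simp: K_def)
    moreover have "closed (K c)"
      unfolding closed_limpt
    proof (intro allI impI)
      fix \<zeta> assume \<zeta>: "\<zeta> islimpt K c"
      then have "\<zeta> islimpt \<Omega>" by (rule islimpt_subset) (auto simp: K_def)
      then have cl: "\<zeta> \<in> closure \<Omega>" by (simp add: closure_def)
      show "\<zeta> \<in> K c"
      proof (cases "\<zeta> \<in> \<Omega>")
        case True
        show ?thesis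
        proof (rule ccontr)
          assume "\<zeta> \<notin> K c"
          then have "\<zeta> \<in> {z\<in>\<Omega>. u z < ereal (h z + c)}" using True by (auto simp: K_def)
          with usc[of c] \<zeta> obtain y where "y \<in> K c" "y \<in> {z\<in>\<Omega>. u z < ereal (h z + c)}"
            using islimptE[OF \<zeta> _ usc[of c]] by blast
          then show False by (auto simp: K_def)
        qed
      next
        case False
        then have "\<zeta> \<in> frontier \<Omega>" using cl \<Omega>(1) by (simp add: frontier_def interior_open)
        then have "eventually (\<lambda>z. u z \<le> ereal (h z + c/2)) (at \<zeta> within \<Omega>)" using bd c by simp
        then obtain S where S: "open S" "\<zeta> \<in> S" "\<And>z. z \<in> S \<Longrightarrow> z \<noteq> \<zeta> \<Longrightarrow> z \<in> \<Omega> \<Longrightarrow> u z \<le> ereal (h z + c/2)"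
          unfolding eventually_at_topological by blast
        obtain y where "y \<in> K c" "y \<in> S" "y \<noteq> \<zeta>" using islimptE[OF \<zeta> S(2,1)] by blast
        then have "ereal (h y + c) \<le> u y" "u y \<le> ereal (h y + c/2)" using S by (auto simp: K_def)
        then have "ereal (h y + c) \<le> ereal (h y + c/2)" by (rule order_trans)
        then show ?thesis using c by simp
      qed
    qed
    ultimately show ?thesis by (simp add: compact_eq_bounded_closed)
  qed
  define d where "d z = real_of_ereal (u z) - h z" for z
  have ud: "u z = ereal (h z + d z)" if "z \<in> K \<epsilon>" for z
    using that fin[of z] by (cases "u z") (auto simp: K_def d_def)
  \<comment> \<open>An upper semicontinuous function attains its maximum on a compact set: otherwise
    the open sets \<open>U m\<close> cover \<open>K \<epsilon>\<close>, and in a finite subcover the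
    index with the largest \<open>d m\<close> lies in no member.\<close>
  have "\<exists>m\<in>K \<epsilon>. \<forall>z\<in>K \<epsilon>. d z \<le> d m"
  proof (rule ccontr)
    assume "\<not> ?thesis"
    then have *: "\<exists>m\<in>K \<epsilon>. d z < d m" if "z \<in> K \<epsilon>" for z using that by (auto simp: not_le)
    define U where "U m = {z\<in>\<Omega>. u z < ereal (h z + d m)}" for m
    have Uiff: "z \<in> U m \<longleftrightarrow> d z < d m" if "z \<in> K \<epsilon>" for z m
      using that ud[OF that] by (auto simp: U_def K_def)
    have "K \<epsilon> \<subseteq> (\<Union>m\<in>K \<epsilon>. U m)" using * Uiff by blast
    from compactE_image[OF K[OF \<epsilon>(1)] _ this]
    obtain F where F: "F \<subseteq> K \<epsilon>" "finite F" "K \<epsilon> \<subseteq> (\<Union>m\<in>F. U m)"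
      using usc unfolding U_def by blast
    have "z \<in> K \<epsilon>" using z \<epsilon> by (simp add: K_def)
    then have "F \<noteq> {}" using F by auto
    then have "Max (d ` F) \<in> d ` F" using F by (intro Max_in) auto
    then obtain m where m: "m \<in> F" "d m = Max (d ` F)" by auto
    have mge: "d y \<le> d m" if "y \<in> F" for y using that F m by simp
    obtain y where y: "y \<in> F" "m \<in> U y" using F m(1) by blast
    then have "d m < d y" using Uiff[of m y] F m(1) by blast
    then show False using mge[OF y(1)] by simp
  qed
  then obtain m where m: "m \<in> K \<epsilon>" "\<And>z. z \<in> K \<epsilon> \<Longrightarrow> d z \<le> d m" by auto
  define S where "S = d m"
  have S: "S \<ge> \<epsilon>" using m ud[of m] by (auto simp: S_def K_def)
  have le: "u z \<le> ereal (h z + S)" if "z \<in> \<Omega>" for z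
  proof (cases "z \<in> K \<epsilon>")
    case True
    then show ?thesis using ud m by (simp add: S_def)
  next
    case False
    then have "u z \<le> ereal (h z + \<epsilon>)" using that by (auto simp: K_def)
    also have "\<dots> \<le> ereal (h z + S)" using S by simp
    finally show ?thesis .
  qed
  have "m \<in> K S" using m ud[of m] by (auto simp: S_def K_def)
  \<comment> \<open>A rightmost maximum point. The point \<open>q\<close> chosen below on a circle
    about \<open>w\<close> lies further right and hence outside \<open>K S\<close>.\<close>
  then obtain w where w: "w \<in> K S" "\<And>y. y \<in> K S \<Longrightarrow> Re y \<le> Re w"
  proof -
    have "compact (K S)" "K S \<noteq> {}" using K[of S] S \<epsilon> \<open>m \<in> K S\<close> by auto
    moreover have "continuous_on (K S) Re" by (intro continuous_intros)
    ultimately have "\<exists>w\<in>K S. \<forall>y\<in>K S. Re y \<le> Re w" by (rule continuous_attains_sup)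
    then show ?thesis using that by blast
  qed
  have w\<Omega>: "w \<in> \<Omega>" using w by (simp add: K_def)
  obtain \<rho> where \<rho>: "\<rho> > 0" "\<And>r. 0 < r \<Longrightarrow> r < \<rho> \<Longrightarrow> u w \<le> circle_mean u w r"
  proof -
    have "\<forall>w\<in>\<Omega>. \<exists>\<rho>>0. \<forall>r. 0 < r \<and> r < \<rho> \<longrightarrow> u w \<le> circle_mean u w r"
      using sub by (simp add: subharmonic_on_def)
    from bspec[OF this w\<Omega>] show ?thesis using that by auto
  qed
  obtain e where e: "e > 0" "cball w e \<subseteq> \<Omega>" using \<Omega> w\<Omega> open_contains_cball by blast
  define r where "r = min (\<rho>/2) e"
  have r: "0 < r" "r < \<rho>" "cball w r \<subseteq> \<Omega>" using \<rho> e by (auto simp: r_def)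
  define q where "q = w + of_real r"
  have q\<Omega>: "q \<in> \<Omega>" using r by (auto simp: q_def dist_norm)
  have "q \<notin> K S" using w(2)[of q] r by (auto simp: q_def)
  then have "u q < ereal (h q + S)" using q\<Omega> by (auto simp: K_def)
  then obtain b where b: "u q < ereal b" "ereal b < ereal (h q + S)" using ereal_dense2 by blast
  define \<delta> where "\<delta> = h q + S - b"
  have \<delta>: "\<delta> > 0" "u q < ereal (h q + (S - \<delta>))" using b by (auto simp: \<delta>_def)
  obtain \<eta> where \<eta>: "\<eta> > 0" "ball q \<eta> \<subseteq> {z\<in>\<Omega>. u z < ereal (h z + (S - \<delta>))}"
  proof -
    have "q \<in> {z\<in>\<Omega>. u z < ereal (h z + (S - \<delta>))}" using \<delta> q\<Omega> by simp
    from openE[OF usc this] show ?thesis using that by blast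
  qed
  \<comment> \<open>Subtracting \<delta> times this tent function from \<open>h + S\<close> leaves a
    continuous majorant \<open>v\<close> of \<open>u\<close>. The strict inequality near
    \<open>q\<close> thereby becomes a strict inequality between averages of continuous
    functions.\<close>
  define bump where "bump z = max 0 (1 - dist z q / \<eta>)" for z
  have bc: "continuous_on A bump" for A unfolding bump_def using \<eta> by (intro continuous_intros) auto
  define v where "v z = h z + S - \<delta> * bump z" for z
  have uv: "u z \<le> ereal (v z)" if "z \<in> \<Omega>" for z
  proof (cases "z \<in> ball q \<eta>")
    case True
    then have "u z < ereal (h z + (S - \<delta>))" using \<eta> by auto
    moreover have "bump z \<le> 1" using \<eta> by (simp add: bump_def)
    then have "ereal (h z + (S - \<delta>)) \<le> ereal (v z)" using \<delta> by (simp add: v_def)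
    ultimately show ?thesis by (rule order_trans[OF less_imp_le])
  next
    case False
    then have "bump z = 0" using \<eta> by (auto simp: bump_def dist_commute)
    then show ?thesis using le[OF that] by (simp add: v_def)
  qed
  have sph: "sphere w r \<subseteq> \<Omega>" using r by auto
  then have hs: "continuous_on (sphere w r) h" using hc continuous_on_subset by blast
  have vs: "continuous_on (sphere w r) v" unfolding v_def by (intro continuous_intros hs bc)
  have "u w \<le> circle_mean u w r" using \<rho> r by simp
  also have "\<dots> \<le> circle_mean (\<lambda>z. ereal (v z)) w r"
  proof (rule circle_mean_mono)
    fix t
    have "w + of_real r * cis t \<in> \<Omega>"
      using circle_point_in_sphere[of r w t] r(1) sph less_imp_le by blast
    then show "u (w + of_real r * cis t) \<le> ereal (v (w + of_real r * cis t))" by (rule uv)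
  qed
  also have "\<dots> = ereal (circle_avg v w r)" using circle_mean_ereal[OF vs] r by simp
  finally have up: "u w \<le> ereal (circle_avg v w r)" .
  have avg: "circle_avg v w r = circle_avg h w r + S - \<delta> * circle_avg bump w r"
  proof -
    have i: "set_integrable lborel {0..2*pi} (\<lambda>t. h (w + of_real r * cis t))"
      "set_integrable lborel {0..2*pi} (\<lambda>t. bump (w + of_real r * cis t))"
      using set_integrable_circle[OF hs] set_integrable_circle[OF bc] r by auto
    have c: "set_integrable lborel {0..2*pi} (\<lambda>t. S)" by (rule borel_integrable_atLeastAtMost') auto
    have "(LINT t:{0..2*pi}|lborel. S) = S * (2*pi)"
      by (simp add: set_lebesgue_integral_def)
    have "(LINT t:{0..2*pi}|lborel. v (w + of_real r * cis t))
        = (LINT t:{0..2*pi}|lborel. h (w + of_real r * cis t)) + S * (2*pi)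
          - \<delta> * (LINT t:{0..2*pi}|lborel. bump (w + of_real r * cis t))"
      unfolding v_def set_integral_diff(2)[OF set_integral_add(1)[OF i(1) c] set_integrable_mult_right[OF i(2)]]
        set_integral_add(2)[OF i(1) c] \<open>(LINT t:{0..2*pi}|lborel. S) = S * (2*pi)\<close> set_integral_mult_right ..
    then show ?thesis
      unfolding circle_avg_def by (simp add: diff_divide_distrib add_divide_distrib)
  qed
  have "circle_avg h w r = h w" using h r by (simp add: mean_value_on_def)
  moreover have "0 < circle_avg bump w r"
    by (rule circle_avg_pos) (use bc r in \<open>auto simp: bump_def q_def\<close>)
  ultimately have "circle_avg v w r < h w + S" using avg \<delta> by simp
  moreover have "ereal (h w + S) \<le> ereal (circle_avg v w r)"
    by (rule order_trans[OF _ up]) (use w in \<open>simp add: K_def\<close>)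
  then have "h w + S \<le> circle_avg v w r" by (simp only: ereal_less_eq)
  ultimately show False by linarith
qed

lemma subharmonic_on_real:
  assumes "mean_value_on g \<Omega>" "open \<Omega>"
  shows "subharmonic_on (\<lambda>z. ereal (g z)) \<Omega>"
  unfolding subharmonic_on_def
proof (intro conjI ballI allI)
  have g: "continuous_on \<Omega> g" using assms by (simp add: mean_value_on_def)
  show "open {z\<in>\<Omega>. ereal (g z) < ereal a}" for a
    using continuous_open_preimage[OF g assms(2), of "{..<a}"] by (simp add: vimage_def Int_def conj_commute)
  fix w assume "w \<in> \<Omega>"
  then obtain e where e: "e > 0" "cball w e \<subseteq> \<Omega>" using assms(2) open_contains_cball by blast
  have "ereal (g w) \<le> circle_mean (\<lambda>z. ereal (g z)) w r" if r: "0 < r" "r < e" for r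
  proof -
    have s: "cball w r \<subseteq> \<Omega>" using r e by auto
    then have "continuous_on (sphere w r) g" using g by (meson continuous_on_subset sphere_cball order_trans)
    then show ?thesis using circle_mean_ereal[of w r g] r s assms(1) by (simp add: mean_value_on_def)
  qed
  then show "\<exists>\<rho>>0. \<forall>r. 0 < r \<and> r < \<rho> \<longrightarrow> ereal (g w) \<le> circle_mean (\<lambda>z. ereal (g z)) w r"
    using e by auto
qed simp

lemma subharmonic_on_subset:
  assumes "subharmonic_on u \<Omega>" "open \<Omega>'" "\<Omega>' \<subseteq> \<Omega>"
  shows "subharmonic_on u \<Omega>'"
proof -
  have "{z\<in>\<Omega>'. u z < ereal a} = \<Omega>' \<inter> {z\<in>\<Omega>. u z < ereal a}" for a using assms by auto
  then have "open {z\<in>\<Omega>'. u z < ereal a}" for a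
    using assms by (auto simp: subharmonic_on_def intro!: open_Int)
  then show ?thesis using assms unfolding subharmonic_on_def by blast
qed

subsection \<open>Harmonic measure in the disk\<close>

text \<open>The setting covers both a level set at positive height and a single component of it,
  when \<psi> fixes the origin.\<close>

locale relatively_closed_in_disk =
  fixes E :: "complex set"
  assumes closedin: "closedin (top_of_set unit_disk) E" and zero: "0 \<notin> E"
begin

definition \<Omega> :: "complex set" where "\<Omega> = connected_component_set (unit_disk - E) 0"

lemma E_subset: "E \<subseteq> unit_disk"
  using closedin closedin_imp_subset by blast

lemma open_diff: "open (unit_disk - E)"
proof -
  obtain T where "closed T" "E = unit_disk \<inter> T" using closedin closedin_closed by blast
  then have "unit_disk - E = unit_disk - T" by auto
  then show ?thesis using \<open>closed T\<close> by (simp add: open_Diff)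
qed

lemma \<Omega>_subset: "\<Omega> \<subseteq> unit_disk - E"
  unfolding \<Omega>_def by (rule connected_component_subset)

lemma open_\<Omega>: "open \<Omega>" unfolding \<Omega>_def by (rule open_connected_component[OF open_diff])

lemma bounded_\<Omega>: "bounded \<Omega>" using \<Omega>_subset bounded_subset[OF bounded_ball] by blast

lemma zero_in_\<Omega>: "0 \<in> \<Omega>" unfolding \<Omega>_def using zero by (simp add: connected_component_refl)

lemma frontier_\<Omega>: "\<zeta> \<in> frontier \<Omega> \<Longrightarrow> \<zeta> \<in> E \<or> cmod \<zeta> = 1"
proof -
  assume \<zeta>: "\<zeta> \<in> frontier \<Omega>"
  then have "\<zeta> \<in> frontier (unit_disk - E)"
    unfolding \<Omega>_def using frontier_of_connected_component_subset by blast
  then have *: "\<zeta> \<in> closure (unit_disk - E)" "\<zeta> \<notin> unit_disk - E"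
    using open_diff by (auto simp: frontier_def interior_open)
  have "closure (unit_disk - E) \<subseteq> closure unit_disk" by (rule closure_mono) auto
  with *(1) have "\<zeta> \<in> cball 0 1" by auto
  with *(2) show ?thesis by auto
qed

definition perron_class :: "(complex \<Rightarrow> ereal) set" where
  "perron_class = {u. subharmonic_on u \<Omega> \<and>
     (\<forall>\<zeta>\<in>frontier \<Omega>. Limsup (at \<zeta> within \<Omega>) u \<le> ereal (indicat_real E \<zeta>))}"

text \<open>The comparison principle applies with \<open>h\<close> as majorant. A frontier point in
  \<open>E\<close> lies inside the disk, where \<open>h\<close> is continuous and at least 1; at any
  other frontier point the boundary data is 0 and nonnegativity of \<open>h\<close> is
  enough.\<close>

lemma perron_class_le:
  assumes u: "u \<in> perron_class" and h: "mean_value_on h unit_disk"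
    and nonneg: "\<And>z. z \<in> unit_disk \<Longrightarrow> 0 \<le> h z" and ge1: "\<And>z. z \<in> E \<Longrightarrow> 1 \<le> h z"
    and z: "z \<in> \<Omega>"
  shows "u z \<le> ereal (h z)"
proof (rule subharmonic_comparison[OF _ open_\<Omega> bounded_\<Omega> _ _ z])
  show "subharmonic_on u \<Omega>" using u by (simp add: perron_class_def)
  have hc: "continuous_on unit_disk h" using h by (simp add: mean_value_on_def)
  show "mean_value_on h \<Omega>"
    by (rule mean_value_on_subset[OF h]) (use \<Omega>_subset in auto)
  fix \<zeta> and \<epsilon> :: real assume \<zeta>: "\<zeta> \<in> frontier \<Omega>" and \<epsilon>: "0 < \<epsilon>"
  have lim: "Limsup (at \<zeta> within \<Omega>) u \<le> ereal (indicat_real E \<zeta>)" using u \<zeta> by (simp add: perron_class_def)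
  then have "Limsup (at \<zeta> within \<Omega>) u < ereal (indicat_real E \<zeta> + \<epsilon>/2)"
    by (rule order_le_less_trans) (use \<epsilon> in simp)
  then have ev: "eventually (\<lambda>z. u z < ereal (indicat_real E \<zeta> + \<epsilon>/2)) (at \<zeta> within \<Omega>)"
    by (rule Limsup_lessD)
  have hev: "eventually (\<lambda>z. indicat_real E \<zeta> - \<epsilon>/2 < h z) (at \<zeta> within \<Omega>)"
  proof (cases "\<zeta> \<in> E")
    case True
    then have "\<zeta> \<in> unit_disk" using E_subset by auto
    then have "isCont h \<zeta>" using hc by (simp add: continuous_on_eq_continuous_at)
    then have "(h \<longlongrightarrow> h \<zeta>) (at \<zeta> within \<Omega>)"
      using isCont_def tendsto_within_subset[of h _ _ UNIV] by blast
    then have "eventually (\<lambda>z. h z > 1 - \<epsilon>/2) (at \<zeta> within \<Omega>)"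
      by (rule order_tendstoD) (use ge1[OF True] \<epsilon> in simp)
    then show ?thesis using True by (auto elim: eventually_mono)
  next
    case False
    have "h z > 0 - \<epsilon>/2" if "z \<in> \<Omega>" for z
    proof -
      have "z \<in> unit_disk" using that \<Omega>_subset by auto
      then show ?thesis using nonneg[of z] \<epsilon> by linarith
    qed
    then show ?thesis using False by (auto simp: eventually_at_filter)
  qed
  show "eventually (\<lambda>z. u z \<le> ereal (h z + \<epsilon>)) (at \<zeta> within \<Omega>)"
    using ev hev
  proof eventually_elim
    case (elim z)
    have "u z \<le> ereal (indicat_real E \<zeta> + \<epsilon>/2)" using elim by simp
    also have "\<dots> \<le> ereal (h z + \<epsilon>)" using elim by simp
    finally show ?case .
  qed
qed

lemma perron_class_le_1: "u \<in> perron_class \<Longrightarrow> z \<in> \<Omega> \<Longrightarrow> u z \<le> 1"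
  using perron_class_le[of u "\<lambda>_. 1" z] mean_value_on_const by (simp add: one_ereal_def)

lemma zero_in_perron_class: "(\<lambda>z. 0) \<in> perron_class"
proof -
  have "subharmonic_on (\<lambda>z. 0) \<Omega>"
    using subharmonic_on_real[OF mean_value_on_const[of 0] open_\<Omega>] by (simp add: zero_ereal_def)
  moreover have "Limsup (at \<zeta> within \<Omega>) (\<lambda>z. 0) \<le> ereal (indicat_real E \<zeta>)" for \<zeta>
    by (rule Limsup_bounded) (auto simp: indicator_def)
  ultimately show ?thesis by (simp add: perron_class_def)
qed

text \<open>The supremum lies between 0 and 1, because 0 is a competitor and 1 is a majorant, so the
  passage through \<open>real_of_ereal\<close> is faithful.\<close>

lemma harmonic_measure_eq:
  "ereal (harmonic_measure unit_disk 0 E) = (SUP u\<in>perron_class. u 0)"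
proof -
  let ?s = "SUP u\<in>perron_class. u 0"
  have "?s \<le> 1" using perron_class_le_1 zero_in_\<Omega> by (auto intro!: SUP_least)
  moreover have "0 \<le> ?s" using SUP_upper[OF zero_in_perron_class, of "\<lambda>u. u 0"] by simp
  ultimately have "ereal (real_of_ereal ?s) = ?s" by (intro ereal_real') auto
  moreover have "harmonic_measure unit_disk 0 E = real_of_ereal ?s"
    by (simp add: harmonic_measure_def perron_solution_def perron_class_def \<Omega>_def)
  ultimately show ?thesis by simp
qed

lemma perron_class_le_harmonic_measure:
  "u \<in> perron_class \<Longrightarrow> u 0 \<le> ereal (harmonic_measure unit_disk 0 E)"
  unfolding harmonic_measure_eq by (rule SUP_upper)

lemma harmonic_measure_nonneg: "0 \<le> harmonic_measure unit_disk 0 E"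
  using perron_class_le_harmonic_measure[OF zero_in_perron_class] by simp

lemma harmonic_measure_le:
  assumes "mean_value_on h unit_disk" "\<And>z. z \<in> unit_disk \<Longrightarrow> 0 \<le> h z" "\<And>z. z \<in> E \<Longrightarrow> 1 \<le> h z"
  shows "harmonic_measure unit_disk 0 E \<le> h 0"
proof -
  have "ereal (harmonic_measure unit_disk 0 E) \<le> ereal (h 0)"
    unfolding harmonic_measure_eq by (rule SUP_least) (rule perron_class_le[OF _ assms zero_in_\<Omega>])
  then show ?thesis by simp
qed

lemma harmonic_measure_le_1: "harmonic_measure unit_disk 0 E \<le> 1"
  using harmonic_measure_le[of "\<lambda>_. 1"] mean_value_on_const by simp

lemma Limsup_le_of_le_near_boundary:
  assumes "cmod \<zeta> = 1" and \<delta>: "\<delta> < 1" "\<And>z. z \<in> unit_disk - E \<Longrightarrow> \<delta> < cmod z \<Longrightarrow> g z \<le> \<epsilon>"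
  shows "Limsup (at \<zeta> within \<Omega>) (\<lambda>z. ereal (g z)) \<le> ereal \<epsilon>"
proof (rule Limsup_bounded)
  have "(cmod \<longlongrightarrow> cmod \<zeta>) (at \<zeta> within \<Omega>)"
    by (rule tendsto_norm) (rule tendsto_ident_at)
  then have "eventually (\<lambda>z. cmod z > \<delta>) (at \<zeta> within \<Omega>)"
    using assms(1,2) by (simp add: order_tendstoD(1))
  moreover have "eventually (\<lambda>z. z \<in> \<Omega>) (at \<zeta> within \<Omega>)" by (simp add: eventually_at_filter)
  ultimately show "eventually (\<lambda>z. ereal (g z) \<le> ereal \<epsilon>) (at \<zeta> within \<Omega>)"
  proof eventually_elim
    case (elim z)
    then have "g z \<le> \<epsilon>" using \<delta>(2) \<Omega>_subset by blast
    then show ?case by simp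
  qed
qed

text \<open>Such a \<open>g\<close> is itself a competitor in the Perron class: its upper limits are
  at most 1 on \<open>E\<close> and at most 0 on the unit circle, by the uniform decay
  \<open>bd\<close>.\<close>

lemma harmonic_measure_ge:
  assumes g: "mean_value_on g (unit_disk - E)" and le1: "\<And>z. z \<in> unit_disk - E \<Longrightarrow> g z \<le> 1"
    and bd: "\<And>\<epsilon>. 0 < \<epsilon> \<Longrightarrow> \<exists>\<delta><1. \<forall>z\<in>unit_disk - E. \<delta> < cmod z \<longrightarrow> g z \<le> \<epsilon>"
  shows "g 0 \<le> harmonic_measure unit_disk 0 E"
proof -
  have "subharmonic_on (\<lambda>z. ereal (g z)) \<Omega>"
    by (rule subharmonic_on_real[OF mean_value_on_subset[OF g \<Omega>_subset] open_\<Omega>])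
  moreover have "Limsup (at \<zeta> within \<Omega>) (\<lambda>z. ereal (g z)) \<le> ereal (indicat_real E \<zeta>)"
    if \<zeta>: "\<zeta> \<in> frontier \<Omega>" for \<zeta>
  proof (cases "\<zeta> \<in> E")
    case True
    have "eventually (\<lambda>z. z \<in> \<Omega>) (at \<zeta> within \<Omega>)" by (simp add: eventually_at_filter)
    then have "eventually (\<lambda>z. ereal (g z) \<le> ereal (indicat_real E \<zeta>)) (at \<zeta> within \<Omega>)"
    proof eventually_elim
      case (elim z)
      then have "g z \<le> 1" using le1 \<Omega>_subset by blast
      then show ?case using True by simp
    qed
    then show ?thesis by (rule Limsup_bounded)
  next
    case False
    then have 1: "cmod \<zeta> = 1" using frontier_\<Omega>[OF \<zeta>] by simp
    have "Limsup (at \<zeta> within \<Omega>) (\<lambda>z. ereal (g z)) \<le> 0 + ereal \<epsilon>" if "\<epsilon> > 0" for \<epsilon>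
      using bd[OF that] Limsup_le_of_le_near_boundary[OF 1] by force
    then have "Limsup (at \<zeta> within \<Omega>) (\<lambda>z. ereal (g z)) \<le> 0" by (rule ereal_le_epsilon2)
    then show ?thesis using False by (simp add: zero_ereal_def)
  qed
  ultimately have "(\<lambda>z. ereal (g z)) \<in> perron_class" unfolding perron_class_def by blast
  from perron_class_le_harmonic_measure[OF this] show ?thesis by simp
qed

end

text \<open>Removing less leaves a larger component of 0, and competitors for \<open>C\<close>
  restrict to competitors for \<open>F\<close>: on \<open>F\<close> the data is 1 and every
  competitor is at most 1, while a frontier point off \<open>F\<close> lies on the unit circle and
  is a frontier point of the larger domain as well.\<close>

lemma harmonic_measure_mono:
  assumes C: "closedin (top_of_set unit_disk) C" and F: "closedin (top_of_set unit_disk) F"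
    and sub: "C \<subseteq> F" and zero: "0 \<notin> F"
  shows "harmonic_measure unit_disk 0 C \<le> harmonic_measure unit_disk 0 F"
proof -
  interpret C: relatively_closed_in_disk C using C sub zero by unfold_locales auto
  interpret F: relatively_closed_in_disk F using F zero by unfold_locales
  have \<Omega>sub: "F.\<Omega> \<subseteq> C.\<Omega>"
    unfolding F.\<Omega>_def C.\<Omega>_def by (rule connected_component_mono) (use sub in auto)
  have "u \<in> F.perron_class" if u: "u \<in> C.perron_class" for u
  proof -
    have "subharmonic_on u F.\<Omega>"
      using u subharmonic_on_subset[OF _ F.open_\<Omega> \<Omega>sub] by (simp add: C.perron_class_def)
    moreover have "Limsup (at \<zeta> within F.\<Omega>) u \<le> ereal (indicat_real F \<zeta>)" if \<zeta>: "\<zeta> \<in> frontier F.\<Omega>" for \<zeta>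
    proof (cases "\<zeta> \<in> F")
      case True
      have "eventually (\<lambda>z. z \<in> F.\<Omega>) (at \<zeta> within F.\<Omega>)" by (simp add: eventually_at_filter)
      then have "eventually (\<lambda>z. u z \<le> 1) (at \<zeta> within F.\<Omega>)"
        by eventually_elim (use C.perron_class_le_1[OF u] \<Omega>sub in auto)
      then show ?thesis using True by (simp add: Limsup_bounded one_ereal_def)
    next
      case False
      then have "cmod \<zeta> = 1" using F.frontier_\<Omega>[OF \<zeta>] by simp
      then have "\<zeta> \<notin> C.\<Omega>" using C.\<Omega>_subset by auto
      moreover have "\<zeta> \<in> closure C.\<Omega>" using \<zeta> closure_mono[OF \<Omega>sub] by (auto simp: frontier_def)
      ultimately have "\<zeta> \<in> frontier C.\<Omega>" using C.open_\<Omega> by (simp add: frontier_def interior_open)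
      then have "Limsup (at \<zeta> within C.\<Omega>) u \<le> ereal (indicat_real C \<zeta>)" using u by (simp add: C.perron_class_def)
      moreover have "Limsup (at \<zeta> within F.\<Omega>) u \<le> Limsup (at \<zeta> within C.\<Omega>) u"
        unfolding Limsup_le_iff[of "at \<zeta> within F.\<Omega>"]
        using Limsup_lessD at_le[OF \<Omega>sub] by (blast intro: filter_leD)
      moreover have "\<zeta> \<notin> C" using False sub by auto
      ultimately show ?thesis using False by (simp add: indicator_def order_trans)
    qed
    ultimately show ?thesis by (simp add: F.perron_class_def)
  qed
  then have "C.perron_class \<subseteq> F.perron_class" by auto
  then have "ereal (harmonic_measure unit_disk 0 C) \<le> ereal (harmonic_measure unit_disk 0 F)"
    unfolding C.harmonic_measure_eq F.harmonic_measure_eq by (rule SUP_subset_mono) auto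
  then show ?thesis by (simp only: ereal_less_eq)
qed

lemma mean_value_on_cmult:
  assumes "mean_value_on g S"
  shows "mean_value_on (\<lambda>z. c * g z) S"
  using assms unfolding mean_value_on_def circle_avg_def
  by (auto intro!: continuous_intros simp: set_integral_mult_right times_divide_eq_right[symmetric] simp del: times_divide_eq_right)

subsection \<open>The Green function of the disk\<close>

definition green :: "complex \<Rightarrow> complex \<Rightarrow> real" where
  "green z \<xi> = ln (cmod ((1 - z * cnj \<xi>) / (z - \<xi>)))"

lemma one_minus_mult_cnj_nonzero:
  assumes "cmod z < 1" "cmod \<xi> \<le> 1"
  shows "1 - z * cnj \<xi> \<noteq> 0"
proof
  assume "1 - z * cnj \<xi> = 0"
  then have "cmod (z * cnj \<xi>) = 1" by simp
  moreover have "cmod z * cmod \<xi> \<le> cmod z * 1" using assms by (intro mult_left_mono) auto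
  ultimately show False using assms by (simp add: norm_mult)
qed

text \<open>Trades the logarithmic singularity of the Green function for an inverse square root,
  which has an elementary antiderivative.\<close>

lemma ln_one_plus_le_sqrt:
  assumes "0 \<le> (x::real)"
  shows "ln (1 + x) \<le> 2 * sqrt x"
proof -
  have "1 + x \<le> (1 + sqrt x)\<^sup>2" using assms by (simp add: power2_sum)
  then have "ln (1 + x) \<le> ln ((1 + sqrt x)\<^sup>2)" using assms by (intro ln_mono) auto
  also have "\<dots> = 2 * ln (1 + sqrt x)" using assms by (simp add: ln_realpow add_pos_nonneg)
  also have "\<dots> \<le> 2 * sqrt x" using ln_add_one_self_le_self[of "sqrt x"] assms by simp
  finally show ?thesis .
qed

text \<open>The quotient inside the logarithm is at most
  \<open>1 + 2 * \<epsilon> / cmod (z - \<xi>)\<close>, and the distance of two points is at least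
  the difference of their moduli. The resulting bound sees \<xi> only through its modulus, so the
  angular position of the measure is irrelevant.\<close>

lemma green_le_inverse_sqrt:
  assumes z: "cmod z < 1" and \<xi>: "1 - \<epsilon> \<le> cmod \<xi>" "cmod \<xi> < 1" and ne: "cmod z \<noteq> cmod \<xi>" and \<epsilon>: "0 < \<epsilon>"
  shows "green z \<xi> \<le> 2 * sqrt (2 * \<epsilon>) * (1 / sqrt \<bar>cmod \<xi> - cmod z\<bar>)"
proof -
  have zx: "0 < cmod (z - \<xi>)" using ne by auto
  have d: "0 < \<bar>cmod \<xi> - cmod z\<bar>" "\<bar>cmod \<xi> - cmod z\<bar> \<le> cmod (z - \<xi>)"
    using ne norm_triangle_ineq3[of \<xi> z] by (auto simp: norm_minus_commute)
  \<comment> \<open>The rewriting separates a part of size at most \<open>2 * \<epsilon>\<close>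
    from a part comparable to the denominator.\<close>
  have "1 - z * cnj \<xi> = of_real (1 - (cmod \<xi>)\<^sup>2) - (z - \<xi>) * cnj \<xi>"
    by (simp add: algebra_simps complex_norm_square del: of_real_power)
  then have "cmod (1 - z * cnj \<xi>) \<le> \<bar>1 - (cmod \<xi>)\<^sup>2\<bar> + cmod (z - \<xi>) * cmod \<xi>"
    by (metis complex_mod_cnj norm_mult norm_of_real norm_triangle_ineq4)
  also have "1 - (cmod \<xi>)\<^sup>2 = (1 - cmod \<xi>) * (1 + cmod \<xi>)" by (simp add: power2_eq_square algebra_simps)
  also have "\<bar>(1 - cmod \<xi>) * (1 + cmod \<xi>)\<bar> \<le> \<epsilon> * 2"
    using \<xi> \<epsilon> by (simp add: abs_mult) (intro mult_mono, auto)
  also have "cmod (z - \<xi>) * cmod \<xi> \<le> cmod (z - \<xi>) * 1" using \<xi> by (intro mult_left_mono) auto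
  finally have "cmod (1 - z * cnj \<xi>) \<le> 2 * \<epsilon> + cmod (z - \<xi>)" by simp
  then have "cmod ((1 - z * cnj \<xi>) / (z - \<xi>)) \<le> (2 * \<epsilon> + cmod (z - \<xi>)) / cmod (z - \<xi>)"
    using zx by (simp add: norm_divide divide_right_mono)
  also have "\<dots> = 1 + 2 * \<epsilon> / cmod (z - \<xi>)" using zx by (simp add: field_simps)
  also have "\<dots> \<le> 1 + 2 * \<epsilon> / \<bar>cmod \<xi> - cmod z\<bar>" using d \<epsilon> by (simp add: frac_le)
  finally have "green z \<xi> \<le> ln (1 + 2 * \<epsilon> / \<bar>cmod \<xi> - cmod z\<bar>)"
    unfolding green_def using one_minus_mult_cnj_nonzero[of z \<xi>] z \<xi> zx by (intro ln_mono) auto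
  also have "\<dots> \<le> 2 * sqrt (2 * \<epsilon> / \<bar>cmod \<xi> - cmod z\<bar>)" using \<epsilon> by (intro ln_one_plus_le_sqrt) auto
  finally show ?thesis by (simp add: real_sqrt_divide)
qed

text \<open>Gives uniform decay at the unit circle for poles in a smaller disk. The squared quotient
  differs from 1 by the product of \<open>1 - (cmod z)\<^sup>2\<close> and
  \<open>1 - (cmod \<xi>)\<^sup>2\<close> over the squared distance, and ln (1 + x) is at most
  x.\<close>

lemma green_le_near_circle:
  assumes z: "cmod z < 1" and \<xi>: "cmod \<xi> \<le> s" "s < 1" and q: "0 < q" "q \<le> cmod z - s"
  shows "green z \<xi> \<le> (1 - cmod z) / q\<^sup>2"
proof -
  have "q \<le> cmod (z - \<xi>)" using norm_triangle_ineq2[of z \<xi>] q \<xi> by linarith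
  then have zx: "0 < cmod (z - \<xi>)" "q\<^sup>2 \<le> (cmod (z - \<xi>))\<^sup>2" using q by (auto intro: power_mono)
  let ?a = "(cmod (1 - z * cnj \<xi>))\<^sup>2" and ?b = "(cmod (z - \<xi>))\<^sup>2"
  have id: "?a = ?b + (1 - (cmod z)\<^sup>2) * (1 - (cmod \<xi>)\<^sup>2)"
    unfolding cmod_power2 by (simp add: power2_eq_square algebra_simps)
  have nz: "1 - z * cnj \<xi> \<noteq> 0" using one_minus_mult_cnj_nonzero[of z \<xi>] z \<xi> by simp
  have "2 * green z \<xi> = ln (?a / ?b)"
    unfolding green_def using nz zx by (simp add: norm_divide ln_div ln_realpow)
  also have "?a / ?b = 1 + (1 - (cmod z)\<^sup>2) * (1 - (cmod \<xi>)\<^sup>2) / ?b"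
    unfolding id using zx by (simp add: field_simps)
  also have "ln \<dots> \<le> (1 - (cmod z)\<^sup>2) * (1 - (cmod \<xi>)\<^sup>2) / ?b"
    using z \<xi> by (intro ln_add_one_self_le_self divide_nonneg_nonneg mult_nonneg_nonneg) (auto simp: abs_square_le_1)
  also have "\<dots> \<le> (2 * (1 - cmod z)) / q\<^sup>2"
  proof (rule frac_le)
    have "(1 - (cmod z)\<^sup>2) * (1 - (cmod \<xi>)\<^sup>2) \<le> (1 - (cmod z)\<^sup>2) * 1"
      using z by (intro mult_left_mono) (auto simp: abs_square_le_1)
    also have "\<dots> = (1 + cmod z) * (1 - cmod z)" by (simp add: power2_eq_square algebra_simps)
    also have "\<dots> \<le> 2 * (1 - cmod z)" using z by (intro mult_right_mono) auto
    finally show "(1 - (cmod z)\<^sup>2) * (1 - (cmod \<xi>)\<^sup>2) \<le> 2 * (1 - cmod z)" .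
  qed (use z q zx in auto)
  finally have "2 * green z \<xi> \<le> 2 * ((1 - cmod z) / q\<^sup>2)" by (simp only: times_divide_eq_right)
  then show ?thesis by (rule mult_left_le_imp_le) simp
qed

lemma green_zero_ge:
  assumes "0 < cmod \<xi>"
  shows "1 - cmod \<xi> \<le> green 0 \<xi>"
proof -
  have "ln (cmod \<xi>) \<le> cmod \<xi> - 1" using assms by (rule ln_le_minus_one)
  then show ?thesis using assms by (simp add: green_def norm_divide ln_div)
qed

text \<open>The antiderivative \<open>F\<close> is continuous across the singularity, so the
  fundamental theorem applies with \<open>t\<close> as exceptional point. The value \<open>B\<close>
  at \<open>t\<close> is left free because the Green function has to be dominated there too. The
  constant 4 counts two sides of \<open>t\<close>, each contributing at most
  \<open>2 * sqrt (b - a)\<close>.\<close>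

lemma has_integral_inverse_sqrt_abs:
  fixes a b t B :: real
  assumes "a \<le> b"
  obtains I where "((\<lambda>s. if s = t then B else 1 / sqrt \<bar>s - t\<bar>) has_integral I) {a..b}" "I \<le> 4 * sqrt (b - a)"
proof
  define F where "F s = 2 * sgn (s - t) * sqrt \<bar>s - t\<bar>" for s
  let ?f = "\<lambda>s. if s = t then B else 1 / sqrt \<bar>s - t\<bar>"
  have F: "F s = (if s \<ge> t then 2 * sqrt (s - t) else - 2 * sqrt (t - s))" for s
    by (auto simp: F_def sgn_if)
  show "(?f has_integral (F b - F a)) {a..b}"
  proof (rule fundamental_theorem_of_calculus_interior_strong[where S="{t}"])
    show "continuous_on {a..b} F"
    proof -
      have "continuous_on ({t..} \<union> {..t}) (\<lambda>s. if s \<ge> t then 2 * sqrt (s - t) else - 2 * sqrt (t - s))"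
        by (rule continuous_on_cases) (auto intro!: continuous_intros)
      then show ?thesis unfolding F[abs_def] by (rule continuous_on_subset) auto
    qed
    fix x assume x: "x \<in> {a<..<b} - {t}"
    show "(F has_vector_derivative ?f x) (at x)"
    proof (cases "x > t")
      case True
      have "((\<lambda>s. 2 * sqrt (s - t)) has_field_derivative 1 / sqrt (x - t)) (at x)"
        using True by (auto intro!: derivative_eq_intros simp: field_simps)
      then have "(F has_field_derivative 1 / sqrt (x - t)) (at x)"
        by (rule has_field_derivative_transform_within_open[where S="{t<..}"]) (use True in \<open>auto simp: F\<close>)
      then show ?thesis using True by (simp add: has_real_derivative_iff_has_vector_derivative)
    next
      case False
      then have xt: "x < t" using x by auto
      have "((\<lambda>s. - 2 * sqrt (t - s)) has_field_derivative 1 / sqrt (t - x)) (at x)"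
        using xt by (auto intro!: derivative_eq_intros simp: field_simps)
      then have "(F has_field_derivative 1 / sqrt (t - x)) (at x)"
        by (rule has_field_derivative_transform_within_open[where S="{..<t}"]) (use xt in \<open>auto simp: F\<close>)
      then show ?thesis using xt by (simp add: has_real_derivative_iff_has_vector_derivative)
    qed
  qed (use assms in auto)
  show "F b - F a \<le> 4 * sqrt (b - a)"
  proof -
    consider "t \<le> a" | "a < t" "t \<le> b" | "b < t" using assms by linarith
    then show ?thesis
    proof cases
      case 1
      have "sqrt (b - t) \<le> sqrt ((b - a) + (a - t))" by simp
      also have "\<dots> \<le> sqrt (b - a) + sqrt (a - t)" using 1 assms by (intro sqrt_add_le_add_sqrt) auto
      finally show ?thesis using 1 assms by (simp add: F) (smt (verit) real_sqrt_ge_zero)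
    next
      case 2
      then have "sqrt (b - t) \<le> sqrt (b - a)" "sqrt (t - a) \<le> sqrt (b - a)" by auto
      moreover have "F b - F a = 2 * sqrt (b - t) + 2 * sqrt (t - a)" using 2 by (simp add: F)
      ultimately show ?thesis by linarith
    next
      case 3
      have "sqrt (t - a) \<le> sqrt ((b - a) + (t - b))" by simp
      also have "\<dots> \<le> sqrt (b - a) + sqrt (t - b)" using 3 assms by (intro sqrt_add_le_add_sqrt) auto
      finally show ?thesis using 3 assms by (simp add: F) (smt (verit) real_sqrt_ge_zero)
    qed
  qed
qed

lemma mean_value_on_green:
  assumes "open S" "S \<subseteq> unit_disk" "\<xi> \<notin> S" "cmod \<xi> \<le> 1"
  shows "mean_value_on (\<lambda>z. green z \<xi>) S"
  unfolding green_def
proof (rule mean_value_on_ln_norm)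
  show "(\<lambda>z. (1 - z * cnj \<xi>) / (z - \<xi>)) holomorphic_on S"
    using assms by (intro holomorphic_intros) auto
  fix z assume "z \<in> S"
  then show "(1 - z * cnj \<xi>) / (z - \<xi>) \<noteq> 0"
    using assms one_minus_mult_cnj_nonzero[of z \<xi>] by auto
qed fact

section \<open>Lower bounds for harmonic measure by Green potentials\<close>

context relatively_closed_in_disk
begin

text \<open>\<open>E\<close> may accumulate at the unit circle, so compactness is available only
  after cutting at a radius below 1.\<close>

lemma compact_Int_cball:
  assumes "s < 1"
  shows "compact (E \<inter> cball 0 s)"
proof -
  obtain T where T: "closed T" "E = unit_disk \<inter> T" using closedin closedin_closed by blast
  then have "E \<inter> cball 0 s = T \<inter> cball 0 s" using assms by auto
  then show ?thesis using T by (simp add: closed_Int_compact)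
qed

text \<open>The Green potential of the image under \<open>\<zeta>\<close> of Lebesgue measure on a radial interval of
  length comparable to \<open>1 - \<rho>\<close> is bounded by a multiple of \<open>1 - \<rho>\<close>, since the singularity of
  the Green function at \<open>\<zeta> s\<close> is no worse than its restriction to radii.\<close>

proposition harmonic_measure_ge_radial_projection:
  fixes \<zeta> :: "real \<Rightarrow> complex"
  assumes \<rho>: "0 < \<rho>" "\<rho> < 1" and I_def: "I = {\<rho>..(1 + \<rho>) / 2}"
    and meas: "\<zeta> \<in> borel_measurable (restrict_space lborel I)"
    and \<zeta>: "\<And>s. s \<in> I \<Longrightarrow> \<zeta> s \<in> E" "\<And>s. s \<in> I \<Longrightarrow> cmod (\<zeta> s) = s"
  shows "(1 - \<rho>) / 32 \<le> harmonic_measure unit_disk 0 E"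
proof -
  define \<epsilon> where "\<epsilon> = 1 - \<rho>"
  define s1 where "s1 = (1 + \<rho>) / 2"
  have \<epsilon>: "0 < \<epsilon>" "\<epsilon> < 1" "s1 < 1" "\<rho> < s1" "s1 - \<rho> = \<epsilon> / 2" "1 - s1 = \<epsilon> / 2"
    using \<rho> by (auto simp: \<epsilon>_def s1_def field_simps)
  have I: "I = {\<rho>..s1}" using I_def s1_def by simp
  define M where "M = restrict_space lborel I"
  define Z where "Z = E \<inter> cball 0 s1"
  define S where "S = unit_disk - E"
  have spM: "space M = I" by (simp add: M_def space_restrict_space)
  have fM: "finite_measure M"
    by standard (simp add: M_def I emeasure_restrict_space space_restrict_space emeasure_lborel_Icc_eq)
  interpret M: finite_measure M by (rule fM)
  have Zc: "compact Z" using compact_Int_cball \<epsilon> by (simp add: Z_def)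
  have \<zeta>Z: "\<zeta> s \<in> Z" if "s \<in> I" for s using \<zeta>[OF that] that by (simp add: Z_def I)
  have SZ: "z \<noteq> \<xi>" "cmod z < 1" "cmod \<xi> < 1" if "z \<in> S" "\<xi> \<in> Z" for z \<xi>
    using that \<epsilon> by (auto simp: S_def Z_def)
  have cont: "continuous_on (S \<times> Z) (\<lambda>(z, \<xi>). green z \<xi>)"
    unfolding green_def case_prod_unfold using SZ one_minus_mult_cnj_nonzero
    by (intro continuous_intros) (auto simp: less_imp_le)
  define p where "p z = (\<integral>s. green z (\<zeta> s) \<partial>M)" for z
  have "mean_value_on p S"
    unfolding p_def
  proof (rule mean_value_on_integral[OF _ fM])
    show "open S" unfolding S_def by (rule open_diff)
    show "\<zeta> \<in> borel_measurable M" using meas by (simp add: M_def)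
    show "Z \<in> sets borel" using Zc by (simp add: borel_compact)
    show "\<zeta> s \<in> Z" if "s \<in> space M" for s using \<zeta>Z that by (simp add: spM)
    show "continuous_on (S \<times> Z) (\<lambda>(z, \<xi>). green z \<xi>)" by (rule cont)
    show "mean_value_on (\<lambda>z. green z \<xi>) S" if "\<xi> \<in> Z" for \<xi>
      by (rule mean_value_on_green) (use that open_diff \<epsilon> in \<open>auto simp: S_def Z_def\<close>)
    fix C assume C: "compact C" "C \<subseteq> S"
    have "compact ((\<lambda>(z, \<xi>). green z \<xi>) ` (C \<times> Z))"
      using C Zc by (intro compact_continuous_image compact_Times continuous_on_subset[OF cont]) auto
    then have "bounded ((\<lambda>(z, \<xi>). green z \<xi>) ` (C \<times> Z))" by (rule compact_imp_bounded)
    then obtain B where "\<forall>y\<in>(\<lambda>(z, \<xi>). green z \<xi>) ` (C \<times> Z). norm y \<le> B" unfolding bounded_iff by blast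
    then have "\<forall>z\<in>C. \<forall>\<xi>\<in>Z. \<bar>green z \<xi>\<bar> \<le> B" by force
    then show "\<exists>B. \<forall>z\<in>C. \<forall>\<xi>\<in>Z. \<bar>green z \<xi>\<bar> \<le> B" by blast
  qed
  then have g: "mean_value_on (\<lambda>z. 1 / (8 * \<epsilon>) * p z) S" by (rule mean_value_on_cmult)
  have int: "integrable M (\<lambda>s. green z (\<zeta> s))" if z: "z \<in> S" for z
  proof -
    have c: "continuous_on Z (\<lambda>\<xi>. green z \<xi>)"
      unfolding green_def using SZ[OF z] one_minus_mult_cnj_nonzero[of z] z
      by (intro continuous_intros) (auto simp: less_imp_le)
    then have "bounded ((\<lambda>\<xi>. green z \<xi>) ` Z)" using Zc by (intro compact_imp_bounded compact_continuous_image)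
    then obtain B where B: "\<forall>y\<in>(\<lambda>\<xi>. green z \<xi>) ` Z. norm y \<le> B" unfolding bounded_iff by blast
    have "(\<lambda>\<xi>. green z \<xi>) \<in> borel_measurable (restrict_space borel Z)"
      using c by (rule borel_measurable_continuous_on_restrict)
    moreover have "\<zeta> \<in> measurable M (restrict_space borel Z)"
      by (rule measurable_restrict_space2) (use \<zeta>Z spM meas in \<open>auto simp: M_def\<close>)
    ultimately have "(\<lambda>s. green z (\<zeta> s)) \<in> borel_measurable M" by (rule measurable_compose[rotated])
    then show ?thesis
      using B \<zeta>Z by (intro M.integrable_const_bound[where B=B]) (auto simp: spM)
  qed
  have pHK: "p z = integral {\<rho>..s1} (\<lambda>s. green z (\<zeta> s))" "(\<lambda>s. green z (\<zeta> s)) integrable_on {\<rho>..s1}"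
    if z: "z \<in> S" for z
  proof -
    have "set_integrable lborel {\<rho>..s1} (\<lambda>s. green z (\<zeta> s))"
      using int[OF z] by (simp add: M_def I integrable_restrict_space set_integrable_def)
    moreover have "p z = (LINT s:{\<rho>..s1}|lborel. green z (\<zeta> s))"
      by (simp add: p_def M_def I integral_restrict_space set_lebesgue_integral_def)
    ultimately show "p z = integral {\<rho>..s1} (\<lambda>s. green z (\<zeta> s))" "(\<lambda>s. green z (\<zeta> s)) integrable_on {\<rho>..s1}"
      using set_borel_integral_eq_integral by metis+
  qed
  have ple: "p z \<le> 8 * \<epsilon>" if z: "z \<in> S" for z
  proof -
    define B where "B = green z (\<zeta> (cmod z)) / (2 * sqrt (2 * \<epsilon>))"
    let ?f = "\<lambda>s. if s = cmod z then B else 1 / sqrt \<bar>s - cmod z\<bar>"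
    obtain J where J: "(?f has_integral J) {\<rho>..s1}" "J \<le> 4 * sqrt (s1 - \<rho>)"
      using has_integral_inverse_sqrt_abs[of \<rho> s1 "cmod z" B] \<epsilon> by auto
    have "p z \<le> 2 * sqrt (2 * \<epsilon>) * J"
      unfolding pHK(1)[OF z]
    proof (rule has_integral_le[OF integrable_integral[OF pHK(2)[OF z]] has_integral_mult_right[OF J(1)]])
      fix s assume s: "s \<in> {\<rho>..s1}"
      show "green z (\<zeta> s) \<le> 2 * sqrt (2 * \<epsilon>) * ?f s"
      proof (cases "s = cmod z")
        case True
        then show ?thesis using \<epsilon> by (simp add: B_def)
      next
        case False
        have "cmod (\<zeta> s) = s" using \<zeta>(2) s I by simp
        then show ?thesis
          using green_le_inverse_sqrt[of z \<epsilon> "\<zeta> s"] SZ[OF z \<zeta>Z[of s]] s False \<epsilon> I by (auto simp: \<epsilon>_def)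
      qed
    qed
    also have "\<dots> \<le> 2 * sqrt (2 * \<epsilon>) * (4 * sqrt (s1 - \<rho>))" using J(2) \<epsilon>(1) by (intro mult_left_mono) auto
    also have "\<dots> = 8 * (sqrt (2 * \<epsilon>) * sqrt (\<epsilon> / 2))" using \<epsilon> by simp
    also have "sqrt (2 * \<epsilon>) * sqrt (\<epsilon> / 2) = \<epsilon>" using \<epsilon> by (simp flip: real_sqrt_mult)
    finally show ?thesis .
  qed
  have 0: "0 \<in> S" using zero by (simp add: S_def)
  have "((\<lambda>s. 1 - s1) has_integral (1 - s1) * (s1 - \<rho>)) {\<rho>..s1}"
    using has_integral_const_real[of "1 - s1" \<rho> s1] \<epsilon>(4) by (simp add: mult.commute)
  \<comment> \<open>On an interval of length \<epsilon>/2 the integrand is at least \<epsilon>/2.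
    Division by the normalising factor \<open>8 * \<epsilon>\<close>, which brings the potential
    below 1, produces the final constant 32.\<close>
  then have p0: "(1 - s1) * (s1 - \<rho>) \<le> p 0"
    unfolding pHK(1)[OF 0]
  proof (rule has_integral_le[OF _ integrable_integral[OF pHK(2)[OF 0]]])
    fix s assume s: "s \<in> {\<rho>..s1}"
    then have "cmod (\<zeta> s) = s" using \<zeta>(2) I by simp
    then show "1 - s1 \<le> green 0 (\<zeta> s)" using green_zero_ge[of "\<zeta> s"] s \<rho> by auto
  qed
  have "1 / (8 * \<epsilon>) * p 0 \<le> harmonic_measure unit_disk 0 E"
  proof (rule harmonic_measure_ge)
    show "mean_value_on (\<lambda>z. 1 / (8 * \<epsilon>) * p z) (unit_disk - E)" using g by (simp add: S_def)
    show "1 / (8 * \<epsilon>) * p z \<le> 1" if "z \<in> unit_disk - E" for z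
      using ple[of z] that \<epsilon> by (simp add: S_def field_simps)
    fix \<eta> :: real assume \<eta>: "0 < \<eta>"
    define q where "q = (1 - s1) / 2"
    have q: "0 < q" using \<epsilon> by (simp add: q_def)
    \<comment> \<open>The first entry keeps \<open>z\<close> at distance at least \<open>q\<close>
      from the support of the measure; the second makes \<open>(1 - cmod z) / q\<^sup>2\<close> at
      most \<open>8 * \<epsilon> * \<eta>\<close>.\<close>
    define \<delta> where "\<delta> = max (s1 + q) (1 - 8 * \<epsilon> * q\<^sup>2 * \<eta>)"
    have "1 / (8 * \<epsilon>) * p z \<le> \<eta>" if z: "z \<in> unit_disk - E" "\<delta> < cmod z" for z
    proof -
      have zS: "z \<in> S" using z by (simp add: S_def)
      have z': "q \<le> cmod z - s1" "1 - cmod z \<le> 8 * \<epsilon> * q\<^sup>2 * \<eta>" using z by (auto simp: \<delta>_def)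
      have "((\<lambda>s. 8 * \<epsilon> * \<eta>) has_integral (8 * \<epsilon> * \<eta>) * (s1 - \<rho>)) {\<rho>..s1}"
        using has_integral_const_real[of "8 * \<epsilon> * \<eta>" \<rho> s1] \<epsilon>(4) by (simp add: mult.commute)
      then have "p z \<le> (8 * \<epsilon> * \<eta>) * (s1 - \<rho>)"
        unfolding pHK(1)[OF zS]
      proof (rule has_integral_le[OF integrable_integral[OF pHK(2)[OF zS]]])
        fix s assume s: "s \<in> {\<rho>..s1}"
        have "cmod (\<zeta> s) = s" using \<zeta>(2) s I by simp
        then have "green z (\<zeta> s) \<le> (1 - cmod z) / q\<^sup>2"
          using green_le_near_circle[of z "\<zeta> s" s1 q] s z z' \<epsilon> q by auto
        also have "\<dots> \<le> (8 * \<epsilon> * q\<^sup>2 * \<eta>) / q\<^sup>2" using z' by (intro divide_right_mono) auto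
        also have "\<dots> = 8 * \<epsilon> * \<eta>" using q by simp
        finally show "green z (\<zeta> s) \<le> 8 * \<epsilon> * \<eta>" .
      qed
      also have "\<dots> \<le> (8 * \<epsilon> * \<eta>) * 1" using \<epsilon> \<eta> by (intro mult_left_mono) auto
      finally show ?thesis using \<epsilon> by (simp add: field_simps)
    qed
    moreover have "\<delta> < 1" using q \<epsilon> \<eta> by (simp add: \<delta>_def q_def field_simps)
    ultimately show "\<exists>\<delta><1. \<forall>z\<in>unit_disk - E. \<delta> < cmod z \<longrightarrow> 1 / (8 * \<epsilon>) * p z \<le> \<eta>" by blast
  qed
  moreover have "\<epsilon> / 32 \<le> 1 / (8 * \<epsilon>) * p 0"
    using p0 \<epsilon> by (simp add: field_simps power2_eq_square)
  ultimately have "\<epsilon> / 32 \<le> harmonic_measure unit_disk 0 E" by linarith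
  then show ?thesis by (simp add: \<epsilon>_def)
qed

text \<open>The first time \<tau>(s) at which the curve reaches modulus \<open>s\<close> is monotone
  in \<open>s\<close> and therefore Borel. Thus \<open>\<gamma> (\<tau> s)\<close> is a measurable
  choice of one point of \<open>E\<close> on each circle, as the radial projection estimate
  requires.\<close>

lemma harmonic_measure_ge_curve:
  fixes \<gamma> :: "real \<Rightarrow> complex"
  assumes \<gamma>: "continuous_on {a..b} \<gamma>" "a \<le> b" "\<And>t. t \<in> {a..b} \<Longrightarrow> \<gamma> t \<in> E"
    and reach: "(1 + cmod (\<gamma> a)) / 2 \<le> cmod (\<gamma> b)"
  shows "(1 - cmod (\<gamma> a)) / 32 \<le> harmonic_measure unit_disk 0 E"
proof -
  define \<rho> where "\<rho> = cmod (\<gamma> a)"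
  have aE: "\<gamma> a \<in> E" using \<gamma> by simp
  then have "\<gamma> a \<noteq> 0" using zero by metis
  then have \<rho>: "0 < \<rho>" "\<rho> < 1" using aE E_subset by (auto simp: \<rho>_def)
  define I where "I = {\<rho>..(1 + \<rho>) / 2}"
  define T where "T s = {t\<in>{a..b}. s \<le> cmod (\<gamma> t)}" for s
  define \<tau> where "\<tau> s = Inf (T s)" for s
  have nc: "continuous_on {a..b} (\<lambda>t. cmod (\<gamma> t))" using \<gamma> by (intro continuous_intros)
  have T: "closed (T s)" for s
    unfolding T_def using continuous_closed_preimage[OF nc, of "{s..}"]
    by (simp add: vimage_def Int_def conj_commute)
  have bT: "b \<in> T s" if "s \<in> I" for s using that reach \<gamma>(2) by (auto simp: T_def I_def \<rho>_def)
  have bdd: "bdd_below (T s)" for s unfolding T_def by (rule bdd_belowI[of _ a]) auto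
  have \<tau>T: "\<tau> s \<in> T s" if "s \<in> I" for s
    unfolding \<tau>_def using bT[OF that] bdd T by (intro closed_contains_Inf) auto
  have \<tau>ab: "\<tau> s \<in> {a..b}" if "s \<in> I" for s using \<tau>T[OF that] by (simp add: T_def)
  have \<tau>s: "cmod (\<gamma> (\<tau> s)) = s" if s: "s \<in> I" for s
  proof (rule ccontr)
    assume "cmod (\<gamma> (\<tau> s)) \<noteq> s"
    then have gt: "s < cmod (\<gamma> (\<tau> s))" using \<tau>T[OF s] by (simp add: T_def)
    \<comment> \<open>If the modulus overshot \<open>s\<close> at the first hitting time, the
      intermediate value theorem would give an earlier one.\<close>
    have "\<exists>x. a \<le> x \<and> x \<le> \<tau> s \<and> cmod (\<gamma> x) = s"
      using \<tau>ab[OF s] gt s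
      by (intro IVT' continuous_on_subset[OF nc]) (auto simp: I_def \<rho>_def)
    then obtain x where x: "a \<le> x" "x \<le> \<tau> s" "cmod (\<gamma> x) = s" by blast
    then have "x \<in> T s" using \<tau>ab[OF s] by (simp add: T_def)
    then have "\<tau> s \<le> x" unfolding \<tau>_def using bdd by (rule cInf_lower)
    then have "x = \<tau> s" using x by simp
    then show False using x gt by simp
  qed
  have "mono_on I \<tau>"
  proof (rule mono_onI)
    fix r s assume rs: "r \<in> I" "s \<in> I" "r \<le> s"
    then have "T s \<subseteq> T r" by (auto simp: T_def)
    then show "\<tau> r \<le> \<tau> s" unfolding \<tau>_def using bT[OF rs(2)] bdd by (intro cInf_superset_mono) auto
  qed
  then have "\<tau> \<in> borel_measurable (restrict_space borel I)" by (rule borel_measurable_mono_on_fnc)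
  then have "\<tau> \<in> borel_measurable (restrict_space lborel I)"
    by (simp cong: measurable_cong_sets add: sets_restrict_space measurable_def space_restrict_space)
  then have "\<tau> \<in> measurable (restrict_space lborel I) (restrict_space borel {a..b})"
    by (rule measurable_restrict_space2[rotated]) (use \<tau>ab in \<open>auto simp: space_restrict_space\<close>)
  then have "(\<lambda>s. \<gamma> (\<tau> s)) \<in> borel_measurable (restrict_space lborel I)"
    by (rule measurable_compose) (rule borel_measurable_continuous_on_restrict[OF \<gamma>(1)])
  then have "(1 - \<rho>) / 32 \<le> harmonic_measure unit_disk 0 E"
    by (rule harmonic_measure_ge_radial_projection[OF \<rho> I_def]) (use \<tau>ab \<tau>s \<gamma>(3) in auto)
  then show ?thesis by (simp add: \<rho>_def)
qed

end

subsection \<open>Components of level sets\<close>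

lemma closedin_level_set:
  assumes "\<psi> holomorphic_on unit_disk"
  shows "closedin (top_of_set unit_disk) (level_set \<psi> \<alpha>)"
proof -
  have "continuous_on unit_disk (\<lambda>z. cmod (\<psi> z))"
    using assms by (intro continuous_intros holomorphic_on_imp_continuous_on)
  from continuous_closedin_preimage[OF this closed_singleton[of \<alpha>]]
  show ?thesis by (simp add: level_set_def vimage_def Int_def)
qed

lemma closedin_component_level_set:
  assumes "\<psi> holomorphic_on unit_disk" "C \<in> components (level_set \<psi> \<alpha>)"
  shows "closedin (top_of_set unit_disk) C"
  using closedin_component[OF assms(2)] closedin_level_set[OF assms(1)] by (rule closedin_trans)

text \<open>If \<psi> were onto the plane, its inverse would be a bounded entire function, hence
  constant by Liouville's theorem.\<close>

lemma conformal_map_omits: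
  assumes "conformal_map \<psi>"
  obtains a where "a \<notin> \<psi> ` unit_disk"
proof -
  have hol: "\<psi> holomorphic_on unit_disk" and inj: "inj_on \<psi> unit_disk"
    using assms by (auto simp: conformal_map_def)
  obtain g where g: "g holomorphic_on \<psi> ` unit_disk" "\<And>z. z \<in> unit_disk \<Longrightarrow> g (\<psi> z) = z"
    using holomorphic_has_inverse[OF hol open_ball inj] by metis
  have "\<psi> ` unit_disk \<noteq> UNIV"
  proof
    assume U: "\<psi> ` unit_disk = UNIV"
    have "g x \<in> unit_disk" for x
    proof -
      obtain z where "z \<in> unit_disk" "x = \<psi> z" using U by blast
      then show ?thesis using g(2) by simp
    qed
    then have "range g \<subseteq> unit_disk" by blast
    then have "bounded (range g)" by (rule bounded_subset[OF bounded_ball])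
    then have "g constant_on UNIV" using g(1) U by (intro Liouville_theorem) auto
    then have "g (\<psi> 0) = g (\<psi> (1/2))" by (auto simp: constant_on_def)
    then show False using g(2)[of 0] g(2)[of "1/2"] by simp
  qed
  then show ?thesis using that by blast
qed

text \<open>The image is simply connected, so a closed path in it has winding number 0 about the
  omitted value \<open>a\<close>; a circle enclosing \<open>a\<close> has winding number 1.\<close>

lemma circle_not_subset_conformal_image:
  assumes conf: "conformal_map \<psi>" and a: "a \<notin> \<psi> ` unit_disk" "cmod a < \<alpha>"
  shows "\<not> sphere (0::complex) \<alpha> \<subseteq> \<psi> ` unit_disk"
proof
  assume sub: "sphere (0::complex) \<alpha> \<subseteq> \<psi> ` unit_disk"
  have hol: "\<psi> holomorphic_on unit_disk" and inj: "inj_on \<psi> unit_disk"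
    using conf by (auto simp: conformal_map_def)
  obtain g where g: "g holomorphic_on \<psi> ` unit_disk" "\<And>z. z \<in> unit_disk \<Longrightarrow> g (\<psi> z) = z"
    using holomorphic_has_inverse[OF hol open_ball inj] by metis
  have "homeomorphism unit_disk (\<psi> ` unit_disk) \<psi> g"
    using hol g by (intro homeomorphismI holomorphic_on_imp_continuous_on) auto
  then have "unit_disk homeomorphic \<psi> ` unit_disk" unfolding homeomorphic_def by blast
  then have sc: "simply_connected (\<psi> ` unit_disk)"
    using homeomorphic_simply_connected convex_imp_simply_connected convex_ball by blast
  have "0 < \<alpha>" using a norm_ge_zero[of a] by linarith
  then have "winding_number (circlepath 0 \<alpha>) a = 0"
    using sub a by (intro simply_connected_imp_winding_number_zero[OF sc]) auto
  moreover have "winding_number (circlepath 0 \<alpha>) a = 1"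
    using a by (intro winding_number_circlepath) simp
  ultimately show False by simp
qed

text \<open>From \<open>\<psi> w\<close> one travels along the circle of radius \<alpha> until the
  image of the disk is first left. The preimage of this arc is a curve in the component of
  \<open>w\<close> that is not contained in the closed disk of radius
  \<open>(1 + cmod w) / 2\<close>, so the curve estimate applies.\<close>

proposition harmonic_measure_component_ge:
  assumes conf: "conformal_map \<psi>" and \<psi>0: "\<psi> 0 = 0"
    and a: "a \<notin> \<psi> ` unit_disk" "cmod a < \<alpha>" and w: "w \<in> level_set \<psi> \<alpha>"
  shows "(1 - cmod w) / 32 \<le> harmonic_measure unit_disk 0 (connected_component_set (level_set \<psi> \<alpha>) w)"
proof -
  define C where "C = connected_component_set (level_set \<psi> \<alpha>) w"
  have hol: "\<psi> holomorphic_on unit_disk" and inj: "inj_on \<psi> unit_disk"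
    using conf by (auto simp: conformal_map_def)
  have cont: "continuous_on unit_disk \<psi>" using hol by (rule holomorphic_on_imp_continuous_on)
  obtain g where g: "g holomorphic_on \<psi> ` unit_disk" "\<And>z. z \<in> unit_disk \<Longrightarrow> g (\<psi> z) = z"
    using holomorphic_has_inverse[OF hol open_ball inj] by metis
  have gc: "continuous_on (\<psi> ` unit_disk) g" using g(1) by (rule holomorphic_on_imp_continuous_on)
  have \<alpha>: "0 < \<alpha>" using a norm_ge_zero[of a] by linarith
  have w': "w \<in> unit_disk" "cmod (\<psi> w) = \<alpha>" using w by (auto simp: level_set_def)
  have CF: "C \<subseteq> level_set \<psi> \<alpha>" unfolding C_def by (rule connected_component_subset)
  have "C \<in> components (level_set \<psi> \<alpha>)" using w by (auto simp: C_def components_def)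
  then have Ccl: "closedin (top_of_set unit_disk) C" using hol by (intro closedin_component_level_set)
  moreover have "0 \<notin> C" using CF \<psi>0 \<alpha> by (auto simp: level_set_def)
  ultimately interpret C: relatively_closed_in_disk C by unfold_locales
  define e where "e t = \<psi> w * cis t" for t
  have ec: "continuous_on A e" for A unfolding e_def by (intro continuous_intros)
  have en: "cmod (e t) = \<alpha>" for t using w' by (simp add: e_def norm_mult)
  have opn: "open (\<psi> ` unit_disk)" using hol inj by (intro open_mapping_thm3) auto
  \<comment> \<open>The exit times. There is one because the circle is not contained in the image,
    and there is a first one because the image is open.\<close>
  define T where "T = {t. 0 \<le> t \<and> e t \<notin> \<psi> ` unit_disk}"
  have "T \<noteq> {}"
  proof
    assume "T = {}"
    then have T0: "e t \<in> \<psi> ` unit_disk" if "0 \<le> t" for t using that by (auto simp: T_def)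
    have "sphere (0::complex) \<alpha> \<subseteq> \<psi> ` unit_disk"
    proof
      fix y assume "y \<in> sphere (0::complex) \<alpha>"
      then have "cmod (y / \<psi> w) = 1" using w' \<alpha> by (simp add: norm_divide)
      then have "cis (Arg2pi (y / \<psi> w)) = y / \<psi> w"
        using Arg2pi_eq[of "y / \<psi> w"] by (simp add: cis_conv_exp mult.commute)
      moreover have "\<psi> w \<noteq> 0" using w' \<alpha> by auto
      ultimately have "e (Arg2pi (y / \<psi> w)) = y" by (simp add: e_def)
      then show "y \<in> \<psi> ` unit_disk" using T0[of "Arg2pi (y / \<psi> w)"] Arg2pi_ge_0 by simp
    qed
    then show False using circle_not_subset_conformal_image[OF conf a] by simp
  qed
  moreover have "closed T"
  proof -
    have "closed ({0..} \<inter> e -` (- \<psi> ` unit_disk))"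
      by (rule continuous_closed_preimage[OF ec]) (use opn in auto)
    moreover have "T = {0..} \<inter> e -` (- \<psi> ` unit_disk)" by (auto simp: T_def)
    ultimately show ?thesis by metis
  qed
  moreover have bdd: "bdd_below T" by (rule bdd_belowI[of _ 0]) (simp add: T_def)
  ultimately have b: "Inf T \<in> T" by (intro closed_contains_Inf)
  define b where "b = Inf T"
  have b0: "0 \<le> b" "e b \<notin> \<psi> ` unit_disk" using b by (auto simp: b_def T_def)
  have "b \<noteq> 0" using b0 w' by (auto simp: e_def)
  then have bpos: "0 < b" using b0 by simp
  have inb: "e t \<in> \<psi> ` unit_disk" if "0 \<le> t" "t < b" for t
  proof (rule ccontr)
    assume "e t \<notin> \<psi> ` unit_disk"
    then have "t \<in> T" using that by (simp add: T_def)
    then have "b \<le> t" unfolding b_def using bdd by (rule cInf_lower)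
    then show False using that by simp
  qed
  define \<gamma> where "\<gamma> t = g (e t)" for t
  have \<gamma>D: "\<gamma> t \<in> unit_disk" "\<psi> (\<gamma> t) = e t" if t: "0 \<le> t" "t < b" for t
  proof -
    obtain z where "z \<in> unit_disk" "e t = \<psi> z" using inb[OF t] by blast
    then show "\<gamma> t \<in> unit_disk" "\<psi> (\<gamma> t) = e t" using g(2) by (simp_all add: \<gamma>_def)
  qed
  have \<gamma>c: "continuous_on {0..c} \<gamma>" if "c < b" for c
    unfolding \<gamma>_def by (rule continuous_on_compose2[OF gc ec]) (use inb that in auto)
  have \<gamma>0: "\<gamma> 0 = w" using g(2) w' by (simp add: \<gamma>_def e_def)
  have \<gamma>C: "\<gamma> t \<in> C" if t: "0 \<le> t" "t < b" for t
  proof -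
    have "connected (\<gamma> ` {0..t})" using \<gamma>c[OF t(2)] by (intro connected_continuous_image) auto
    moreover have "\<gamma> ` {0..t} \<subseteq> level_set \<psi> \<alpha>"
    proof (rule image_subsetI)
      fix s assume "s \<in> {0..t}"
      then have "0 \<le> s" "s < b" using t by auto
      from \<gamma>D[OF this] show "\<gamma> s \<in> level_set \<psi> \<alpha>" unfolding level_set_def by (simp add: en)
    qed
    moreover have "w \<in> \<gamma> ` {0..t}" using \<gamma>0 t by (intro image_eqI[of _ _ 0]) auto
    ultimately have "\<gamma> ` {0..t} \<subseteq> C" unfolding C_def by (intro connected_component_maximal)
    then show ?thesis using t by auto
  qed
  define s1 where "s1 = (1 + cmod w) / 2"
  have s1: "s1 < 1" using w' by (simp add: s1_def)
  \<comment> \<open>Otherwise the arc before time \<open>b\<close> would lie in the compact image of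
    a smaller closed disk, and so would its end point \<open>e b\<close>, which is not in the image
    at all.\<close>
  have "\<exists>t. 0 \<le> t \<and> t < b \<and> s1 \<le> cmod (\<gamma> t)"
  proof (rule ccontr)
    assume neg: "\<not> ?thesis"
    have "compact (\<psi> ` cball 0 s1)"
      using s1 by (intro compact_continuous_image continuous_on_subset[OF cont]) auto
    then have cl: "closed (\<psi> ` cball 0 s1)" by (rule compact_imp_closed)
    have "e t \<in> \<psi> ` cball 0 s1" if t: "t \<in> {0..<b}" for t
    proof (rule image_eqI[of _ _ "\<gamma> t"])
      have t': "0 \<le> t" "t < b" using t by auto
      then show "e t = \<psi> (\<gamma> t)" using \<gamma>D(2) by simp
      show "\<gamma> t \<in> cball 0 s1" using neg t' by (auto simp: not_le)
    qed
    then have "e ` {0..<b} \<subseteq> \<psi> ` cball 0 s1" by blast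
    moreover have "e ` closure {0..<b} \<subseteq> closure (e ` {0..<b})"
      by (rule image_closure_subset) (auto intro: ec closure_subset[THEN subsetD])
    ultimately have "e ` closure {0..<b} \<subseteq> \<psi> ` cball 0 s1" using cl closure_minimal by blast
    moreover have "b \<in> closure {0..<b}" using bpos by simp
    moreover have "\<psi> ` cball 0 s1 \<subseteq> \<psi> ` unit_disk" using s1 by (intro image_mono) auto
    ultimately show False using b0 by blast
  qed
  then obtain t where t: "0 \<le> t" "t < b" "s1 \<le> cmod (\<gamma> t)" by blast
  have "(1 - cmod (\<gamma> 0)) / 32 \<le> harmonic_measure unit_disk 0 C"
    by (rule C.harmonic_measure_ge_curve[OF \<gamma>c[OF t(2)] t(1)])
       (use t \<gamma>C \<gamma>0 in \<open>auto simp: s1_def\<close>)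
  then show ?thesis by (simp add: \<gamma>0 C_def)
qed

subsection \<open>Area of holomorphic images\<close>

text \<open>The transfer to \<open>real^2\<close> makes the change of variables formula with a
  Jacobian determinant applicable.\<close>

definition vec_of_complex :: "complex \<Rightarrow> real^2" where
  "vec_of_complex z = vector [Re z, Im z]"

definition complex_of_vec :: "real^2 \<Rightarrow> complex" where
  "complex_of_vec v = Complex (v $ 1) (v $ 2)"

lemma vec_of_complex_nth [simp]: "vec_of_complex z $ 1 = Re z" "vec_of_complex z $ 2 = Im z"
  by (simp_all add: vec_of_complex_def)

lemma complex_of_vec_inverse [simp]:
  "complex_of_vec (vec_of_complex z) = z" "vec_of_complex (complex_of_vec v) = v"
  by (simp_all add: vec_of_complex_def complex_of_vec_def vec_eq_iff forall_2)

lemma bounded_linear_vec_of_complex: "bounded_linear vec_of_complex"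
  unfolding vec_of_complex_def
  by (rule linear_conv_bounded_linear[THEN iffD1], rule linearI) (simp_all add: vec_eq_iff forall_2)

lemma bounded_linear_complex_of_vec: "bounded_linear complex_of_vec"
  by (rule linear_conv_bounded_linear[THEN iffD1], rule linearI) (simp_all add: complex_of_vec_def complex_eq_iff)

lemma continuous_on_complex_of_vec: "continuous_on A complex_of_vec"
  using bounded_linear_complex_of_vec by (rule linear_continuous_on)

lemma borel_measurable_vector_2: "(\<lambda>(x, y). vector [x, y] :: real^2) \<in> borel_measurable borel"
proof (rule borel_measurable_continuous_onI)
  have "continuous_on UNIV (\<lambda>p::real\<times>real. if i = 1 then fst p else snd p)" for i :: 2
    by (cases "i = 1") (auto intro!: continuous_intros)
  then have "continuous_on UNIV (\<lambda>p::real\<times>real. (\<chi> i. if i = 1 then fst p else snd p) :: real^2)"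
    by (rule continuous_on_vec_lambda)
  moreover have "(\<lambda>(x, y). vector [x, y] :: real^2) = (\<lambda>p. \<chi> i. if i = 1 then fst p else snd p)"
    by (auto simp: fun_eq_iff vec_eq_iff forall_2)
  ultimately show "continuous_on UNIV (\<lambda>(x, y). vector [x, y] :: real^2)" by simp
qed

text \<open>Agreement on boxes determines Lebesgue measure. This converts area integrals over
  \<open>real^2\<close> into iterated integrals over pairs of reals.\<close>

lemma distr_lborel_vec:
  "distr lborel borel (\<lambda>(x, y). vector [x, y]) = (lborel :: (real^2) measure)"
proof (rule sym, rule lborel_eqI)
  fix l u :: "real^2" assume lu: "\<And>b. b \<in> Basis \<Longrightarrow> l \<bullet> b \<le> u \<bullet> b"
  have "l \<bullet> axis 1 1 \<le> u \<bullet> axis 1 1" "l \<bullet> axis 2 1 \<le> u \<bullet> axis 2 1"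
    by (rule lu, simp)+
  then have lu': "l $ 1 \<le> u $ 1" "l $ 2 \<le> u $ 2" by (simp_all add: inner_axis)
  have "(\<lambda>(x, y). vector [x, y] :: real^2) -` box l u = {l$1<..<u$1} \<times> {l$2<..<u$2}"
    by (auto simp: mem_box_cart forall_2)
  then have "emeasure (distr lborel borel (\<lambda>(x, y). vector [x, y])) (box l u)
      = emeasure (lborel :: (real \<times> real) measure) ({l$1<..<u$1} \<times> {l$2<..<u$2})"
    using borel_measurable_vector_2 by (subst emeasure_distr) auto
  also have "\<dots> = ennreal (u$1 - l$1) * ennreal (u$2 - l$2)"
    using lu' by (simp add: lborel_prod[symmetric] lborel.emeasure_pair_measure_Times)
  also have "\<dots> = ennreal ((u$1 - l$1) * (u$2 - l$2))"
    using lu' by (simp add: ennreal_mult)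
  also have "(u$1 - l$1) * (u$2 - l$2) = (\<Prod>b\<in>Basis. (u - l) \<bullet> b)"
  proof -
    have B: "(Basis :: (real^2) set) = {axis 1 1, axis 2 1}" by (auto simp: Basis_vec_def UNIV_2)
    have "axis 1 1 \<noteq> (axis 2 1 :: real^2)" by (simp add: axis_eq_axis)
    then show ?thesis unfolding B by (simp add: inner_axis)
  qed
  finally show "emeasure (distr lborel borel (\<lambda>(x, y). vector [x, y])) (box l u) = ennreal (\<Prod>b\<in>Basis. (u - l) \<bullet> b)" .
qed simp

text \<open>The Jacobian determinant of a holomorphic map is the squared modulus of its derivative,
  and injectivity makes its integral over \<open>S\<close> equal to the area of the image. The inner
  integral runs along horizontal lines, as the length-area argument needs; the indicator of
  \<open>R\<close> makes the integrand Borel on the whole plane.\<close>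

lemma nn_integral_deriv_square_le_area:
  assumes S: "open R" "S \<subseteq> R" "S \<in> sets borel" and \<Phi>: "\<Phi> holomorphic_on R" "inj_on \<Phi> R"
    and img: "complex_of_vec -` (\<Phi> ` S) \<in> sets borel"
    and A: "emeasure lborel (complex_of_vec -` (\<Phi> ` S)) \<le> ennreal A"
  shows "(\<integral>\<^sup>+y. \<integral>\<^sup>+x. ennreal (indicator S (Complex x y) * (cmod (indicator R (Complex x y) *\<^sub>R deriv \<Phi> (Complex x y)))\<^sup>2) \<partial>lborel \<partial>lborel)
    \<le> ennreal A"
proof -
  define F where "F z = indicat_real S z * (cmod (indicat_real R z *\<^sub>R deriv \<Phi> z))\<^sup>2" for z
  have Fm: "F \<in> borel_measurable borel"
  proof -
    have "continuous_on R (deriv \<Phi>)"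
      using \<Phi>(1) S(1) by (intro holomorphic_on_imp_continuous_on holomorphic_deriv)
    then have "(\<lambda>z. indicat_real R z *\<^sub>R deriv \<Phi> z) \<in> borel_measurable borel"
      by (intro borel_measurable_continuous_on_indicator) (use S in auto)
    then show ?thesis unfolding F_def using S(3) by measurable
  qed
  have Jm: "complex_of_vec \<in> borel_measurable borel"
    by (rule borel_measurable_continuous_onI) (rule continuous_on_complex_of_vec)
  define S2 where "S2 = complex_of_vec -` S"
  have S2: "S2 \<in> sets borel" unfolding S2_def using measurable_sets[OF Jm S(3)] by simp
  define g where "g v = vec_of_complex (\<Phi> (complex_of_vec v))" for v
  define g' where "g' v h = vec_of_complex (deriv \<Phi> (complex_of_vec v) * complex_of_vec h)" for v h
  have der: "(g has_derivative g' v) (at v within S2)" if v: "v \<in> S2" for v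
  proof -
    have "complex_of_vec v \<in> R" using v S by (auto simp: S2_def)
    then have "(\<Phi> has_derivative (\<lambda>h. deriv \<Phi> (complex_of_vec v) * h)) (at (complex_of_vec v))"
      using \<Phi>(1) S(1) holomorphic_derivI has_field_derivative_imp_has_derivative by blast
    then have "((\<lambda>v. \<Phi> (complex_of_vec v)) has_derivative (\<lambda>h. deriv \<Phi> (complex_of_vec v) * complex_of_vec h)) (at v)"
      by (rule has_derivative_compose[OF bounded_linear_imp_has_derivative[OF bounded_linear_complex_of_vec]])
    from bounded_linear.has_derivative[OF bounded_linear_vec_of_complex this]
    show ?thesis unfolding g_def[abs_def] g'_def[abs_def] by (rule has_derivative_at_withinI)
  qed
  have inj: "inj_on g S2"
  proof (rule inj_onI)
    fix v w assume vw: "v \<in> S2" "w \<in> S2" "g v = g w"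
    then have "\<Phi> (complex_of_vec v) = \<Phi> (complex_of_vec w)"
      unfolding g_def by (metis complex_of_vec_inverse(1))
    then have "complex_of_vec v = complex_of_vec w"
      using \<Phi>(2) vw S by (auto simp: S2_def inj_on_def)
    then show "v = w" by (metis complex_of_vec_inverse(2))
  qed
  have img_eq: "g ` S2 = complex_of_vec -` (\<Phi> ` S)"
  proof (intro equalityI subsetI)
    fix w assume "w \<in> complex_of_vec -` (\<Phi> ` S)"
    then obtain z where "z \<in> S" "complex_of_vec w = \<Phi> z" by auto
    then show "w \<in> g ` S2"
      by (intro image_eqI[of _ _ "vec_of_complex z"]) (simp_all add: g_def S2_def, metis complex_of_vec_inverse(2))
  qed (auto simp: g_def S2_def)
  have fin: "emeasure lborel (g ` S2) < \<infinity>" unfolding img_eq using A by (rule order_le_less_trans) simp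
  have lm: "g ` S2 \<in> lmeasurable"
    using fin img by (intro fmeasurableI) (auto simp: img_eq)
  have det: "\<bar>det (matrix (g' v))\<bar> = F (complex_of_vec v)" if "v \<in> S2" for v
  proof -
    have "complex_of_vec (axis 1 1) = 1" "complex_of_vec (axis 2 1) = \<i>"
      by (simp_all add: complex_of_vec_def complex_eq_iff axis_def)
    \<comment> \<open>The columns of the matrix are the derivative and \<i> times the derivative,
      which is the content of the Cauchy-Riemann equations.\<close>
    then have "det (matrix (g' v)) = (Re (deriv \<Phi> (complex_of_vec v)))\<^sup>2 + (Im (deriv \<Phi> (complex_of_vec v)))\<^sup>2"
      by (simp add: det_2 matrix_def g'_def power2_eq_square)
    also have "\<dots> = (cmod (deriv \<Phi> (complex_of_vec v)))\<^sup>2" by (simp add: cmod_power2)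
    finally show ?thesis using that S by (auto simp: F_def S2_def)
  qed
  have "((\<lambda>v. \<bar>det (matrix (g' v))\<bar>) has_integral measure lebesgue (g ` S2)) S2"
    using has_measure_differentiable_image[OF _ der inj] S2 lm by (metis sets_completionI_sets sets_lborel)
  then have "((\<lambda>v. F (complex_of_vec v)) has_integral measure lebesgue (g ` S2)) S2"
    by (rule has_integral_eq[rotated]) (rule det)
  then have "(\<integral>\<^sup>+v. ennreal (indicator S2 v * F (complex_of_vec v)) \<partial>lborel) = ennreal (measure lebesgue (g ` S2))"
    by (intro nn_integral_has_integral_lebesgue) (auto simp: F_def)
  also have "(\<lambda>v. indicator S2 v * F (complex_of_vec v)) = (\<lambda>v. F (complex_of_vec v))"
    by (auto simp: F_def S2_def fun_eq_iff indicator_def)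
  also have "measure lebesgue (g ` S2) = measure lborel (g ` S2)"
    using img by (simp add: img_eq)
  also have "ennreal \<dots> = emeasure lborel (g ` S2)"
    using fin by (intro emeasure_eq_ennreal_measure[symmetric]) auto
  also have "\<dots> \<le> ennreal A" using A by (simp add: img_eq)
  finally have "(\<integral>\<^sup>+v. ennreal (F (complex_of_vec v)) \<partial>lborel) \<le> ennreal A" .
  also have "(\<integral>\<^sup>+v. ennreal (F (complex_of_vec v)) \<partial>lborel)
      = (\<integral>\<^sup>+v. ennreal (F (complex_of_vec v)) \<partial>distr lborel borel (\<lambda>(x, y). vector [x, y]))"
    unfolding distr_lborel_vec ..
  also have "\<dots> = (\<integral>\<^sup>+p. ennreal (F (case p of (x, y) \<Rightarrow> Complex x y)) \<partial>lborel)"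
  proof -
    have m: "(\<lambda>(x, y). vector [x, y] :: real^2) \<in> measurable lborel borel"
      using borel_measurable_vector_2 by simp
    have "(\<lambda>v. ennreal (F (complex_of_vec v))) \<in> borel_measurable borel" using Fm Jm by measurable
    then have "(\<lambda>v. ennreal (F (complex_of_vec v)))
        \<in> borel_measurable (distr lborel borel (\<lambda>(x, y). vector [x, y]))" by simp
    from nn_integral_distr[OF m this]
    have "(\<integral>\<^sup>+v. ennreal (F (complex_of_vec v)) \<partial>distr lborel borel (\<lambda>(x, y). vector [x, y]))
        = (\<integral>\<^sup>+p. ennreal (F (complex_of_vec (case p of (x, y) \<Rightarrow> vector [x, y]))) \<partial>lborel)" .
    also have "\<dots> = (\<integral>\<^sup>+p. ennreal (F (case p of (x, y) \<Rightarrow> Complex x y)) \<partial>lborel)"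
      by (intro nn_integral_cong) (auto simp: complex_of_vec_def)
    finally show ?thesis .
  qed
  also have "\<dots> = (\<integral>\<^sup>+p. ennreal (F (case p of (x, y) \<Rightarrow> Complex x y)) \<partial>(lborel \<Otimes>\<^sub>M lborel))"
    by (simp add: lborel_prod)
  also have "\<dots> = (\<integral>\<^sup>+y. \<integral>\<^sup>+x. ennreal (F (Complex x y)) \<partial>lborel \<partial>lborel)"
  proof -
    have "(\<lambda>p. case p of (x, y) \<Rightarrow> Complex x y) \<in> borel_measurable (borel :: (real \<times> real) measure)"
      unfolding case_prod_unfold Complex_eq by (intro borel_measurable_continuous_onI continuous_intros)
    then have "(\<lambda>p. ennreal (F (case p of (x, y) \<Rightarrow> Complex x y))) \<in> borel_measurable (lborel \<Otimes>\<^sub>M lborel)"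
      unfolding lborel_prod using Fm by measurable
    from lborel_pair.nn_integral_snd[OF this] show ?thesis by simp
  qed
  finally show ?thesis by (simp only: F_def)
qed

text \<open>\<open>V\<close> is cut into bands of height 2 pi, and all pieces are shifted vertically
  into one rectangle of sides 1 and 2 pi. Translation preserves measure, and the hypothesis keeps
  the shifted pieces \<open>Wk k\<close> disjoint.\<close>

lemma emeasure_le_of_vertical_translates_disjoint:
  fixes V :: "(real^2) set"
  assumes V: "V \<in> sets borel" and strip: "\<And>v. v \<in> V \<Longrightarrow> s \<le> v $ 1 \<and> v $ 1 \<le> s + 1"
    and disj: "\<And>v w k. v \<in> V \<Longrightarrow> w \<in> V \<Longrightarrow> v $ 1 = w $ 1 \<Longrightarrow> v $ 2 = w $ 2 + 2 * pi * of_int k \<Longrightarrow> k = 0"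
  shows "emeasure lborel V \<le> ennreal (2 * pi)"
proof -
  define c where "c k = (vector [0, 2 * pi * of_int k] :: real^2)" for k :: int
  define Vk where "Vk k = V \<inter> {v. 2 * pi * of_int k \<le> v $ 2 \<and> v $ 2 < 2 * pi * (of_int k + 1)}" for k :: int
  define Wk where "Wk k = (+) (c k) -` Vk k" for k
  have m: "Vk k \<in> sets borel" for k
  proof -
    have "{v::real^2. 2 * pi * of_int k \<le> v $ 2 \<and> v $ 2 < 2 * pi * (of_int k + 1)}
        = {v. 2 * pi * of_int k \<le> v $ 2} \<inter> {v. v $ 2 < 2 * pi * (of_int k + 1)}" by auto
    moreover have "closed {v::real^2. 2 * pi * of_int k \<le> v $ 2}"
      by (intro closed_Collect_le continuous_intros)
    moreover have "open {v::real^2. v $ 2 < 2 * pi * (of_int k + 1)}"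
      by (intro open_Collect_less continuous_intros)
    ultimately show ?thesis unfolding Vk_def using V by auto
  qed
  have mW: "Wk k \<in> sets borel" for k
  proof -
    have "(+) (c k) \<in> borel_measurable borel" by simp
    from measurable_sets[OF this m[of k]] show ?thesis by (simp add: Wk_def)
  qed
  have em: "emeasure lborel (Wk k) = emeasure lborel (Vk k)" for k
  proof -
    have "emeasure lborel (Vk k) = emeasure (distr lborel borel ((+) (c k))) (Vk k)" by (simp add: lborel_distr_plus)
    also have "\<dots> = emeasure lborel (Wk k)" using m by (subst emeasure_distr) (auto simp: Wk_def)
    finally show ?thesis by simp
  qed
  have V_eq: "V = (\<Union>k. Vk k)"
  proof -
    have "v \<in> Vk \<lfloor>v $ 2 / (2 * pi)\<rfloor>" if "v \<in> V" for v
    proof -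
      define k where "k = \<lfloor>v $ 2 / (2 * pi)\<rfloor>"
      have "of_int k \<le> v $ 2 / (2 * pi)" "v $ 2 / (2 * pi) < of_int k + 1"
        unfolding k_def by linarith+
      then have "2 * pi * of_int k \<le> v $ 2" "v $ 2 < 2 * pi * (of_int k + 1)"
        using pi_gt_zero by (simp_all add: le_divide_eq divide_less_eq mult.commute)
      then show ?thesis using that by (simp add: Vk_def k_def)
    qed
    then show ?thesis by (auto simp: Vk_def)
  qed
  have dV: "disjoint_family Vk"
    unfolding disjoint_family_on_def
  proof (intro ballI impI)
    fix j k :: int assume jk: "j \<noteq> k"
    show "Vk j \<inter> Vk k = {}"
    proof (rule ccontr)
      assume "Vk j \<inter> Vk k \<noteq> {}"
      then obtain v :: "real^2" where "2 * pi * of_int j \<le> v $ 2" "v $ 2 < 2 * pi * (of_int j + 1)"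
        "2 * pi * of_int k \<le> v $ 2" "v $ 2 < 2 * pi * (of_int k + 1)" by (auto simp: Vk_def)
      then have "2 * pi * real_of_int j < 2 * pi * (of_int k + 1)" "2 * pi * real_of_int k < 2 * pi * (of_int j + 1)" by linarith+
      then have "real_of_int j < of_int k + 1" "real_of_int k < of_int j + 1" by simp_all
      then show False using jk by linarith
    qed
  qed
  have dW: "disjoint_family Wk"
    unfolding disjoint_family_on_def
  proof (intro ballI impI)
    fix j k :: int assume jk: "j \<noteq> k"
    show "Wk j \<inter> Wk k = {}"
    proof (rule ccontr)
      assume "Wk j \<inter> Wk k \<noteq> {}"
      then obtain v where v: "c j + v \<in> V" "c k + v \<in> V" by (auto simp: Wk_def Vk_def)
      \<comment> \<open>A common point of two shifted pieces comes from two points of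
        \<open>V\<close> that differ vertically by a nonzero multiple of 2 pi.\<close>
      have "(c j + v) $ 1 = (c k + v) $ 1" "(c j + v) $ 2 = (c k + v) $ 2 + 2 * pi * of_int (j - k)"
        by (simp_all add: c_def algebra_simps)
      from disj[OF v this] show False using jk by simp
    qed
  qed
  have "emeasure lborel V = (\<integral>\<^sup>+k. emeasure lborel (Vk k) \<partial>count_space UNIV)"
    unfolding V_eq by (rule emeasure_UN_countable) (use m dV in auto)
  also have "\<dots> = (\<integral>\<^sup>+k. emeasure lborel (Wk k) \<partial>count_space UNIV)" by (simp only: em)
  also have "\<dots> = emeasure lborel (\<Union>k. Wk k)"
    by (rule emeasure_UN_countable[symmetric]) (use mW dW in auto)
  also have "\<dots> \<le> emeasure lborel (cbox (vector [s, 0]) (vector [s + 1, 2 * pi]) :: (real^2) set)"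
  proof (rule emeasure_mono)
    show "(\<Union>k. Wk k) \<subseteq> cbox (vector [s, 0]) (vector [s + 1, 2 * pi])"
    proof
      fix v assume "v \<in> (\<Union>k. Wk k)"
      then obtain k where k: "c k + v \<in> Vk k" by (auto simp: Wk_def)
      then have "c k + v \<in> V" by (simp add: Vk_def)
      from strip[OF this] k show "v \<in> cbox (vector [s, 0]) (vector [s + 1, 2 * pi])"
        by (simp add: Vk_def c_def mem_box_cart forall_2 algebra_simps)
    qed
  qed simp
  also have "\<dots> = ennreal (2 * pi)"
  proof -
    have B: "(Basis :: (real^2) set) = {axis 1 1, axis 2 1}" by (auto simp: Basis_vec_def UNIV_2)
    have "axis 1 1 \<noteq> (axis 2 1 :: real^2)" by (simp add: axis_eq_axis)
    then show ?thesis by (simp add: emeasure_lborel_cbox_eq B inner_axis)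
  qed
  finally show ?thesis .
qed

subsection \<open>The length-area estimate\<close>

text \<open>\<open>x2\<close> is the first time at level \<open>t\<close> and \<open>x1\<close> the
  last time before it at level \<open>s\<close>; by the intermediate value theorem the function
  stays between the two levels in the meantime.\<close>

lemma continuous_crossing:
  fixes u :: "real \<Rightarrow> real"
  assumes u: "continuous_on {a..b} u" and ab: "a \<le> b" "u a \<le> s" "s \<le> t" "t \<le> u b"
  obtains x1 x2 where "a \<le> x1" "x1 \<le> x2" "x2 \<le> b" "u x1 = s" "u x2 = t"
    "\<And>x. x \<in> {x1..x2} \<Longrightarrow> s \<le> u x \<and> u x \<le> t"
proof -
  define A where "A = {x\<in>{a..b}. u x = t}"
  have cA: "closed A"
    unfolding A_def using continuous_closed_preimage[OF u, of "{t}"] by (simp add: vimage_def Int_def)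
  have "A \<noteq> {}" using IVT'[of u a t b] u ab by (auto simp: A_def)
  have bA: "bdd_below A" by (rule bdd_belowI[of _ a]) (simp add: A_def)
  define x2 where "x2 = Inf A"
  have x2: "x2 \<in> A" unfolding x2_def using cA \<open>A \<noteq> {}\<close> bA by (intro closed_contains_Inf)
  then have x2': "a \<le> x2" "x2 \<le> b" "u x2 = t" by (auto simp: A_def)
  have u2: "continuous_on {a..x2} u" using u x2' by (auto intro: continuous_on_subset)
  define B where "B = {x\<in>{a..x2}. u x = s}"
  have cB: "closed B"
    unfolding B_def using continuous_closed_preimage[OF u2, of "{s}"] by (simp add: vimage_def Int_def)
  have "B \<noteq> {}" using IVT'[of u a s x2] u2 ab x2' by (auto simp: B_def)
  have bB: "bdd_above B" by (rule bdd_aboveI[of _ x2]) (simp add: B_def)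
  define x1 where "x1 = Sup B"
  have "x1 \<in> B" unfolding x1_def using cB \<open>B \<noteq> {}\<close> bB by (intro closed_contains_Sup)
  then have x1': "a \<le> x1" "x1 \<le> x2" "u x1 = s" by (auto simp: B_def)
  have "s \<le> u x \<and> u x \<le> t" if x: "x \<in> {x1..x2}" for x
  proof (intro conjI)
    show "s \<le> u x"
    proof (rule ccontr)
      assume n: "\<not> s \<le> u x"
      have "continuous_on {x..x2} u" using u2 x x1' by (auto intro: continuous_on_subset)
      then obtain y where y: "x \<le> y" "y \<le> x2" "u y = s"
        using IVT'[of u x s x2] n x x2' ab by auto
      then have "y \<in> B" using x x1' by (auto simp: B_def)
      then have "y \<le> x1" unfolding x1_def using bB by (rule cSup_upper)
      then have "x = x1" using x y by auto
      then show False using n x1' by simp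
    qed
    show "u x \<le> t"
    proof (rule ccontr)
      assume n: "\<not> u x \<le> t"
      have "continuous_on {a..x} u" using u2 x by (auto intro: continuous_on_subset)
      then obtain y where y: "a \<le> y" "y \<le> x" "u y = t"
        using IVT'[of u a t x] n x x1' ab by auto
      then have "y \<in> A" using x x2' by (auto simp: A_def)
      then have "x2 \<le> y" unfolding x2_def using bA by (rule cInf_lower)
      then have "x = x2" using x y by auto
      then show False using n x2' by simp
    qed
  qed
  from that[OF x1'(1,2) x2'(2) x1'(3) x2'(3) this] show ?thesis .
qed

text \<open>In logarithmic coordinates rays become horizontal lines. On the line of each angle in
  \<open>Y\<close> the real part of f climbs from \<open>s\<close> to \<open>s + 1\<close> over a
  length of at most \<open>- ln \<rho>\<close>, so the squared derivative has integral at least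
  \<open>1 / - ln \<rho>\<close> on that line. The total of these integrals is at most the area 2 pi
  available in the strip.\<close>

proposition length_area:
  fixes f :: "complex \<Rightarrow> complex"
  assumes f: "f holomorphic_on unit_disk"
    and sep: "\<And>z w k. z \<in> unit_disk \<Longrightarrow> w \<in> unit_disk \<Longrightarrow> f z = f w + 2 * pi * of_int k * \<i> \<Longrightarrow> z = w"
    and \<rho>: "0 < \<rho>" "\<rho> < 1" and le: "\<And>z. cmod z \<le> \<rho> \<Longrightarrow> Re (f z) \<le> s"
    and Y_def: "Y = {y\<in>{0<..<2*pi}. \<exists>r\<in>{0<..<1}. s + 1 < Re (f (of_real r * cis y))}"
  shows "open Y" "emeasure lborel Y \<le> ennreal (2 * pi * - ln \<rho>)"
proof -
  define \<Phi> where "\<Phi> \<zeta> = f (exp \<zeta>)" for \<zeta>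
  define R where "R = {\<zeta>. Re \<zeta> < 0 \<and> 0 < Im \<zeta> \<and> Im \<zeta> < 2*pi}"
  have R: "open R"
    unfolding R_def by (intro open_Collect_conj open_Collect_less continuous_intros)
  have expD: "exp \<zeta> \<in> unit_disk" if "Re \<zeta> < 0" for \<zeta> :: complex using that by simp
  have \<Phi>: "\<Phi> holomorphic_on R"
    unfolding \<Phi>_def by (rule holomorphic_on_compose_gen[OF holomorphic_on_exp f, unfolded o_def]) (use expD in \<open>auto simp: R_def\<close>)
  \<comment> \<open>\<open>R\<close> has height 2 pi, so \<open>exp\<close> is injective on it, and
    then equality of the two points forces \<open>k = 0\<close>.\<close>
  have sep': "\<zeta> = \<zeta>' \<and> k = 0" if \<zeta>: "\<zeta> \<in> R" "\<zeta>' \<in> R" and eq: "\<Phi> \<zeta> = \<Phi> \<zeta>' + 2 * pi * of_int k * \<i>" for \<zeta> \<zeta>' k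
  proof -
    have "exp \<zeta> = exp \<zeta>'" using sep[OF expD expD] \<zeta> eq unfolding \<Phi>_def R_def by blast
    moreover have "\<bar>Im \<zeta> - Im \<zeta>'\<bar> < 2 * pi" using \<zeta> by (auto simp: R_def)
    ultimately have "\<zeta> = \<zeta>'" by (rule exp_complex_eqI[rotated])
    then have "2 * pi * of_int k * \<i> = 0" using eq by simp
    then show ?thesis using \<open>\<zeta> = \<zeta>'\<close> by simp
  qed
  have inj: "inj_on \<Phi> R"
  proof (rule inj_onI)
    fix x y assume "x \<in> R" "y \<in> R" "\<Phi> x = \<Phi> y"
    then show "x = y" using sep'[of x y 0] by simp
  qed
  have \<Phi>c: "continuous_on R \<Phi>" using \<Phi> by (rule holomorphic_on_imp_continuous_on)
  define S where "S = {\<zeta>\<in>R. s \<le> Re (\<Phi> \<zeta>) \<and> Re (\<Phi> \<zeta>) \<le> s + 1}"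
  have SR: "S \<subseteq> R" by (auto simp: S_def)
  have Sb: "S \<in> sets borel"
  proof -
    have "continuous_on R (\<lambda>\<zeta>. Re (\<Phi> \<zeta>))" using \<Phi>c by (intro continuous_intros)
    from borel_measurable_continuous_on_restrict[OF this]
    have "(\<lambda>\<zeta>. Re (\<Phi> \<zeta>)) -` {s..s+1} \<inter> space (restrict_space borel R) \<in> sets (restrict_space borel R)"
      by (rule measurable_sets) simp
    then have "(\<lambda>\<zeta>. Re (\<Phi> \<zeta>)) -` {s..s+1} \<inter> R \<in> sets (restrict_space borel R)"
      by (simp add: space_restrict_space)
    moreover have "(\<lambda>\<zeta>. Re (\<Phi> \<zeta>)) -` {s..s+1} \<inter> R = S" by (auto simp: S_def)
    ultimately show ?thesis using R by (simp add: sets_restrict_space_iff)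
  qed
  define V where "V = complex_of_vec -` (\<Phi> ` S)"
  have \<Phi>S: "\<Phi> ` S = \<Phi> ` R \<inter> {w. s \<le> Re w} \<inter> {w. Re w \<le> s + 1}" by (auto simp: S_def)
  have "\<Phi> ` S \<in> sets borel"
  proof -
    have "open (\<Phi> ` R)" using \<Phi> R inj by (rule open_mapping_thm3)
    moreover have "closed {w. s \<le> Re w}" "closed {w. Re w \<le> s + 1}"
      by (simp_all add: closed_halfspace_Re_ge closed_halfspace_Re_le)
    ultimately show ?thesis unfolding \<Phi>S by auto
  qed
  then have Vb: "V \<in> sets borel"
    using measurable_sets[OF borel_measurable_continuous_onI[OF continuous_on_complex_of_vec[of UNIV]]]
    by (simp add: V_def)
  have VA: "emeasure lborel V \<le> ennreal (2 * pi)"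
  proof (rule emeasure_le_of_vertical_translates_disjoint[OF Vb])
    show "s \<le> v $ 1 \<and> v $ 1 \<le> s + 1" if v: "v \<in> V" for v :: "real^2"
    proof -
      obtain \<zeta> where "\<zeta> \<in> S" "complex_of_vec v = \<Phi> \<zeta>" using v by (auto simp: V_def)
      then have "s \<le> Re (complex_of_vec v) \<and> Re (complex_of_vec v) \<le> s + 1" by (simp add: S_def)
      then show ?thesis by (simp add: complex_of_vec_def)
    qed
    fix v w :: "real^2" and k :: int
    assume v: "v \<in> V" and w: "w \<in> V" and eq: "v $ 1 = w $ 1" "v $ 2 = w $ 2 + 2 * pi * of_int k"
    obtain \<zeta> where \<zeta>: "\<zeta> \<in> S" "complex_of_vec v = \<Phi> \<zeta>" using v by (auto simp: V_def)
    obtain \<zeta>' where \<zeta>': "\<zeta>' \<in> S" "complex_of_vec w = \<Phi> \<zeta>'" using w by (auto simp: V_def)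
    have "complex_of_vec v = complex_of_vec w + 2 * pi * of_int k * \<i>"
      using eq by (simp add: complex_of_vec_def complex_eq_iff)
    then show "k = 0" using sep'[of \<zeta> \<zeta>' k] \<zeta> \<zeta>' SR by auto
  qed
  define F where "F y x = indicat_real S (Complex x y) * (cmod (indicat_real R (Complex x y) *\<^sub>R deriv \<Phi> (Complex x y)))\<^sup>2" for y x
  have area: "(\<integral>\<^sup>+y. \<integral>\<^sup>+x. ennreal (F y x) \<partial>lborel \<partial>lborel) \<le> ennreal (2 * pi)"
    unfolding F_def by (rule nn_integral_deriv_square_le_area[OF R SR Sb \<Phi> inj]) (use Vb VA in \<open>simp_all add: V_def\<close>)
  define lr where "lr = - ln \<rho>"
  have lr: "0 < lr" using \<rho> by (simp add: lr_def ln_less_zero)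
  have ray: "ennreal (1 / lr) \<le> (\<integral>\<^sup>+x. ennreal (F y x) \<partial>lborel)" if y: "y \<in> Y" for y
  proof -
    have y': "0 < y" "y < 2 * pi" using y by (auto simp: Y_def)
    obtain r where r: "0 < r" "r < 1" "s + 1 < Re (f (of_real r * cis y))" using y by (auto simp: Y_def)
    have expc: "exp (Complex x y) = of_real (exp x) * cis y" for x
      by (simp add: exp_eq_polar)
    define u where "u x = Re (\<Phi> (Complex x y))" for x
    have inR: "Complex x y \<in> R" if "x < 0" for x using that y' by (simp add: R_def)
    have der: "(u has_real_derivative Re (deriv \<Phi> (Complex x y))) (at x)" if "x < 0" for x
    proof -
      have "(\<Phi> has_field_derivative deriv \<Phi> (Complex x y)) (at (Complex x y))"
        using \<Phi> R inR[OF that] by (rule holomorphic_derivI)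
      moreover have "((\<lambda>x. Complex x y) has_vector_derivative 1) (at x)"
      proof -
        have "((\<lambda>x. of_real x + \<i> * of_real y) has_vector_derivative 1) (at x)"
          by (auto intro!: derivative_eq_intros)
        then show ?thesis by (simp add: Complex_eq)
      qed
      ultimately have "((\<lambda>x. \<Phi> (Complex x y)) has_vector_derivative 1 * deriv \<Phi> (Complex x y)) (at x)"
        using field_vector_diff_chain_at[of "\<lambda>x. Complex x y" 1 x \<Phi> "deriv \<Phi> (Complex x y)"] by (simp add: o_def)
      then have "((\<lambda>x. Re (\<Phi> (Complex x y))) has_vector_derivative Re (deriv \<Phi> (Complex x y))) (at x)"
        using bounded_linear.has_vector_derivative[OF bounded_linear_Re] by fastforce
      then show ?thesis by (simp add: u_def[abs_def] has_real_derivative_iff_has_vector_derivative)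
    qed
    have lnr: "ln \<rho> \<le> ln r"
    proof (rule ccontr)
      assume "\<not> ln \<rho> \<le> ln r"
      then have "r \<le> \<rho>" using r \<rho> by (simp add: not_le)
      then have "Re (f (of_real r * cis y)) \<le> s" using r by (intro le) (simp add: norm_mult)
      then show False using r by simp
    qed
    have lnr0: "ln r < 0" using r by simp
    have "u (ln \<rho>) \<le> s" unfolding u_def \<Phi>_def expc using \<rho> by (intro le) (simp add: norm_mult)
    moreover have "s + 1 \<le> u (ln r)" unfolding u_def \<Phi>_def expc using r by simp
    moreover have "continuous_on {ln \<rho>..ln r} u"
    proof (rule continuous_at_imp_continuous_on, rule ballI)
      fix x assume "x \<in> {ln \<rho>..ln r}"
      then have "x < 0" using lnr0 by auto
      from DERIV_isCont[OF der[OF this]] show "isCont u x" .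
    qed
    ultimately obtain x1 x2 where x12: "ln \<rho> \<le> x1" "x1 \<le> x2" "x2 \<le> ln r" "u x1 = s" "u x2 = s + 1"
      "\<And>x. x \<in> {x1..x2} \<Longrightarrow> s \<le> u x \<and> u x \<le> s + 1"
      using continuous_crossing[of "ln \<rho>" "ln r" u s "s + 1"] lnr by auto
    have neg: "x < 0" if "x \<in> {x1..x2}" for x using that x12 lnr0 by auto
    define D where "D x = (cmod (deriv \<Phi> (Complex x y)))\<^sup>2" for x
    have Dc: "continuous_on {x1..x2} D"
    proof -
      have "continuous_on R (deriv \<Phi>)"
        using \<Phi> R by (intro holomorphic_on_imp_continuous_on holomorphic_deriv)
      then have "continuous_on {x1..x2} (\<lambda>x. deriv \<Phi> (Complex x y))"
        by (rule continuous_on_compose2) (use inR neg in \<open>auto simp: Complex_eq intro!: continuous_intros\<close>)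
      then show ?thesis unfolding D_def by (intro continuous_intros)
    qed
    then have DI: "(D has_integral integral {x1..x2} D) {x1..x2}"
      by (intro integrable_integral integrable_continuous_real)
    have "((\<lambda>x. Re (deriv \<Phi> (Complex x y))) has_integral u x2 - u x1) {x1..x2}"
      by (rule fundamental_theorem_of_calculus)
         (use x12 der neg in \<open>auto simp: has_real_derivative_iff_has_vector_derivative intro: has_vector_derivative_at_within\<close>)
    then have I1: "((\<lambda>x. Re (deriv \<Phi> (Complex x y))) has_integral 1) {x1..x2}" using x12 by simp
    \<comment> \<open>The Cauchy-Schwarz inequality in pointwise form: d is at most
      \<open>lr / 2\<close> times its square plus \<open>1 / (2 * lr)\<close>. With this weight the
      constant term integrates to at most 1/2 over a length of at most \<open>lr\<close>, and half
      of the unit increment remains for the derivative term.\<close>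
    have I2: "((\<lambda>x. lr / 2 * D x + 1 / (2 * lr)) has_integral lr / 2 * integral {x1..x2} D + (x2 - x1) * (1 / (2 * lr))) {x1..x2}"
      using has_integral_add[OF has_integral_mult_right[OF DI, of "lr/2"] has_integral_const_real[of "1 / (2 * lr)" x1 x2]] x12(2)
      by simp
    have "1 \<le> lr / 2 * integral {x1..x2} D + (x2 - x1) * (1 / (2 * lr))"
    proof (rule has_integral_le[OF I1 I2])
      fix x
      let ?d = "cmod (deriv \<Phi> (Complex x y))"
      have "0 \<le> (lr * ?d - 1)\<^sup>2" by simp
      then have "?d * (2 * lr) \<le> lr\<^sup>2 * D x + 1" by (simp add: D_def power2_eq_square algebra_simps)
      then have "?d \<le> (lr\<^sup>2 * D x + 1) / (2 * lr)" using lr by (simp add: le_divide_eq)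
      also have "\<dots> = lr / 2 * D x + 1 / (2 * lr)" using lr by (simp add: field_simps power2_eq_square)
      finally show "Re (deriv \<Phi> (Complex x y)) \<le> lr / 2 * D x + 1 / (2 * lr)"
        using complex_Re_le_cmod order_trans by blast
    qed
    moreover have "(x2 - x1) * (1 / (2 * lr)) \<le> lr * (1 / (2 * lr))"
      using x12 lnr0 lr by (intro mult_right_mono) (auto simp: lr_def)
    moreover have "lr * (1 / (2 * lr)) = 1 / 2" using lr by simp
    ultimately have "1 / 2 \<le> lr / 2 * integral {x1..x2} D" by linarith
    then have "1 / lr \<le> integral {x1..x2} D" using lr by (simp add: field_simps)
    then have "ennreal (1 / lr) \<le> ennreal (integral {x1..x2} D)" by (rule ennreal_leI)
    also have "\<dots> = (\<integral>\<^sup>+x. ennreal (indicator {x1..x2} x * D x) \<partial>lborel)"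
      using nn_integral_has_integral_lebesgue[OF _ DI] by (simp add: D_def)
    also have "\<dots> \<le> (\<integral>\<^sup>+x. ennreal (F y x) \<partial>lborel)"
    proof (intro nn_integral_mono ennreal_leI)
      fix x
      show "indicator {x1..x2} x * D x \<le> F y x"
      proof (cases "x \<in> {x1..x2}")
        case True
        then have "Complex x y \<in> S" using x12(6)[OF True] inR[OF neg[OF True]] by (simp add: S_def u_def)
        then show ?thesis using True SR by (auto simp: F_def D_def)
      qed (simp add: F_def)
    qed
    finally show ?thesis .
  qed
  show "open Y"
  proof -
    have "open {y\<in>{0<..<2*pi}. s + 1 < Re (f (of_real r * cis y))}" if r: "r \<in> {0<..<1}" for r
    proof -
      have "continuous_on {0<..<2*pi} (\<lambda>y. Re (f (of_real r * cis y)))"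
        using r by (intro continuous_intros continuous_on_compose2[OF holomorphic_on_imp_continuous_on[OF f]])
          (auto simp: norm_mult)
      from continuous_open_preimage[OF this open_greaterThanLessThan, of "{s+1<..}"]
      show ?thesis by (simp add: vimage_def Int_def conj_commute)
    qed
    then have "open (\<Union>r\<in>{0<..<1}. {y\<in>{0<..<2*pi}. s + 1 < Re (f (of_real r * cis y))})" by blast
    moreover have "Y = (\<Union>r\<in>{0<..<1}. {y\<in>{0<..<2*pi}. s + 1 < Re (f (of_real r * cis y))})" by (auto simp: Y_def)
    ultimately show ?thesis by simp
  qed
  then have Yb: "Y \<in> sets lborel" by simp
  \<comment> \<open>Chebyshev's inequality for the ray integrals.\<close>
  have "ennreal (1 / lr) * emeasure lborel Y = (\<integral>\<^sup>+y. ennreal (1 / lr) * indicator Y y \<partial>lborel)"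
    using Yb by (simp add: nn_integral_cmult_indicator)
  also have "\<dots> \<le> (\<integral>\<^sup>+y. \<integral>\<^sup>+x. ennreal (F y x) \<partial>lborel \<partial>lborel)"
    by (intro nn_integral_mono) (use ray in \<open>auto simp: indicator_def\<close>)
  also note area
  finally have *: "ennreal (1 / lr) * emeasure lborel Y \<le> ennreal (2 * pi)" .
  have "emeasure lborel Y = ennreal lr * (ennreal (1 / lr) * emeasure lborel Y)"
    using lr by (simp add: mult.assoc[symmetric] ennreal_mult[symmetric])
  also have "\<dots> \<le> ennreal lr * ennreal (2 * pi)" using * by (rule mult_left_mono) simp
  also have "\<dots> = ennreal (2 * pi * - ln \<rho>)" using lr by (simp add: ennreal_mult[symmetric] lr_def mult_ac)
  finally show "emeasure lborel Y \<le> ennreal (2 * pi * - ln \<rho>)" .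
qed

subsection \<open>Logarithms of univalent functions\<close>

text \<open>By Bloch's theorem the image contains a ball of radius
  \<open>(1 - cmod z) * cmod (deriv f z) / 12\<close>. A radius above pi would place two values
  differing by 2 pi \<i> in the image, at distance pi above and below the centre.\<close>

lemma deriv_bound_of_separated:
  assumes f: "f holomorphic_on unit_disk"
    and sep: "\<And>z w k. z \<in> unit_disk \<Longrightarrow> w \<in> unit_disk \<Longrightarrow> f z = f w + 2 * pi * of_int k * \<i> \<Longrightarrow> z = w"
    and z: "z \<in> unit_disk"
  shows "(1 - cmod z) * cmod (deriv f z) \<le> 12 * pi"
proof (rule ccontr)
  assume n: "\<not> ?thesis"
  have sub: "ball z (1 - cmod z) \<subseteq> unit_disk"
  proof
    fix w assume "w \<in> ball z (1 - cmod z)"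
    then have "cmod (z - w) < 1 - cmod z" by (simp add: dist_norm)
    moreover have "cmod w \<le> cmod z + cmod (z - w)" using norm_triangle_sub[of w z] by (simp add: norm_minus_commute)
    ultimately show "w \<in> unit_disk" by simp
  qed
  define r where "r = (1 - cmod z) * cmod (deriv f z) / 12"
  have r: "r > pi" using n by (simp add: r_def)
  obtain b where b: "ball b r \<subseteq> f ` ball z (1 - cmod z)"
  proof (rule Bloch)
    show "f holomorphic_on ball z (1 - cmod z)" using f sub by (rule holomorphic_on_subset)
  qed (use z in \<open>auto simp: r_def\<close>)
  have "b + pi * \<i> \<in> ball b r" "b - pi * \<i> \<in> ball b r" using r by (simp_all add: dist_norm norm_mult)
  then have "b + pi * \<i> \<in> f ` unit_disk" "b - pi * \<i> \<in> f ` unit_disk" using b sub by blast+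
  then obtain z1 z2 where z12: "z1 \<in> unit_disk" "b + pi * \<i> = f z1" "z2 \<in> unit_disk" "b - pi * \<i> = f z2"
    by (elim imageE)
  have "f z1 = f z2 + 2 * pi * of_int 1 * \<i>" using z12(2,4)[symmetric] by (simp add: algebra_simps)
  then have "z1 = z2" using sep z12 by blast
  then have "b + pi * \<i> = b - pi * \<i>" using z12 by simp
  then show False by (simp add: complex_eq_iff)
qed

text \<open>With \<delta> half the distance of \<open>z\<close> to the unit circle, the derivative
  is at most \<open>12 * pi / \<delta>\<close> on the closed ball of radius \<delta>, so a
  displacement of at most \<delta> changes \<open>f\<close> by at most
  \<open>12 * pi\<close>.\<close>

lemma oscillation_bound_of_separated:
  assumes f: "f holomorphic_on unit_disk"
    and sep: "\<And>z w k. z \<in> unit_disk \<Longrightarrow> w \<in> unit_disk \<Longrightarrow> f z = f w + 2 * pi * of_int k * \<i> \<Longrightarrow> z = w"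
    and z: "z \<in> unit_disk" and w: "cmod (w - z) \<le> (1 - cmod z) / 2"
  shows "cmod (f w - f z) \<le> 12 * pi"
proof -
  define \<delta> where "\<delta> = (1 - cmod z) / 2"
  have \<delta>: "\<delta> > 0" using z by (simp add: \<delta>_def)
  have far: "\<delta> \<le> 1 - cmod x" if "x \<in> cball z \<delta>" for x
  proof -
    have "cmod (x - z) \<le> \<delta>" using that by (simp add: dist_norm norm_minus_commute)
    moreover have "cmod x \<le> cmod z + cmod (x - z)" by (rule norm_triangle_sub)
    ultimately show ?thesis by (simp add: \<delta>_def field_simps)
  qed
  have sub: "cball z \<delta> \<subseteq> unit_disk"
  proof
    fix x assume "x \<in> cball z \<delta>"
    from far[OF this] \<delta> show "x \<in> unit_disk" by simp
  qed
  have "cmod (f w - f z) \<le> (12 * pi / \<delta>) * cmod (w - z)"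
  proof (rule field_differentiable_bound[OF convex_cball])
    fix x assume x: "x \<in> cball z \<delta>"
    then have xD: "x \<in> unit_disk" using sub by blast
    show "(f has_field_derivative deriv f x) (at x within cball z \<delta>)"
      using holomorphic_derivI[OF f open_ball xD] by (rule has_field_derivative_at_within)
    have "\<delta> * cmod (deriv f x) \<le> (1 - cmod x) * cmod (deriv f x)" using far[OF x] by (rule mult_right_mono) simp
    also have "\<dots> \<le> 12 * pi"
      by (rule deriv_bound_of_separated[OF f _ xD]) (erule (2) sep)
    finally show "cmod (deriv f x) \<le> 12 * pi / \<delta>" using \<delta> by (simp add: field_simps)
  qed (use w \<delta> in \<open>auto simp: \<delta>_def dist_norm norm_minus_commute\<close>)
  also have "\<dots> \<le> (12 * pi / \<delta>) * \<delta>" using w \<delta> by (intro mult_left_mono) (auto simp: \<delta>_def)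
  also have "\<dots> = 12 * pi" using \<delta> by simp
  finally show ?thesis .
qed

subsection \<open>Poisson integrals\<close>

text \<open>The real part of a holomorphic function of \<open>z\<close>, so harmonicity is
  immediate; \<open>poisson_eq\<close> recovers the quotient form used for sign and size.\<close>

definition poisson :: "complex \<Rightarrow> complex \<Rightarrow> real" where
  "poisson z \<xi> = Re ((\<xi> + z) / (\<xi> - z))"

lemma poisson_eq: "poisson z \<xi> = ((cmod \<xi>)\<^sup>2 - (cmod z)\<^sup>2) / (cmod (\<xi> - z))\<^sup>2"
proof -
  have "Re (\<xi> + z) * Re (\<xi> - z) + Im (\<xi> + z) * Im (\<xi> - z) = (cmod \<xi>)\<^sup>2 - (cmod z)\<^sup>2"
    unfolding cmod_power2 by (simp add: power2_eq_square algebra_simps)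
  then show ?thesis unfolding poisson_def Re_divide cmod_power2[of "\<xi> - z"] by simp
qed

lemma norm_cis_diff_le: "cmod (cis s - cis t) \<le> \<bar>s - t\<bar>"
proof -
  have "(cmod (cis s - cis t))\<^sup>2 = (cos s - cos t)\<^sup>2 + (sin s - sin t)\<^sup>2"
    by (simp add: cmod_power2)
  also have "\<dots> = ((cos s)\<^sup>2 + (sin s)\<^sup>2) + ((cos t)\<^sup>2 + (sin t)\<^sup>2) - 2 * (cos s * cos t + sin s * sin t)"
    unfolding power2_eq_square by algebra
  also have "\<dots> = 2 - 2 * cos (s - t)" by (simp add: cos_diff)
  also have "\<dots> = (2 * sin ((s - t) / 2))\<^sup>2"
  proof -
    have "2 * ((s - t) / 2) = s - t" by simp
    then have "cos (s - t) = 1 - 2 * (sin ((s - t) / 2))\<^sup>2"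
      using cos_double_sin[of "(s - t) / 2"] by (simp only:)
    then show ?thesis by (simp only: power_mult_distrib) simp
  qed
  finally have "(cmod (cis s - cis t))\<^sup>2 = \<bar>2 * sin ((s - t) / 2)\<bar>\<^sup>2" by (simp only: power2_abs)
  then have "cmod (cis s - cis t) = \<bar>2 * sin ((s - t) / 2)\<bar>"
    by (rule power2_eq_imp_eq) (rule norm_ge_zero, rule abs_ge_zero)
  also have "\<dots> = 2 * \<bar>sin ((s - t) / 2)\<bar>" by (simp add: abs_mult)
  also have "\<dots> \<le> 2 * \<bar>(s - t) / 2\<bar>" using abs_sin_x_le_abs_x[of "(s - t) / 2"] by linarith
  also have "\<dots> = \<bar>s - t\<bar>" by simp
  finally show ?thesis .
qed

context
  fixes Y :: "real set"
  assumes Y: "Y \<in> sets borel" "Y \<subseteq> {0..2*pi}"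
begin

text \<open>The factor 1 / (2 pi) is omitted, so the value at the origin is the Lebesgue measure of
  \<open>Y\<close>.\<close>

definition poisson_integral :: "complex \<Rightarrow> real" where
  "poisson_integral z = (\<integral>t. poisson z (cis t) \<partial>restrict_space lborel Y)"

lemma finite_measure_restrict: "finite_measure (restrict_space lborel Y)"
proof
  have "emeasure lborel Y \<le> emeasure lborel {0..2*pi}" using Y by (intro emeasure_mono) auto
  also have "\<dots> < \<infinity>" by simp
  finally show "emeasure (restrict_space lborel Y) (space (restrict_space lborel Y)) \<noteq> \<infinity>"
    using Y by (simp add: emeasure_restrict_space space_restrict_space)
qed

lemma continuous_on_poisson: "continuous_on (unit_disk \<times> sphere 0 1) (\<lambda>(z, \<xi>). poisson z \<xi>)"
  unfolding poisson_def case_prod_unfold by (intro continuous_intros) auto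

lemma mean_value_on_poisson_integral: "mean_value_on poisson_integral unit_disk"
  unfolding poisson_integral_def
proof (rule mean_value_on_integral[OF open_ball finite_measure_restrict])
  show "cis \<in> borel_measurable (restrict_space lborel Y)"
  proof -
    have "cis \<in> borel_measurable borel" by (intro borel_measurable_continuous_onI continuous_intros)
    then show ?thesis by (intro measurable_restrict_space1) simp
  qed
  show "sphere (0::complex) 1 \<in> sets borel" by simp
  show "continuous_on (unit_disk \<times> sphere 0 1) (\<lambda>(z, \<xi>). poisson z \<xi>)" by (rule continuous_on_poisson)
  show "mean_value_on (\<lambda>z. poisson z \<xi>) unit_disk" if "\<xi> \<in> sphere 0 1" for \<xi>
    unfolding poisson_def by (rule mean_value_onI_Re) (use that in \<open>auto intro!: holomorphic_intros\<close>)
  fix C :: "complex set" assume C: "compact C" "C \<subseteq> unit_disk"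
  have "compact ((\<lambda>(z, \<xi>). poisson z \<xi>) ` (C \<times> sphere 0 1))"
    using C by (intro compact_continuous_image compact_Times continuous_on_subset[OF continuous_on_poisson]) auto
  then have "bounded ((\<lambda>(z, \<xi>). poisson z \<xi>) ` (C \<times> sphere 0 1))" by (rule compact_imp_bounded)
  then obtain B where "\<forall>y\<in>(\<lambda>(z, \<xi>). poisson z \<xi>) ` (C \<times> sphere 0 1). norm y \<le> B" unfolding bounded_iff by blast
  then have "\<forall>z\<in>C. \<forall>\<xi>\<in>sphere 0 1. \<bar>poisson z \<xi>\<bar> \<le> B" by force
  then show "\<exists>B. \<forall>z\<in>C. \<forall>\<xi>\<in>sphere 0 1. \<bar>poisson z \<xi>\<bar> \<le> B" by blast
qed (auto simp: norm_cis)

lemma poisson_nonneg: "cmod z < 1 \<Longrightarrow> 0 \<le> poisson z (cis t)"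
  unfolding poisson_eq by (simp add: abs_square_le_1)

lemma poisson_integral_nonneg: "cmod z < 1 \<Longrightarrow> 0 \<le> poisson_integral z"
  unfolding poisson_integral_def by (rule Bochner_Integration.integral_nonneg) (simp add: poisson_nonneg)

lemma poisson_integral_zero: "poisson_integral 0 = measure lborel Y"
proof -
  have "poisson 0 (cis t) = 1" for t by (simp add: poisson_eq)
  then show ?thesis
    using Y by (simp add: poisson_integral_def space_restrict_space measure_restrict_space)
qed

text \<open>On an arc of length \<open>(1 - r) / 2\<close> next to \<theta> the distance to the
  point is at most \<open>3 / 2 * (1 - r)\<close>, so the kernel is at least
  \<open>4 / (9 * (1 - r))\<close>; the product of this with the arc length is 2/9.\<close>

lemma poisson_integral_ge:
  assumes r: "0 < r" "r < 1" and \<theta>: "\<theta> \<in> {0..2*pi}"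
    and arc: "\<And>t. t \<in> {0<..<2*pi} \<Longrightarrow> \<bar>t - \<theta>\<bar> \<le> (1 - r) / 2 \<Longrightarrow> t \<in> Y"
  shows "2 / 9 \<le> poisson_integral (of_real r * cis \<theta>)"
proof -
  define \<delta> where "\<delta> = (1 - r) / 2"
  define z where "z = of_real r * cis \<theta>"
  have z: "cmod z = r" using r by (simp add: z_def norm_mult)
  have \<delta>: "0 < \<delta>" "\<delta> < 1" using r by (auto simp: \<delta>_def)
  \<comment> \<open>The hypothesis covers only angles strictly between 0 and 2 pi. Taking the half
    of the arc that points towards pi stays in this range even when \<theta> is close to an
    end.\<close>
  obtain c where c: "{c<..<c + \<delta>} \<subseteq> {0<..<2*pi}" "{c<..<c + \<delta>} \<subseteq> {\<theta> - \<delta>..\<theta> + \<delta>}"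
  proof (cases "\<theta> < pi")
    case True
    then show ?thesis using \<theta> \<delta> pi_gt3 by (intro that[of \<theta>]) auto
  next
    case False
    then show ?thesis using \<theta> \<delta> pi_gt3 by (intro that[of "\<theta> - \<delta>"]) auto
  qed
  define I where "I = {c<..<c + \<delta>}"
  have arc': "\<bar>t - \<theta>\<bar> \<le> \<delta>" if "t \<in> I" for t using that c by (force simp: I_def abs_le_iff)
  have IY: "I \<subseteq> Y"
  proof
    fix t assume t: "t \<in> I"
    then have "t \<in> {0<..<2*pi}" using c(1) by (auto simp: I_def)
    then show "t \<in> Y" using arc[of t] arc'[OF t] by (simp add: \<delta>_def)
  qed
  define M where "M = restrict_space lborel Y"
  interpret M: finite_measure M unfolding M_def by (rule finite_measure_restrict)
  have spM: "space M = Y" by (simp add: M_def space_restrict_space)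
  have IM: "I \<in> sets M"
    using IY by (auto simp: M_def sets_restrict_space image_iff I_def intro!: bexI[of _ I])
  have emI: "measure M I = \<delta>"
    using IY Y \<delta> by (simp add: M_def measure_restrict_space) (simp add: I_def)
  have int: "integrable M (\<lambda>t. poisson z (cis t))"
  proof -
    have c: "continuous_on UNIV (\<lambda>t. poisson z (cis t))"
    proof -
      have "cis t - z \<noteq> 0" for t using z r by (metis norm_cis eq_iff_diff_eq_0 less_irrefl)
      then show ?thesis unfolding poisson_def by (intro continuous_intros) auto
    qed
    then have "compact ((\<lambda>t. poisson z (cis t)) ` {0..2*pi})"
      by (intro compact_continuous_image) (auto intro: continuous_on_subset)
    then have "bounded ((\<lambda>t. poisson z (cis t)) ` {0..2*pi})" by (rule compact_imp_bounded)
    then obtain B where B: "\<forall>y\<in>(\<lambda>t. poisson z (cis t)) ` {0..2*pi}. norm y \<le> B" unfolding bounded_iff by blast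
    have "(\<lambda>t. poisson z (cis t)) \<in> borel_measurable borel" using c by (rule borel_measurable_continuous_onI)
    then have "(\<lambda>t. poisson z (cis t)) \<in> borel_measurable M"
      unfolding M_def by (intro measurable_restrict_space1) simp
    then show ?thesis
      using B Y by (intro M.integrable_const_bound[where B=B] AE_I2) (auto simp: spM)
  qed
  have "4 / (9 * (1 - r)) * \<delta> = (\<integral>t. 4 / (9 * (1 - r)) * indicator I t \<partial>M)"
    using IM spM IY emI by (simp add: Int_absorb2)
  also have "\<dots> \<le> (\<integral>t. poisson z (cis t) \<partial>M)"
  proof (rule integral_mono[OF _ int])
    show "integrable M (\<lambda>t. 4 / (9 * (1 - r)) * indicator I t)"
    proof (intro integrable_mult_right integrable_real_indicator IM)
      show "emeasure M I < \<infinity>"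
        unfolding infinity_ennreal_def top.not_eq_extremum[symmetric] using M.emeasure_finite[of I] by simp
    qed
    fix t assume "t \<in> space M"
    show "4 / (9 * (1 - r)) * indicator I t \<le> poisson z (cis t)"
    proof (cases "t \<in> I")
      case True
      have "cmod (cis t - z) \<le> cmod (cis t - cis \<theta>) + cmod (cis \<theta> - z)"
        using norm_triangle_ineq[of "cis t - cis \<theta>" "cis \<theta> - z"] by simp
      also have "cmod (cis t - cis \<theta>) \<le> \<delta>" using norm_cis_diff_le[of t \<theta>] arc'[OF True] by linarith
      also have "cis \<theta> - z = of_real (1 - r) * cis \<theta>" by (simp add: z_def algebra_simps)
      also have "cmod \<dots> = 1 - r" using r by (simp add: norm_mult del: of_real_diff)
      finally have up: "cmod (cis t - z) \<le> 3 / 2 * (1 - r)" by (simp add: \<delta>_def field_simps)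
      have "cis t \<noteq> z" using z r by (metis norm_cis less_irrefl)
      then have pos: "0 < cmod (cis t - z)" by simp
      have frac: "4 / (9 * q) = q / (3 / 2 * q)\<^sup>2" if "0 < q" for q :: real
        using that by (simp add: field_simps power2_eq_square)
      have "4 / (9 * (1 - r)) = (1 - r) / (3 / 2 * (1 - r))\<^sup>2" by (rule frac) (use r in simp)
      also have "\<dots> \<le> (1 - r\<^sup>2) / (cmod (cis t - z))\<^sup>2"
      proof (rule frac_le)
        show "1 - r \<le> 1 - r\<^sup>2" using r by (simp add: power2_eq_square)
        show "(cmod (cis t - z))\<^sup>2 \<le> (3 / 2 * (1 - r))\<^sup>2" using up by (intro power_mono) auto
      qed (use r pos in \<open>auto simp: abs_square_le_1\<close>)
      also have "\<dots> = poisson z (cis t)" by (simp add: poisson_eq z)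
      finally show ?thesis using True by simp
    qed (use poisson_nonneg[of z t] z r in simp)
  qed
  also have "\<dots> = poisson_integral z" by (simp add: poisson_integral_def M_def)
  finally have "4 / (9 * (1 - r)) * \<delta> \<le> poisson_integral z" .
  moreover have "4 / (9 * q) * (q / 2) = 2 / 9" if "0 < q" for q :: real
    using that by (simp add: field_simps)
  from this[of "1 - r"] have "4 / (9 * (1 - r)) * \<delta> = 2 / 9" unfolding \<delta>_def using r(2) by linarith
  ultimately show ?thesis by (simp only: z_def)
qed

end

section \<open>Upper bound for the harmonic measure of a level set\<close>

text \<open>For a logarithm f of \<psi> - a, the condition on \<alpha> makes the real part of f
  exceed \<open>s + 1 + 12 * pi\<close> on the level set. The oscillation bound then puts all angles
  near that of a level-set point into \<open>Y\<close>, so 9/2 times the Poisson integral of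
  \<open>Y\<close> is at least 1 there. Its value at 0 is controlled by the length-area
  estimate.\<close>

proposition harmonic_measure_level_set_le:
  assumes conf: "conformal_map \<psi>" and \<psi>0: "\<psi> 0 = 0" and a: "a \<notin> \<psi> ` unit_disk"
    and \<rho>: "0 < \<rho>" "\<rho> < 1" and le: "\<And>z. cmod z \<le> \<rho> \<Longrightarrow> cmod (\<psi> z) \<le> \<beta>"
    and \<alpha>: "0 < \<alpha>" "exp (12 * pi + 1) * (\<beta> + cmod a) < \<alpha> - cmod a"
  shows "harmonic_measure unit_disk 0 (level_set \<psi> \<alpha>) \<le> 9 * pi * - ln \<rho>"
proof -
  have hol: "\<psi> holomorphic_on unit_disk" and inj: "inj_on \<psi> unit_disk"
    using conf by (auto simp: conformal_map_def)
  have nz: "\<psi> z - a \<noteq> 0" if "z \<in> unit_disk" for z using a that by auto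
  have hol': "(\<lambda>z. \<psi> z - a) holomorphic_on unit_disk" using hol by (intro holomorphic_intros)
  have "0 \<in> unit_disk" by simp
  from holomorphic_logarithm_exists[OF convex_ball open_ball hol' nz this]
  obtain f where f: "f holomorphic_on unit_disk" "\<And>z. z \<in> unit_disk \<Longrightarrow> exp (f z) = \<psi> z - a"
    by blast
  have sep: "z = w" if z: "z \<in> unit_disk" and w: "w \<in> unit_disk" and eq: "f z = f w + 2 * pi * of_int k * \<i>" for z w and k :: int
  proof -
    have "exp (f z) = exp (f w)"
      unfolding eq by (subst exp_eq) (rule exI[of _ k], simp)
    then have "\<psi> z = \<psi> w" using f(2) z w by simp
    then show ?thesis using inj z w by (simp add: inj_on_def)
  qed
  have Re_f: "Re (f z) = ln (cmod (\<psi> z - a))" if "z \<in> unit_disk" for z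
    by (simp flip: f(2)[OF that])
  define s where "s = ln (\<beta> + cmod a)"
  \<comment> \<open>Strict positivity holds because 0 is a value of \<psi>, so the omitted value
    \<open>a\<close> is not 0.\<close>
  have \<beta>: "0 < \<beta> + cmod a"
  proof -
    have "0 \<le> \<beta>" using le[of 0] \<rho> by (simp add: \<psi>0)
    moreover have "a \<noteq> 0" using a \<psi>0 by force
    ultimately show ?thesis by (simp add: add_nonneg_pos)
  qed
  have fs: "Re (f z) \<le> s" if z: "cmod z \<le> \<rho>" for z
  proof -
    have zD: "z \<in> unit_disk" using z \<rho> by simp
    have "cmod (\<psi> z - a) \<le> cmod (\<psi> z) + cmod a" by (rule norm_triangle_ineq4)
    also have "\<dots> \<le> \<beta> + cmod a" using le[OF z] by simp
    finally show ?thesis unfolding Re_f[OF zD] s_def using nz[OF zD] by (intro ln_mono) auto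
  qed
  define Y where "Y = {y\<in>{0<..<2*pi}. \<exists>r\<in>{0<..<1}. s + 1 < Re (f (of_real r * cis y))}"
  have Yo: "open Y"
    by (rule length_area(1)[OF f(1) _ \<rho> fs Y_def]) (erule (2) sep)
  have Ym: "emeasure lborel Y \<le> ennreal (2 * pi * - ln \<rho>)"
    by (rule length_area(2)[OF f(1) _ \<rho> fs Y_def]) (erule (2) sep)
  have Y: "Y \<in> sets borel" "Y \<subseteq> {0..2*pi}" using Yo by (auto simp: Y_def)
  have "measure lborel Y \<le> 2 * pi * - ln \<rho>"
  proof -
    have "0 \<le> 2 * pi * - ln \<rho>" using \<rho> by (simp add: mult_nonneg_nonpos)
    then show ?thesis unfolding measure_def using Ym by (rule enn2real_leI)
  qed
  interpret E: relatively_closed_in_disk "level_set \<psi> \<alpha>"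
    by unfold_locales (use closedin_level_set[OF hol] \<psi>0 \<alpha> in \<open>auto simp: level_set_def\<close>)
  have "harmonic_measure unit_disk 0 (level_set \<psi> \<alpha>) \<le> 9 / 2 * poisson_integral Y 0"
  proof (rule E.harmonic_measure_le[OF mean_value_on_cmult[OF mean_value_on_poisson_integral[OF Y]]])
    show "0 \<le> 9 / 2 * poisson_integral Y z" if "z \<in> unit_disk" for z
      using that poisson_integral_nonneg[OF Y, of z] by simp
    fix z assume "z \<in> level_set \<psi> \<alpha>"
    then have zD: "z \<in> unit_disk" and z\<alpha>: "cmod (\<psi> z) = \<alpha>" by (auto simp: level_set_def)
    have "z \<noteq> 0" using z\<alpha> \<psi>0 \<alpha> by auto
    define r where "r = cmod z"
    define \<theta> where "\<theta> = Arg2pi z"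
    have r: "0 < r" "r < 1" using zD \<open>z \<noteq> 0\<close> by (auto simp: r_def)
    have z_eq: "z = of_real r * cis \<theta>"
      using Arg2pi_eq[of z] by (simp add: r_def \<theta>_def cis_conv_exp)
    have \<theta>: "\<theta> \<in> {0..2*pi}" using Arg2pi_ge_0[of z] Arg2pi_lt_2pi[of z] by (simp add: \<theta>_def)
    have "exp (12 * pi + 1 + s) < cmod (\<psi> z - a)"
    proof -
      have "exp (12 * pi + 1 + s) = exp (12 * pi + 1) * (\<beta> + cmod a)" using \<beta> by (simp add: exp_add s_def)
      also have "\<dots> < \<alpha> - cmod a" by (rule \<alpha>)
      also have "\<dots> \<le> cmod (\<psi> z - a)" using norm_triangle_ineq2[of "\<psi> z" a] z\<alpha> by simp
      finally show ?thesis .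
    qed
    then have "ln (exp (12 * pi + 1 + s)) < ln (cmod (\<psi> z - a))" by (subst ln_less_cancel_iff) (use nz[OF zD] in auto)
    then have big: "12 * pi + 1 + s < Re (f z)" using Re_f[OF zD] by simp
    have "2 / 9 \<le> poisson_integral Y (of_real r * cis \<theta>)"
    proof (rule poisson_integral_ge[OF Y r \<theta>])
      fix t assume t: "t \<in> {0<..<2*pi}" "\<bar>t - \<theta>\<bar> \<le> (1 - r) / 2"
      have "of_real r * cis t - z = of_real r * (cis t - cis \<theta>)" by (simp add: z_eq algebra_simps)
      then have "cmod (of_real r * cis t - z) = r * cmod (cis t - cis \<theta>)" using r by (simp add: norm_mult)
      also have "\<dots> \<le> 1 * \<bar>t - \<theta>\<bar>" using r norm_cis_diff_le[of t \<theta>] by (intro mult_mono) auto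
      also have "\<dots> \<le> (1 - cmod z) / 2" using t by (simp add: r_def)
      finally have near: "cmod (of_real r * cis t - z) \<le> (1 - cmod z) / 2" .
      have "cmod (f (of_real r * cis t) - f z) \<le> 12 * pi"
        by (rule oscillation_bound_of_separated[OF f(1) _ zD near]) (erule (2) sep)
      then have "\<bar>Re (f (of_real r * cis t)) - Re (f z)\<bar> \<le> 12 * pi"
        using abs_Re_le_cmod[of "f (of_real r * cis t) - f z"] by simp
      then have "s + 1 < Re (f (of_real r * cis t))" using big by linarith
      then show "t \<in> Y" using t r by (auto simp: Y_def)
    qed
    then show "1 \<le> 9 / 2 * poisson_integral Y z" by (simp add: z_eq)
  qed
  also have "\<dots> = 9 / 2 * measure lborel Y" by (simp add: poisson_integral_zero[OF Y])
  also have "\<dots> \<le> 9 / 2 * (2 * pi * - ln \<rho>)" using \<open>measure lborel Y \<le> 2 * pi * - ln \<rho>\<close> by simp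
  finally show ?thesis by simp
qed

subsection \<open>Comparison of the growth rates\<close>

lemma log_inverse_antimono: "0 \<le> x \<Longrightarrow> x \<le> y \<Longrightarrow> log_inverse y \<le> log_inverse x"
  by (auto simp: log_inverse_def ln_inverse)

lemma log_inverse_eq: "0 < x \<Longrightarrow> log_inverse x = ereal (- ln x)"
  by (simp add: log_inverse_def ln_inverse)

lemma hyp_dist_zero: "hyp_dist 0 w = ln ((1 + cmod w) / (1 - cmod w))"
  by (simp add: hyp_dist_def)

lemma level_set_nonzero:
  assumes "\<psi> 0 = 0" "0 < \<alpha>"
  shows "0 \<notin> level_set \<psi> \<alpha>"
  using assms by (auto simp: level_set_def)

text \<open>If the level set at \<beta> is at hyperbolic distance more than \<open>x\<close> from 0,
  then \<psi> is bounded by \<beta> on the hyperbolic disk of radius \<open>x\<close>. The upper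
  bound for harmonic measure at the larger level \<alpha> then decays like
  \<open>exp (- x)\<close>.\<close>

lemma hyp_dist_set_le_log_inverse:
  assumes conf: "conformal_map \<psi>" and \<psi>0: "\<psi> 0 = 0" and a: "a \<notin> \<psi> ` unit_disk"
    and \<beta>: "0 < \<beta>" and \<alpha>: "exp (12 * pi + 1) * (\<beta> + cmod a) < \<alpha> - cmod a"
  shows "hyp_dist_set 0 (level_set \<psi> \<beta>) \<le> log_inverse (harmonic_measure unit_disk 0 (level_set \<psi> \<alpha>)) + ereal (ln (36 * pi))"
proof (rule ccontr)
  define h where "h = harmonic_measure unit_disk 0 (level_set \<psi> \<alpha>)"
  assume "\<not> ?thesis"
  then have "log_inverse h + ereal (ln (36 * pi)) < hyp_dist_set 0 (level_set \<psi> \<beta>)" by (simp add: h_def not_le)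
  \<comment> \<open>A real number in the gap, so that the case of infinite distance needs no
    separate treatment.\<close>
  then obtain x where x: "log_inverse h + ereal (ln (36 * pi)) < ereal x" "ereal x < hyp_dist_set 0 (level_set \<psi> \<beta>)"
    using ereal_dense2 by blast
  have hol: "\<psi> holomorphic_on unit_disk" using conf by (simp add: conformal_map_def)
  have "0 \<le> exp (12 * pi + 1) * (\<beta> + cmod a)" using \<beta> by simp
  then have \<alpha>0: "0 < \<alpha>" using \<alpha> norm_ge_zero[of a] by linarith
  interpret E: relatively_closed_in_disk "level_set \<psi> \<alpha>"
    by unfold_locales (rule closedin_level_set[OF hol], rule level_set_nonzero[of \<psi> \<alpha>, OF \<psi>0 \<alpha>0])
  have h01: "0 \<le> h" "h \<le> 1" unfolding h_def by (rule E.harmonic_measure_nonneg, rule E.harmonic_measure_le_1)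
  have "0 \<le> log_inverse h" using log_inverse_antimono[OF h01] by (simp add: log_inverse_eq zero_ereal_def)
  then have "0 + ereal (ln (36 * pi)) \<le> log_inverse h + ereal (ln (36 * pi))" by (rule add_right_mono)
  then have "ereal (ln (36 * pi)) < ereal x" using x(1) unfolding add_0_left by (rule order_le_less_trans)
  then have "ln (36 * pi) < x" by simp
  then have "exp (ln (36 * pi)) < exp x" by (rule exp_less_mono)
  then have ex: "2 \<le> exp x" using pi_gt3 by simp
  \<comment> \<open>The Euclidean radius of the hyperbolic disk of radius \<open>x\<close> about 0,
    so that \<open>(1 + \<rho>) / (1 - \<rho>) = exp x\<close>.\<close>
  define \<rho> where "\<rho> = (exp x - 1) / (exp x + 1)"
  have \<rho>: "0 < \<rho>" "\<rho> < 1"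
    unfolding \<rho>_def using ex by (intro divide_pos_pos, linarith+) (simp add: divide_less_eq add_pos_pos)
  \<comment> \<open>A larger value would force the segment from 0 to \<open>z\<close> to meet the
    level set at \<beta> within hyperbolic distance \<open>x\<close>.\<close>
  have le: "cmod (\<psi> z) \<le> \<beta>" if z: "cmod z \<le> \<rho>" for z
  proof (rule ccontr)
    assume gt: "\<not> cmod (\<psi> z) \<le> \<beta>"
    have inD: "of_real t * z \<in> unit_disk" if "t \<in> {0..1}" for t
    proof -
      have "t * cmod z \<le> 1 * \<rho>" using that z \<rho> by (intro mult_mono) auto
      then show ?thesis using that \<rho> by (simp add: norm_mult)
    qed
    have "continuous_on {0..1} (\<lambda>t. cmod (\<psi> (of_real t * z)))"
      by (intro continuous_intros continuous_on_compose2[OF holomorphic_on_imp_continuous_on[OF hol]])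
        (use inD in auto)
    moreover have "cmod (\<psi> (of_real 0 * z)) \<le> \<beta>" "\<beta> \<le> cmod (\<psi> (of_real 1 * z))" using \<psi>0 \<beta> gt by auto
    ultimately obtain t where t: "0 \<le> t" "t \<le> 1" "cmod (\<psi> (of_real t * z)) = \<beta>"
      using IVT'[of "\<lambda>t. cmod (\<psi> (of_real t * z))" 0 \<beta> 1] by auto
    define w where "w = of_real t * z"
    have wF: "w \<in> level_set \<psi> \<beta>" using t inD[of t] by (simp add: w_def level_set_def)
    have "t * cmod z \<le> 1 * \<rho>" using t z \<rho> by (intro mult_mono) auto
    then have w: "cmod w \<le> \<rho>" using t by (simp add: w_def norm_mult)
    have "hyp_dist_set 0 (level_set \<psi> \<beta>) \<le> ereal (hyp_dist 0 w)"
      unfolding hyp_dist_set_def using wF by (rule INF_lower)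
    also have "hyp_dist 0 w \<le> ln (exp x)"
      unfolding hyp_dist_zero
    proof (rule ln_mono)
      have "(1 + cmod w) / (1 - cmod w) \<le> (1 + \<rho>) / (1 - \<rho>)" using w \<rho> by (intro frac_le) auto
      also have "\<dots> = exp x" using ex by (simp add: \<rho>_def field_simps)
      finally show "(1 + cmod w) / (1 - cmod w) \<le> exp x" .
    qed (use w \<rho> in \<open>auto intro!: divide_pos_pos add_pos_nonneg\<close>)
    finally show False using x(2) by simp
  qed
  have "h \<le> 9 * pi * - ln \<rho>"
    unfolding h_def by (rule harmonic_measure_level_set_le[OF conf \<psi>0 a \<rho> le \<alpha>0 \<alpha>])
  \<comment> \<open>The bound \<open>2 \<le> exp x\<close> makes \<open>exp x - 1\<close> at least
    half of \<open>exp x\<close>; this yields \<open>4 / exp x\<close>, and 9 times 4 is the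
    constant 36.\<close>
  also have "- ln \<rho> = ln (1 + 2 / (exp x - 1))"
    using ex by (simp add: \<rho>_def ln_div field_simps)
  also have "\<dots> \<le> 2 / (exp x - 1)" using ex by (intro ln_add_one_self_le_self divide_nonneg_nonneg) linarith+
  also have "2 / (exp x - 1) = 4 / (2 * (exp x - 1))"
    using ex by (auto simp: divide_eq_eq eq_divide_eq)
  also have "\<dots> \<le> 4 / exp x" by (rule frac_le) (use ex in \<open>linarith | simp\<close>)+
  finally have h: "h \<le> 36 * pi / exp x" by simp
  have "ereal (- ln (36 * pi / exp x)) \<le> log_inverse h"
    using log_inverse_antimono[OF h01(1) h] by (simp add: log_inverse_eq)
  also have "- ln (36 * pi / exp x) = x - ln (36 * pi)" by (simp add: ln_div)
  finally have "ereal (x - ln (36 * pi)) + ereal (ln (36 * pi)) \<le> log_inverse h + ereal (ln (36 * pi))"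
    by (rule add_right_mono)
  then have "ereal x \<le> log_inverse h + ereal (ln (36 * pi))" by simp
  then show False using x(1) by (simp add: not_less[symmetric])
qed

text \<open>The maximal component has at least the harmonic measure of the component through any
  given \<open>w\<close>, which is at least \<open>(1 - cmod w) / 32\<close>. Since ln (1 + |w|) is
  nonnegative, \<open>- ln (1 - cmod w)\<close> is at most the hyperbolic distance. An empty level
  set is covered because its distance is infinite.\<close>

lemma log_inverse_max_component_le:
  assumes conf: "conformal_map \<psi>" and \<psi>0: "\<psi> 0 = 0"
    and a: "a \<notin> \<psi> ` unit_disk" "cmod a < \<alpha>" and C: "is_max_component \<psi> \<alpha> C"
  shows "log_inverse (harmonic_measure unit_disk 0 C) \<le> hyp_dist_set 0 (level_set \<psi> \<alpha>) + ereal (ln 32)"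
proof -
  have "log_inverse (harmonic_measure unit_disk 0 C) - ereal (ln 32) \<le> hyp_dist_set 0 (level_set \<psi> \<alpha>)"
    unfolding hyp_dist_set_def
  proof (rule INF_greatest)
    fix w assume w: "w \<in> level_set \<psi> \<alpha>"
    have w1: "cmod w < 1" using w by (simp add: level_set_def)
    have "connected_component_set (level_set \<psi> \<alpha>) w \<in> components (level_set \<psi> \<alpha>)"
      using w by (auto simp: components_def)
    then have "harmonic_measure unit_disk 0 (connected_component_set (level_set \<psi> \<alpha>) w) \<le> harmonic_measure unit_disk 0 C"
      using C w by (auto simp: is_max_component_def split: if_splits)
    with harmonic_measure_component_ge[OF conf \<psi>0 a w]
    have "(1 - cmod w) / 32 \<le> harmonic_measure unit_disk 0 C" by linarith
    then have "log_inverse (harmonic_measure unit_disk 0 C) \<le> log_inverse ((1 - cmod w) / 32)"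
      using w1 by (intro log_inverse_antimono) auto
    also have "\<dots> = ereal (ln 32 - ln (1 - cmod w))" using w1 by (simp add: log_inverse_eq ln_div)
    also have "ln 32 - ln (1 - cmod w) \<le> hyp_dist 0 w + ln 32"
    proof -
      have "ln ((1 + cmod w) / (1 - cmod w)) = ln (1 + cmod w) - ln (1 - cmod w)"
        using w1 add_pos_nonneg[OF zero_less_one norm_ge_zero[of w]] by (simp add: ln_div)
      moreover have "0 \<le> ln (1 + cmod w)" by simp
      ultimately show ?thesis by (simp add: hyp_dist_zero)
    qed
    finally show "log_inverse (harmonic_measure unit_disk 0 C) - ereal (ln 32) \<le> ereal (hyp_dist 0 w)"
      by (simp add: ereal_minus_le)
  qed
  then show ?thesis by (simp add: ereal_minus_le)
qed

lemma log_inverse_level_set_le: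
  assumes conf: "conformal_map \<psi>" and \<psi>0: "\<psi> 0 = 0" and \<alpha>: "0 < \<alpha>" and C: "is_max_component \<psi> \<alpha> C"
  shows "log_inverse (harmonic_measure unit_disk 0 (level_set \<psi> \<alpha>)) \<le> log_inverse (harmonic_measure unit_disk 0 C)"
proof (cases "level_set \<psi> \<alpha> = {}")
  case True
  then show ?thesis using C by (simp add: is_max_component_def)
next
  case False
  have hol: "\<psi> holomorphic_on unit_disk" using conf by (simp add: conformal_map_def)
  have C': "C \<in> components (level_set \<psi> \<alpha>)" using C False by (simp add: is_max_component_def)
  have zero: "0 \<notin> level_set \<psi> \<alpha>" by (rule level_set_nonzero[of \<psi> \<alpha>, OF \<psi>0 \<alpha>])
  have cl: "closedin (top_of_set unit_disk) C" using hol C' by (rule closedin_component_level_set)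
  have sub: "C \<subseteq> level_set \<psi> \<alpha>" using C' by (rule in_components_subset)
  interpret C: relatively_closed_in_disk C by unfold_locales (use cl zero sub in auto)
  show ?thesis
    by (rule log_inverse_antimono[OF C.harmonic_measure_nonneg
          harmonic_measure_mono[OF cl closedin_level_set[OF hol] sub zero]])
qed

section \<open>Limits of quotients by the logarithm in the extended reals\<close>

lemma ereal_add_divide:
  assumes "0 < l"
  shows "(x + ereal c) / ereal l = x / ereal l + ereal (c / l)"
  using assms by (cases x) (auto simp: add_divide_distrib)

lemma ereal_divide_rescale:
  assumes "0 < l" "0 < m"
  shows "x / ereal l = x / ereal m * ereal (m / l)"
  using assms by (cases x) auto

lemma tendsto_const_div_ln: "((\<lambda>\<alpha>. ereal (c / ln \<alpha>)) \<longlongrightarrow> 0) at_top"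
proof -
  have "((\<lambda>\<alpha>. c / ln \<alpha>) \<longlongrightarrow> 0) at_top"
    by (rule tendsto_divide_0[OF tendsto_const]) (rule filterlim_at_top_imp_at_infinity[OF ln_at_top])
  then show ?thesis by (simp add: zero_ereal_def)
qed

theorem theorem1p3:
  fixes \<psi> :: "complex \<Rightarrow> complex" and Fstar :: "real \<Rightarrow> complex set" and L :: ereal
  assumes "conformal_map \<psi>" and "\<psi> 0 = 0"
    and "0 \<le> L"
    and "((\<lambda>\<alpha>. log_inverse (harmonic_measure unit_disk 0 (level_set \<psi> \<alpha>)) / ereal (ln \<alpha>))
           \<longlongrightarrow> L) at_top"
    and "\<And>\<alpha>. \<alpha> > 0 \<Longrightarrow> is_max_component \<psi> \<alpha> (Fstar \<alpha>)"
  shows "((\<exists>\<mu>::ereal. 0 \<le> \<mu> \<and>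
            ((\<lambda>\<alpha>. hyp_dist_set 0 (level_set \<psi> \<alpha>) / ereal (ln \<alpha>)) \<longlongrightarrow> \<mu>) at_top)
         \<longleftrightarrow>
         Limsup at_top (\<lambda>\<alpha>. log_inverse (harmonic_measure unit_disk 0 (Fstar \<alpha>)) / ereal (ln \<alpha>)) = L)
         \<and> (\<forall>\<mu>::ereal. ((\<lambda>\<alpha>. hyp_dist_set 0 (level_set \<psi> \<alpha>) / ereal (ln \<alpha>)) \<longlongrightarrow> \<mu>) at_top
           \<longrightarrow> \<mu> = L)"
proof -
  define A where "A \<alpha> = log_inverse (harmonic_measure unit_disk 0 (level_set \<psi> \<alpha>))" for \<alpha>
  define B where "B \<alpha> = log_inverse (harmonic_measure unit_disk 0 (Fstar \<alpha>))" for \<alpha>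
  define D where "D \<alpha> = hyp_dist_set 0 (level_set \<psi> \<alpha>)" for \<alpha>
  have A: "((\<lambda>\<alpha>. A \<alpha> / ereal (ln \<alpha>)) \<longlongrightarrow> L) at_top" using assms(4) by (simp add: A_def)
  obtain a where a: "a \<notin> \<psi> ` unit_disk" using conformal_map_omits[OF assms(1)] .
  define K where "K = exp (12 * pi + 1)"
  have K: "1 < K" unfolding K_def using pi_gt_zero by (simp add: add_pos_pos)
  \<comment> \<open>A dilation factor of twice \<open>K\<close> leaves room to absorb the terms with
    \<open>cmod a\<close> once \<alpha> is large.\<close>
  define c where "c = 2 * K"
  have c: "0 < c" "1 < c" using K by (simp_all add: c_def)
  \<comment> \<open>Beyond this threshold \<open>ln \<alpha>\<close> is positive, the circle of
    radius \<alpha> encloses \<open>a\<close>, and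
    \<open>K * (\<alpha> + cmod a) < c * \<alpha> - cmod a\<close>.\<close>
  define \<alpha>\<^sub>0 where "\<alpha>\<^sub>0 = max (max 1 (cmod a)) (K * cmod a + cmod a)"
  have ev: "eventually (\<lambda>\<alpha>. \<alpha>\<^sub>0 < \<alpha>) at_top" by (rule eventually_gt_at_top)
  have AB: "A \<alpha> / ereal (ln \<alpha>) \<le> B \<alpha> / ereal (ln \<alpha>)" if "\<alpha>\<^sub>0 < \<alpha>" for \<alpha>
  proof -
    have "1 < \<alpha>" using that by (simp add: \<alpha>\<^sub>0_def)
    then show ?thesis
      unfolding A_def B_def
      by (intro ereal_divide_right_mono log_inverse_level_set_le assms(1,2,5)) auto
  qed
  have BD: "B \<alpha> / ereal (ln \<alpha>) \<le> D \<alpha> / ereal (ln \<alpha>) + ereal (ln 32 / ln \<alpha>)" if "\<alpha>\<^sub>0 < \<alpha>" for \<alpha>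
  proof -
    have \<alpha>: "1 < \<alpha>" "cmod a < \<alpha>" using that by (simp_all add: \<alpha>\<^sub>0_def)
    have "B \<alpha> \<le> D \<alpha> + ereal (ln 32)"
      unfolding B_def D_def by (rule log_inverse_max_component_le[OF assms(1,2) a \<alpha>(2)]) (use assms(5) \<alpha> in auto)
    then have "B \<alpha> / ereal (ln \<alpha>) \<le> (D \<alpha> + ereal (ln 32)) / ereal (ln \<alpha>)"
      using \<alpha> by (intro ereal_divide_right_mono) auto
    also have "\<dots> = D \<alpha> / ereal (ln \<alpha>) + ereal (ln 32 / ln \<alpha>)" using \<alpha> by (intro ereal_add_divide) simp
    finally show ?thesis .
  qed
  have DA: "D \<alpha> / ereal (ln \<alpha>) \<le> A (c * \<alpha>) / ereal (ln (c * \<alpha>)) * ereal (ln (c * \<alpha>) / ln \<alpha>) + ereal (ln (36 * pi) / ln \<alpha>)"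
    if "\<alpha>\<^sub>0 < \<alpha>" for \<alpha>
  proof -
    have \<alpha>: "1 < \<alpha>" "K * cmod a + cmod a < \<alpha>" using that by (simp_all add: \<alpha>\<^sub>0_def)
    have "1 * \<alpha> \<le> K * \<alpha>" using K \<alpha> by (intro mult_right_mono) auto
    moreover have "K * (\<alpha> + cmod a) = K * \<alpha> + K * cmod a" "c * \<alpha> = K * \<alpha> + K * \<alpha>"
      by (simp_all add: c_def algebra_simps)
    ultimately have "K * (\<alpha> + cmod a) < c * \<alpha> - cmod a" using \<alpha> by linarith
    then have "D \<alpha> \<le> A (c * \<alpha>) + ereal (ln (36 * pi))"
      unfolding A_def D_def K_def using \<alpha> by (intro hyp_dist_set_le_log_inverse[OF assms(1,2) a]) auto
    then have "D \<alpha> / ereal (ln \<alpha>) \<le> (A (c * \<alpha>) + ereal (ln (36 * pi))) / ereal (ln \<alpha>)"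
      using \<alpha> by (intro ereal_divide_right_mono) auto
    also have "\<dots> = A (c * \<alpha>) / ereal (ln \<alpha>) + ereal (ln (36 * pi) / ln \<alpha>)" using \<alpha> by (intro ereal_add_divide) simp
    also have "A (c * \<alpha>) / ereal (ln \<alpha>) = A (c * \<alpha>) / ereal (ln (c * \<alpha>)) * ereal (ln (c * \<alpha>) / ln \<alpha>)"
    proof (rule ereal_divide_rescale)
      show "0 < ln \<alpha>" using \<alpha> by simp
      have "1 * 1 < c * \<alpha>" using c \<alpha> by (intro mult_strict_mono) auto
      then show "0 < ln (c * \<alpha>)" by simp
    qed
    finally show ?thesis .
  qed
  \<comment> \<open>The lower bound goes through the maximal components,
    \<open>A \<le> B \<le> D + ln 32\<close>; the upper bound compares with \<open>A\<close> at the
    dilated level \<open>c * \<alpha>\<close>. Additive constants vanish after division by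
    \<open>ln \<alpha>\<close>, also when \<open>L\<close> is infinite.\<close>
  have D: "((\<lambda>\<alpha>. D \<alpha> / ereal (ln \<alpha>)) \<longlongrightarrow> L) at_top"
  proof (rule tendsto_sandwich)
    show "eventually (\<lambda>\<alpha>. A \<alpha> / ereal (ln \<alpha>) + ereal (- ln 32 / ln \<alpha>) \<le> D \<alpha> / ereal (ln \<alpha>)) at_top"
      using ev
    proof eventually_elim
      case (elim \<alpha>)
      have "A \<alpha> / ereal (ln \<alpha>) \<le> D \<alpha> / ereal (ln \<alpha>) + ereal (ln 32 / ln \<alpha>)"
        using AB[OF elim] BD[OF elim] by (rule order_trans)
      then have "A \<alpha> / ereal (ln \<alpha>) - ereal (ln 32 / ln \<alpha>) \<le> D \<alpha> / ereal (ln \<alpha>)"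
        by (simp add: ereal_minus_le)
      then show ?case by (simp add: minus_ereal_def)
    qed
    show "eventually (\<lambda>\<alpha>. D \<alpha> / ereal (ln \<alpha>) \<le> A (c * \<alpha>) / ereal (ln (c * \<alpha>)) * ereal (ln (c * \<alpha>) / ln \<alpha>)
        + ereal (ln (36 * pi) / ln \<alpha>)) at_top"
      using ev by eventually_elim (rule DA)
    have "((\<lambda>\<alpha>. A \<alpha> / ereal (ln \<alpha>) + ereal (- ln 32 / ln \<alpha>)) \<longlongrightarrow> L + 0) at_top"
      by (rule tendsto_add_ereal_general[OF _ A tendsto_const_div_ln]) simp
    then show "((\<lambda>\<alpha>. A \<alpha> / ereal (ln \<alpha>) + ereal (- ln 32 / ln \<alpha>)) \<longlongrightarrow> L) at_top" by simp
    have "filterlim (\<lambda>\<alpha>. c * \<alpha>) at_top at_top"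
      by (rule filterlim_tendsto_pos_mult_at_top[OF tendsto_const c(1) filterlim_ident])
    with A have Ac: "((\<lambda>\<alpha>. A (c * \<alpha>) / ereal (ln (c * \<alpha>))) \<longlongrightarrow> L) at_top"
      by (rule filterlim_compose)
    \<comment> \<open>Dilation by \<open>c\<close> does not affect the limit, because the ratio of
      the two logarithms tends to 1. As this limit is finite and nonzero, the product rule holds for
      every \<open>L\<close>, including 0 and \<infinity>.\<close>
    have "((\<lambda>\<alpha>. ereal (ln c / ln \<alpha>) + ereal 1) \<longlongrightarrow> 0 + ereal 1) at_top"
      by (rule tendsto_add_ereal_general[OF _ tendsto_const_div_ln tendsto_const]) simp
    then have "((\<lambda>\<alpha>. ereal (ln (c * \<alpha>) / ln \<alpha>)) \<longlongrightarrow> 0 + ereal 1) at_top"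
    proof (rule Lim_transform_eventually)
      show "eventually (\<lambda>\<alpha>. ereal (ln c / ln \<alpha>) + ereal 1 = ereal (ln (c * \<alpha>) / ln \<alpha>)) at_top"
        using eventually_gt_at_top[of 1]
      proof eventually_elim
        case (elim \<alpha>)
        then have "ln (c * \<alpha>) / ln \<alpha> = ln c / ln \<alpha> + 1" using c by (simp add: ln_mult field_simps)
        then show ?case by simp
      qed
    qed
    then have "((\<lambda>\<alpha>. A (c * \<alpha>) / ereal (ln (c * \<alpha>)) * ereal (ln (c * \<alpha>) / ln \<alpha>)) \<longlongrightarrow> L * (0 + ereal 1)) at_top"
      by (rule tendsto_mult_ereal[OF Ac]) auto
    from tendsto_add_ereal_general[OF _ this tendsto_const_div_ln[of "ln (36 * pi)"]]
    show "((\<lambda>\<alpha>. A (c * \<alpha>) / ereal (ln (c * \<alpha>)) * ereal (ln (c * \<alpha>) / ln \<alpha>) + ereal (ln (36 * pi) / ln \<alpha>)) \<longlongrightarrow> L) at_top"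
      by simp
  qed
  have "((\<lambda>\<alpha>. B \<alpha> / ereal (ln \<alpha>)) \<longlongrightarrow> L) at_top"
  proof (rule tendsto_sandwich[OF _ _ A])
    show "eventually (\<lambda>\<alpha>. A \<alpha> / ereal (ln \<alpha>) \<le> B \<alpha> / ereal (ln \<alpha>)) at_top"
      using ev by eventually_elim (rule AB)
    show "eventually (\<lambda>\<alpha>. B \<alpha> / ereal (ln \<alpha>) \<le> D \<alpha> / ereal (ln \<alpha>) + ereal (ln 32 / ln \<alpha>)) at_top"
      using ev by eventually_elim (rule BD)
    have "((\<lambda>\<alpha>. D \<alpha> / ereal (ln \<alpha>) + ereal (ln 32 / ln \<alpha>)) \<longlongrightarrow> L + 0) at_top"
      by (rule tendsto_add_ereal_general[OF _ D tendsto_const_div_ln]) simp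
    then show "((\<lambda>\<alpha>. D \<alpha> / ereal (ln \<alpha>) + ereal (ln 32 / ln \<alpha>)) \<longlongrightarrow> L) at_top" by simp
  qed
  then have "Limsup at_top (\<lambda>\<alpha>. B \<alpha> / ereal (ln \<alpha>)) = L"
    by (intro lim_imp_Limsup) auto
  \<comment> \<open>Uniqueness of limits in the Hausdorff space of extended reals.\<close>
  moreover have "\<mu> = L" if "((\<lambda>\<alpha>. D \<alpha> / ereal (ln \<alpha>)) \<longlongrightarrow> \<mu>) at_top" for \<mu>
    using that D by (rule tendsto_unique[rotated]) simp
  ultimately show ?thesis
    using D assms(3) unfolding B_def D_def by blast
qed

end
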